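(* Let $G(\lambda)$ be skew-symmetric and let $\mathcal S(\lambda)=\left[\begin{array}{c|c}P(\lambda)&-B^TJ^T\\ \hline B&\lambda I_r-A\end{array}\right]$ be the system matrix of a minimal skew-Hamiltonian realization $G(\lambda)=P(\lambda)+B^TJ^T(\lambda I_r-A)^{-1}B$, $r=2\ell$. Let $0\le h\le m-1$ be even; $\mathbf w$ the simple admissible tuple of $\{0:h\}$ with symmetric complement $\mathbf c_w$; $\mathbf z+m$ any admissible tuple of $\{0:m-h-1\}$ with symmetric complement $\mathbf c_z+m$; and let $\mathbf t_w$, with indices from $\{0:h-1\}$, and $\mathbf t_z+m$, with indices from $\{0:m-h-2\}$, be right index tuples of type-1 relative to $\mathrm{rev}(\mathbf w)$ and $\mathrm{rev}(\mathbf z+m)$, respectively. Let $L(\lambda)=M^P_{\mathrm{rev}(\mathbf t_z)}M^P_{\mathrm{rev}(\mathbf t_w)}(\lambda M^P_{\mathbf z}-M^P_{\mathbf w})M^P_{\mathbf c_w}M^P_{\mathbf t_w}M^P_{\mathbf c_z}M^P_{\mathbf t_z}$, $\alpha=c_0(\mathbf w,\mathbf c_w,\mathbf t_w)$, $Q$ the (unique up to multiplication by $-1$) quasi-identity matrix such that $QL(\lambda)$ is skew-symmetric, and $\mathbf s$ the $(m-\alpha)$-th parameter of $Q$. Suppose that $0\notin\mathbf t_w$ (resp. $-m\notin\mathbf t_z$) when $A_0$ (resp. $A_m$) is singular. Assume that $\mathrm{Ind}(\mathbf z+m)=0$ when $A_m$ is singular. Then $$\mathbb T(\lambda)=\left[\begin{array}{c|c}\mathbf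 s\,QL(\lambda)&-e_{m-\alpha}\otimes B^TJ^T\\ \hline e^T_{m-\alpha}\otimes B&\lambda I_r-A\end{array}\right]$$ is a skew-Hamiltonian Rosenbrock strong linearization of $G(\lambda)$. The transfer function $\mathbb G(\lambda)=\mathbf s\,QL(\lambda)+(e_{m-\alpha}\otimes B^TJ^T)(\lambda I_r-A)^{-1}(e^T_{m-\alpha}\otimes B)$ of $\mathbb T(\lambda)$ is skew-symmetric.
   Context: Setting: a rational matrix or pencil $F(\lambda)$ is skew-symmetric if $F(\lambda)^T=-F(\lambda)$. $P(\lambda)=\sum_{i=0}^m\lambda^iA_i$, $A_i\in\mathbb C^{n\times n}$, $A_m\ne0$, $m\ge1$. For $r=2\ell$, $J=\begin{bmatrix}0&I_\ell\\ -I_\ell&0\end{bmatrix}$, $\mathbb J_{k,r}=\mathrm{diag}(I_k,J)$; $X\in\mathbb C^{r\times r}$ is skew-Hamiltonian if $(JX)^T=-JX$. A skew-Hamiltonian realization is $G(\lambda)=P(\lambda)+C(\lambda I_r-A)^{-1}B$ with $P$ skew-symmetric, $A\in\mathbb C^{r\times r}$ skew-Hamiltonian, $r=2\ell$, $C^T=JB$ (so $C=B^TJ^T$); minimal means $r$ is smallest possible among all realizations of $G$. The system matrix $\mathbb T(\lambda)$ of size $(mn+r)\times(mn+r)$ is skew-Hamiltonian if $(\mathbb J_{mn,r}\mathbb T(\lambda))^T=-\mathbb J_{mn,r}\mathbb T(\lambda)$. $e_j$ is the $j$-th column of $I_m$. Fiedler matrices: $M_0^P=\mathrm{diag}(I_{(m-1)n},-A_0)$,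 $M_{-m}^P=\mathrm{diag}(A_m,I_{(m-1)n})$, and for $1\le i\le m-1$, $M_i^P=\mathrm{diag}\big(I_{(m-i-1)n},\begin{bmatrix}-A_i&I_n\\ I_n&0\end{bmatrix},I_{(i-1)n}\big)$, $M_{-i}^P=(M_i^P)^{-1}=\mathrm{diag}\big(I_{(m-i-1)n},\begin{bmatrix}0&I_n\\ I_n&A_i\end{bmatrix},I_{(i-1)n}\big)$. For a tuple $\mathbf t=(t_1,\dots,t_k)$, $M^P_{\mathbf t}=M^P_{t_1}\cdots M^P_{t_k}$ (empty product $=$ identity). Tuples: $(a:b)=(a,a+1,\dots,b)$ if $a\le b$, empty otherwise; tuples separated by commas are concatenated; $\mathbf t+k$ adds $k$ to each entry; $\mathrm{rev}$ reverses. $c_0(\beta)$ is the largest $p\ge0$ such that $(0,1,\dots,p)$ is a subtuple of $\beta$ (obtained by deleting entries). An admissible tuple of $\{0:k\}$ with index $p=\mathrm{Ind}(\mathbf w)$, $0\le p\le k$, $k-p$ even, is $\mathbf w=(k-1:k,\,k-3:k-2,\dots,p+1:p+2,\,0:p)$; it is simple if $p\in\{0,1\}$ ($p=0$ for $k$ even). Its symmetric complement is $\mathbf c_w=(k-1,k-3,\dots,p+3,p+1,(0:p)_{rev_c})$ if $p\ge1$, where $(0:p)_{rev_c}=(0:p-1,0:p-2,\dots,0:1,0)$; $\mathbf c_w=(k-1,k-3,\dots,1)$ if $p=0,k>0$; $\mathbf c_w=\emptyset$ if $k=0$. Right index tuples of type-1: each permutation $\beta$ of $\{0:k\}$ can be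 brought, by interchanging adjacent indices that differ by more than $1$, to a unique column standard form $\mathrm{csf}(\beta)=(\mathbf b_d,\mathbf b_{d-1},\dots,\mathbf b_1)$ with strings $\mathbf b_i=(a_{i-1}+1:a_i)$, $-1=a_0<a_1<\dots<a_d=k$. An index $s\in\{0:k-1\}$ is a right index of type-1 relative to $\beta$ if some string of $\mathrm{csf}(\beta)$ is $(s:t)$ with $s<t$. In that case define $z_r(\beta,s)$: if $s=a_{g-1}+1\ne0$, replace in $\mathrm{csf}(\beta)$ the strings $\mathbf b_g,\mathbf b_{g-1}$ by $(a_{g-1}+2:a_g)$, $(a_{g-2}+1:a_{g-1}+1)$; if $s=0$, replace $\mathbf b_1$ by the two strings $(1:a_1),(0)$. A tuple $(s_1,\dots,s_q)$ with indices from $\{0:k-1\}$ (possibly empty) is a right index tuple of type-1 relative to $\beta$ if for each $i$, $s_i$ is a right index of type-1 relative to $z_r(\beta,(s_1,\dots,s_{i-1}))$, where $z_r(\beta,\emptyset)=\beta$ and $z_r(\beta,(s_1,\dots,s_{i-1}))=z_r(z_r(\beta,(s_1,\dots,s_{i-2})),s_{i-1})$. Quasi-identity: $Q\in\mathbb C^{mn\times mn}$ is a quasi-identity matrix if $Q=\epsilon_1I_n\oplus\cdots\oplus\epsilon_mI_n$ with $\epsilon_i\in\{\pm1\}$; $\epsilon_j$ is its $j$-th parameter. It is a known result that, for $P$ skew-symmetric and tuples as in the claim, there is, up to multiplication by $-1$, a unique quasi-identity $Q$ such that $QL(\lambda)$ is skew-symmetric. A matrix polynomial is unimodular if its determinant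 is a nonzero constant; a square rational matrix is biproper if its limit at $\infty$ exists and is nonsingular. Rosenbrock strong linearization of $G(\lambda)$: an $(mn+r)\times(mn+r)$ pencil $\mathbb T(\lambda)=\left[\begin{array}{c|c}\mathcal X-\lambda\mathcal Y&\mathcal C\\ \hline\mathcal B&H-\lambda K\end{array}\right]$ with $K\in\mathbb C^{r\times r}$ nonsingular, irreducible ($[\mathcal B\ \ H-\lambda K]$ and $\begin{bmatrix}\mathcal C\\ H-\lambda K\end{bmatrix}$ have rank $r$ for all $\lambda\in\mathbb C$), such that (i) $\mathrm{diag}(U(\lambda),U_0)\,\mathbb T(\lambda)\,\mathrm{diag}(V(\lambda),V_0)=\mathrm{diag}(I_{(m-1)n},\mathcal S(\lambda))$ for some $mn\times mn$ unimodular $U,V$ and nonsingular $U_0,V_0\in\mathbb C^{r\times r}$; (ii) $\mathcal O_\ell(\lambda)\lambda^{-1}\mathbb G(\lambda)\mathcal O_r(\lambda)=\mathrm{diag}(I_{(m-1)n},\lambda^{-m}G(\lambda))$ for some $mn\times mn$ biproper $\mathcal O_\ell,\mathcal O_r$, where $\mathbb G(\lambda)=\mathcal X-\lambda\mathcal Y+\mathcal C(\lambda K-H)^{-1}\mathcal B$ is the transfer function. *)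

theory Defs
  imports
    "HOL-Computational_Algebra.Computational_Algebra"
    "HOL-Library.Sublist"
    "Jordan_Normal_Form.Gauss_Jordan_Elimination"
    "Jordan_Normal_Form.Determinant"
    "Jordan_Normal_Form.DL_Rank"
begin

section \<open>Constant, polynomial and rational matrices\<close>

text \<open>Matrix polynomials are matrices over \<open>complex poly\<close>; rational matrices are matrices over the
  field \<open>complex poly fract\<close> of rational functions.\<close>

type_synonym cmat = "complex mat"
type_synonym pmat = "complex poly mat"
type_synonym rmat = "complex poly fract mat"

definition const_mat :: "cmat \<Rightarrow> pmat" where
  "const_mat = map_mat (\<lambda>c. [:c:])"

definition rat_mat :: "pmat \<Rightarrow> rmat" where
  "rat_mat = map_mat to_fract"

abbreviation lam :: "complex poly" where
  "lam \<equiv> [:0, 1:]"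

definition rat_inverse :: "rmat \<Rightarrow> rmat" where
  "rat_inverse F = the (mat_inverse F)"

definition matrix_poly :: "nat \<Rightarrow> nat \<Rightarrow> (nat \<Rightarrow> cmat) \<Rightarrow> pmat" where
  "matrix_poly n m a = mat n n (\<lambda>(i, j). \<Sum>k\<le>m. monom (a k $$ (i, j)) k)"

definition skew_symmetric :: "'a::group_add mat \<Rightarrow> bool" where
  "skew_symmetric F \<longleftrightarrow> transpose_mat F = - F"

definition kron :: "'a::times mat \<Rightarrow> 'a mat \<Rightarrow> 'a mat" where
  "kron A B = mat (dim_row A * dim_row B) (dim_col A * dim_col B)
     (\<lambda>(i, j). A $$ (i div dim_row B, j div dim_col B) * B $$ (i mod dim_row B, j mod dim_col B))"

text \<open>The column \<open>e\<^sub>j\<close> of the identity, numbered from 1.\<close>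

definition e_col :: "nat \<Rightarrow> nat \<Rightarrow> 'a::{zero,one} mat" where
  "e_col m j = mat m 1 (\<lambda>(i, _). if Suc i = j then 1 else 0)"

definition unimodular :: "nat \<Rightarrow> pmat \<Rightarrow> bool" where
  "unimodular k U \<longleftrightarrow> U \<in> carrier_mat k k \<and> (\<exists>c. c \<noteq> 0 \<and> det U = [:c:])"

text \<open>The limit of a rational function at infinity; it does not depend on the representation
  of \<open>f\<close> as a fraction.\<close>

definition tendsto_at_infinity :: "complex poly fract \<Rightarrow> complex \<Rightarrow> bool" where
  "tendsto_at_infinity f c \<longleftrightarrow>
     (\<exists>p q. q \<noteq> 0 \<and> f = Fract p q \<and> ((\<lambda>x. poly p x / poly q x) \<longlongrightarrow> c) at_infinity)"

definition biproper :: "nat \<Rightarrow> rmat \<Rightarrow> bool" where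
  "biproper k F \<longleftrightarrow> F \<in> carrier_mat k k \<and>
     (\<exists>F\<^sub>0 \<in> carrier_mat k k.
        (\<forall>i<k. \<forall>j<k. tendsto_at_infinity (F $$ (i, j)) (F\<^sub>0 $$ (i, j))) \<and> invertible_mat F\<^sub>0)"


section \<open>Skew-Hamiltonian structure and realizations\<close>

definition J_mat :: "nat \<Rightarrow> 'a::ring_1 mat" where
  "J_mat l = four_block_mat (0\<^sub>m l l) (1\<^sub>m l) (- 1\<^sub>m l) (0\<^sub>m l l)"

text \<open>\<open>JJ_mat k l\<close> is \<open>\<J>\<^bsub>k,2l\<^esub>\<close>.\<close>

definition JJ_mat :: "nat \<Rightarrow> nat \<Rightarrow> 'a::ring_1 mat" where
  "JJ_mat k l = diag_block_mat [1\<^sub>m k, J_mat l]"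

definition skew_hamiltonian :: "nat \<Rightarrow> cmat \<Rightarrow> bool" where
  "skew_hamiltonian l X \<longleftrightarrow> X \<in> carrier_mat (2 * l) (2 * l) \<and> skew_symmetric (J_mat l * X)"

definition skew_hamiltonian_system :: "nat \<Rightarrow> nat \<Rightarrow> pmat \<Rightarrow> bool" where
  "skew_hamiltonian_system k l T \<longleftrightarrow>
     T \<in> carrier_mat (k + 2 * l) (k + 2 * l) \<and> skew_symmetric (JJ_mat k l * T)"

definition state_pencil :: "nat \<Rightarrow> cmat \<Rightarrow> pmat" where
  "state_pencil r A = lam \<cdot>\<^sub>m 1\<^sub>m r - const_mat A"

definition realization ::
  "nat \<Rightarrow> nat \<Rightarrow> pmat \<Rightarrow> cmat \<Rightarrow> cmat \<Rightarrow> cmat \<Rightarrow> rmat \<Rightarrow> bool" where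
  "realization n r P A B C G \<longleftrightarrow>
     P \<in> carrier_mat n n \<and> A \<in> carrier_mat r r \<and> B \<in> carrier_mat r n \<and> C \<in> carrier_mat n r \<and>
     G = rat_mat P
           + rat_mat (const_mat C) * rat_inverse (rat_mat (state_pencil r A)) * rat_mat (const_mat B)"

definition skew_hamiltonian_realization ::
  "nat \<Rightarrow> nat \<Rightarrow> pmat \<Rightarrow> cmat \<Rightarrow> cmat \<Rightarrow> cmat \<Rightarrow> rmat \<Rightarrow> bool" where
  "skew_hamiltonian_realization n l P A B C G \<longleftrightarrow>
     realization n (2 * l) P A B C G \<and> skew_symmetric P \<and> skew_hamiltonian l A \<and>
     transpose_mat C = J_mat l * B"

definition minimal_skew_hamiltonian_realization ::
  "nat \<Rightarrow> nat \<Rightarrow> pmat \<Rightarrow> cmat \<Rightarrow> cmat \<Rightarrow> cmat \<Rightarrow> rmat \<Rightarrow> bool" where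
  "minimal_skew_hamiltonian_realization n l P A B C G \<longleftrightarrow>
     skew_hamiltonian_realization n l P A B C G \<and>
     (\<forall>r' P' A' B' C'. realization n r' P' A' B' C' G \<longrightarrow> 2 * l \<le> r')"


section \<open>Fiedler matrices\<close>

text \<open>Here \<open>a\<close> is the sequence of coefficients of the matrix polynomial; the index \<open>i\<close> is
  meant to range over \<open>{-m..m-1}\<close>.\<close>

definition fiedler :: "nat \<Rightarrow> nat \<Rightarrow> (nat \<Rightarrow> cmat) \<Rightarrow> int \<Rightarrow> cmat" where
  "fiedler n m a i =
    (let k = nat \<bar>i\<bar> in
     if i = 0 then diag_block_mat [1\<^sub>m ((m - 1) * n), - a 0]
     else if i = - int m then diag_block_mat [a m, 1\<^sub>m ((m - 1) * n)]
     else if i > 0 then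
       diag_block_mat [1\<^sub>m ((m - k - 1) * n),
         four_block_mat (- a k) (1\<^sub>m n) (1\<^sub>m n) (0\<^sub>m n n), 1\<^sub>m ((k - 1) * n)]
     else
       diag_block_mat [1\<^sub>m ((m - k - 1) * n),
         four_block_mat (0\<^sub>m n n) (1\<^sub>m n) (1\<^sub>m n) (a k), 1\<^sub>m ((k - 1) * n)])"

definition fiedler_prod :: "nat \<Rightarrow> nat \<Rightarrow> (nat \<Rightarrow> cmat) \<Rightarrow> int list \<Rightarrow> cmat" where
  "fiedler_prod n m a t = foldr (\<lambda>i X. fiedler n m a i * X) t (1\<^sub>m (m * n))"

definition fiedler_pencil ::
  "nat \<Rightarrow> nat \<Rightarrow> (nat \<Rightarrow> cmat) \<Rightarrow> int list \<Rightarrow> int list \<Rightarrow> int list \<Rightarrow> int list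
     \<Rightarrow> int list \<Rightarrow> int list \<Rightarrow> pmat" where
  "fiedler_pencil n m a w c\<^sub>w t\<^sub>w z c\<^sub>z t\<^sub>z =
    (let M = (\<lambda>t. const_mat (fiedler_prod n m a t)) in
     M (rev t\<^sub>z) * M (rev t\<^sub>w) * (lam \<cdot>\<^sub>m M z - M w) * M c\<^sub>w * M t\<^sub>w * M c\<^sub>z * M t\<^sub>z)"


section \<open>Index tuples\<close>

definition shift :: "int list \<Rightarrow> int \<Rightarrow> int list" where
  "shift t k = map (\<lambda>i. i + k) t"

definition c0 :: "int list \<Rightarrow> nat" where
  "c0 \<beta> = (GREATEST p. subseq [0..int p] \<beta>)"

definition admissible_tuple :: "nat \<Rightarrow> nat \<Rightarrow> int list \<Rightarrow> bool" where
  "admissible_tuple k p w \<longleftrightarrow> p \<le> k \<and> even (k - p) \<and>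
     w = concat (map (\<lambda>j. [int k - 1 - 2 * int j .. int k - 2 * int j]) [0..<(k - p) div 2])
           @ [0..int p]"

definition simple_admissible_tuple :: "nat \<Rightarrow> nat \<Rightarrow> int list \<Rightarrow> bool" where
  "simple_admissible_tuple k p w \<longleftrightarrow> admissible_tuple k p w \<and> p \<in> {0, 1}"

text \<open>\<open>(0:p)\<^bsub>rev_c\<^esub> = (0:p-1, 0:p-2, \<dots>, 0:1, 0)\<close>, which is empty for \<open>p = 0\<close>. Hence
  \<open>sym_compl k p\<close> also covers the cases \<open>p = 0\<close>, \<open>k > 0\<close> and \<open>p = k = 0\<close> of the symmetric
  complement of the admissible tuple of \<open>{0:k}\<close> with index \<open>p\<close>.\<close>

definition rev_c :: "nat \<Rightarrow> int list" where
  "rev_c p = concat (map (\<lambda>q. [0..int q]) (rev [0..<p]))"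

definition sym_compl :: "nat \<Rightarrow> nat \<Rightarrow> int list" where
  "sym_compl k p = map (\<lambda>j. int k - 1 - 2 * int j) [0..<(k - p) div 2] @ rev_c p"

inductive comm_swap :: "int list \<Rightarrow> int list \<Rightarrow> bool" where
  "\<bar>i - j\<bar> > 1 \<Longrightarrow> comm_swap (xs @ i # j # ys) (xs @ j # i # ys)"

text \<open>A tuple in column standard form is given by its list of strings
  \<open>[b\<^sub>d, \<dots>, b\<^sub>1]\<close>; below, \<open>as = [a\<^sub>0, \<dots>, a\<^sub>d]\<close>.\<close>

definition column_standard :: "nat \<Rightarrow> int list list \<Rightarrow> bool" where
  "column_standard k bs \<longleftrightarrow>
     (\<exists>as. as \<noteq> [] \<and> sorted_wrt (<) as \<and> hd as = -1 \<and> last as = int k \<and>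
        bs = rev (map2 (\<lambda>a a'. [a + 1..a']) as (tl as)))"

definition csf :: "nat \<Rightarrow> int list \<Rightarrow> int list list" where
  "csf k \<beta> = (THE bs. column_standard k bs \<and> comm_swap\<^sup>*\<^sup>* \<beta> (concat bs))"

definition type1_right_index :: "nat \<Rightarrow> int list \<Rightarrow> int \<Rightarrow> bool" where
  "type1_right_index k \<beta> s \<longleftrightarrow> s \<in> {0..int k - 1} \<and> (\<exists>t>s. [s..t] \<in> set (csf k \<beta>))"

text \<open>The string starting with \<open>s\<close> loses \<open>s\<close>, which is appended to the next string
  on its right (which ends with \<open>s - 1\<close>) or, for \<open>s = 0\<close>, becomes a string of its own.\<close>

fun move_index :: "int \<Rightarrow> int list list \<Rightarrow> int list list" where
  "move_index s [] = []"
| "move_index s [b] = (if hd b = s then [tl b, [s]] else [b])"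
| "move_index s (b # b' # bs) =
     (if hd b = s then tl b # (b' @ [s]) # bs else b # move_index s (b' # bs))"

definition z_r :: "nat \<Rightarrow> int list \<Rightarrow> int \<Rightarrow> int list" where
  "z_r k \<beta> s = concat (move_index s (csf k \<beta>))"

definition type1_right_index_tuple :: "nat \<Rightarrow> int list \<Rightarrow> int list \<Rightarrow> bool" where
  "type1_right_index_tuple k \<beta> t \<longleftrightarrow>
     (\<forall>i<length t. type1_right_index k (foldl (z_r k) \<beta> (take i t)) (t ! i))"


section \<open>Quasi-identity matrices\<close>

definition quasi_identity :: "nat \<Rightarrow> nat \<Rightarrow> (nat \<Rightarrow> complex) \<Rightarrow> cmat \<Rightarrow> bool" where
  "quasi_identity n m \<epsilon> Q \<longleftrightarrow> (\<forall>j\<in>{1..m}. \<epsilon> j \<in> {1, -1}) \<and>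
     Q = diag_block_mat (map (\<lambda>j. \<epsilon> j \<cdot>\<^sub>m 1\<^sub>m n) [1..<Suc m])"


section \<open>Rosenbrock strong linearizations\<close>

text \<open>The transfer function of \<open>T\<close>, partitioned with a leading \<open>k \<times> k\<close> block. The
  trailing block is \<open>D = H - \<lambda>K\<close>, so that \<open>\<lambda>K - H = - D\<close>.\<close>

definition transfer_function :: "nat \<Rightarrow> pmat \<Rightarrow> rmat" where
  "transfer_function k T =
    (case split_block T k k of (X, C, B, D) \<Rightarrow>
       rat_mat X + rat_mat C * rat_inverse (rat_mat (- D)) * rat_mat B)"

text \<open>\<open>S\<close> is the system matrix of the realization of \<open>G\<close>.\<close>

definition rosenbrock_strong_linearization ::
  "nat \<Rightarrow> nat \<Rightarrow> nat \<Rightarrow> pmat \<Rightarrow> rmat \<Rightarrow> pmat \<Rightarrow> bool" where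
  "rosenbrock_strong_linearization n m r S G T \<longleftrightarrow>
    (\<exists>X \<in> carrier_mat (m * n) (m * n). \<exists>Y \<in> carrier_mat (m * n) (m * n).
     \<exists>C \<in> carrier_mat (m * n) r. \<exists>B \<in> carrier_mat r (m * n).
     \<exists>H \<in> carrier_mat r r. \<exists>K \<in> carrier_mat r r.
        T = four_block_mat (const_mat X - lam \<cdot>\<^sub>m const_mat Y) (const_mat C)
                           (const_mat B) (const_mat H - lam \<cdot>\<^sub>m const_mat K) \<and>
        invertible_mat K \<and>
        (\<forall>x. vec_space.rank r
               (four_block_mat B (H - x \<cdot>\<^sub>m K) (0\<^sub>m 0 (m * n)) (0\<^sub>m 0 r)) = r \<and>
             vec_space.rank (m * n + r) (C @\<^sub>r (H - x \<cdot>\<^sub>m K)) = r)) \<and>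
    (\<exists>U V. \<exists>U\<^sub>0 \<in> carrier_mat r r. \<exists>V\<^sub>0 \<in> carrier_mat r r.
        unimodular (m * n) U \<and> unimodular (m * n) V \<and> invertible_mat U\<^sub>0 \<and> invertible_mat V\<^sub>0 \<and>
        diag_block_mat [U, const_mat U\<^sub>0] * T * diag_block_mat [V, const_mat V\<^sub>0]
          = diag_block_mat [1\<^sub>m ((m - 1) * n), S]) \<and>
    (\<exists>O\<^sub>l O\<^sub>r. biproper (m * n) O\<^sub>l \<and> biproper (m * n) O\<^sub>r \<and>
        O\<^sub>l * (inverse (to_fract lam) \<cdot>\<^sub>m transfer_function (m * n) T) * O\<^sub>r
          = diag_block_mat [1\<^sub>m ((m - 1) * n), (inverse (to_fract lam)) ^ m \<cdot>\<^sub>m G])"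

end

theory Submission
  imports Defs "Jordan_Normal_Form.Char_Poly"
begin

text \<open>Write \<open>e\<^sub>j\<close> for the \<open>j\<close>-th block unit vector. Expanding the tuples shows that
  \<open>L = X (\<lambda> M\<^sub>z - M\<^sub>w) Y\<close> with constant invertible \<open>X\<close> and \<open>Y\<close>: only \<open>M\<^sub>0\<close> and \<open>M\<^bsub>-m\<^esub>\<close> can be
  singular, and the assumptions keep them out of the outer factors when they are. The proof rests on
  what happens to the two places where the coefficient \<open>A\<^sub>0\<close> enters \<open>M\<^sub>w\<close>. Since \<open>A\<^sub>0\<close> occurs in one
  factor only, \<open>M\<^sub>w\<close> depends on it as \<open>M\<^sub>w(A\<^sub>0 + D) = M\<^sub>w(A\<^sub>0) - l D r\<close>, with a block column \<open>l\<close> and a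
  block row \<open>r\<close>, the ports of \<open>M\<^sub>w\<close>. For a simple admissible tuple they are block unit vectors.

  The core is an equivalence over an arbitrary ring \<open>S\<close> (\<open>generalized_fiedler_eqv\<close>): a generalized
  Fiedler pencil evaluated at \<open>x \<in> S\<close> is reduced to \<open>diag(I, \<Sum>\<^sub>i x\<^sup>i A\<^sub>i)\<close> by matrices invertible
  over \<open>S\<close> that take both ports to the last block unit vector. All of \<open>M\<^sub>z\<close> but one block row and
  column is eliminated at once; then each step peels one Fiedler matrix off \<open>M\<^sub>w\<close> and eliminates a
  block pivot \<open>-I\<close>, which amounts to a Horner step. The result is used twice.

  \<^item> Over the polynomials, with \<open>x = \<lambda>\<close>, it gives a unimodular equivalence of \<open>sQL\<close> with
    \<open>diag(I, P)\<close>. In \<open>T\<close> the states are attached to \<open>sQL\<close> exactly at the ports, so that the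
    equivalence extends by the identity on the states to the system matrices
    (\<open>system_equivalence\<close>).
  \<^item> Over the proper rational functions, with \<open>x = 1/\<lambda>\<close>, it is applied to the reversal of
    \<open>\<lambda>\<^sup>-\<^sup>1 (\<lambda> M\<^sub>z - M\<^sub>w)\<close>, which is again such a pencil. Adding \<open>l H r\<close> to the pencil, where \<open>H\<close> is the
    strictly proper part of \<open>G\<close>, replaces \<open>A\<^sub>0\<close> by \<open>A\<^sub>0 + H\<close>, hence \<open>P\<close> by \<open>G\<close>; so
    \<open>\<lambda>\<^sup>-\<^sup>1\<close> times the transfer function is reduced to \<open>diag(I, \<lambda>\<^sup>-\<^sup>m G)\<close> by biproper matrices
    (\<open>pencil_proper_eqv\<close>).

  That the position of the ports after multiplication by \<open>X\<close> and \<open>Y\<close> is given by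
  \<open>\<alpha> = c\<^sub>0(w, c\<^sub>w, t\<^sub>w)\<close> is combinatorial. A Fiedler matrix \<open>M\<^sub>s\<close> moves \<open>e\<^bsub>m-d\<^esub>\<close> to
  \<open>e\<^bsub>m-d-1\<^esub>\<close> if \<open>s = d + 1\<close> and fixes it if \<open>s \<notin> {d, d + 1}\<close>, so that \<open>d\<close> follows the greedy search
  for the subtuple \<open>(0, 1, 2, \<dots>)\<close> (\<open>prod_walk\<close>, \<open>c0_track\<close>). The bad case \<open>s = d\<close> is excluded by the
  type-1 condition: as long as \<open>d\<close> is the end of a string of the column standard form, \<open>d\<close> is not a
  right index of type-1, and moving another index keeps the current \<open>d\<close> a string end
  (\<open>type1_avoids\<close>). The scalar \<open>s\<close> makes \<open>sQ\<close> fix \<open>e\<^bsub>m-\<alpha>\<^esub>\<close>, so that \<open>sQ\<close> can be absorbed into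
  \<open>X\<close>.

  Irreducibility follows from minimality: a left eigenvector of \<open>A\<close> that annihilates \<open>B\<close> would give
  a realization of smaller dimension (\<open>minimal_controllable\<close>), and \<open>J\<close> turns the dual
  statement about \<open>C\<close> into this one. The structural claims are block computations.\<close>

section \<open>Block matrices over a commutative ring\<close>

abbreviation dsum :: "'a::zero mat \<Rightarrow> 'a mat \<Rightarrow> 'a mat" where
  "dsum A B \<equiv> four_block_mat A (0\<^sub>m (dim_row A) (dim_col B)) (0\<^sub>m (dim_row B) (dim_col A)) B"

lemma mult_assoc_dim:
  fixes A B C :: "'a::comm_ring_1 mat"
  assumes "dim_col A = dim_row B" "dim_col B = dim_row C"
  shows "(A * B) * C = A * (B * C)"
  by (rule assoc_mult_mat[of A "dim_row A" "dim_row B" B "dim_row C" C "dim_col C"])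
     (use assms in auto)

lemma mult_left_distrib_dim:
  fixes A B C :: "'a::comm_ring_1 mat"
  assumes "dim_row A = dim_row B" "dim_col A = dim_col B" "dim_col B = dim_row C"
  shows "(A + B) * C = A * C + B * C"
  by (rule add_mult_distrib_mat[of A "dim_row B" "dim_row C" B C "dim_col C"])
     (use assms in auto)

lemma mult_right_distrib_dim:
  fixes A B C :: "'a::comm_ring_1 mat"
  assumes "dim_row C = dim_row B" "dim_col C = dim_col B" "dim_col A = dim_row B"
  shows "A * (B + C) = A * B + A * C"
  by (rule mult_add_distrib_mat[of A "dim_row A" "dim_row B" B "dim_col B" C])
     (use assms in auto)

lemma smult_mult_dim:
  fixes A B :: "'a::comm_ring_1 mat"
  assumes "dim_col A = dim_row B"
  shows "(k \<cdot>\<^sub>m A) * B = k \<cdot>\<^sub>m (A * B)" "A * (k \<cdot>\<^sub>m B) = k \<cdot>\<^sub>m (A * B)"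
proof -
  have A: "A \<in> carrier_mat (dim_row A) (dim_row B)" and B: "B \<in> carrier_mat (dim_row B) (dim_col B)"
    using assms by auto
  show "(k \<cdot>\<^sub>m A) * B = k \<cdot>\<^sub>m (A * B)" by (rule mult_smult_assoc_mat[OF A B])
  show "A * (k \<cdot>\<^sub>m B) = k \<cdot>\<^sub>m (A * B)" by (rule mult_smult_distrib[OF A B])
qed

lemma uminus_mult_dim:
  fixes A B :: "'a::comm_ring_1 mat"
  assumes "dim_col A = dim_row B"
  shows "(- A) * B = - (A * B)" "A * (- B) = - (A * B)"
  using assms by (auto intro!: eq_matI)

lemma zero_mult_dim:
  fixes A :: "'a::comm_ring_1 mat"
  shows "dim_row A = k \<Longrightarrow> 0\<^sub>m r k * A = 0\<^sub>m r (dim_col A)"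
    and "dim_col A = k \<Longrightarrow> A * 0\<^sub>m k c = 0\<^sub>m (dim_row A) c"
  by (auto intro!: eq_matI)

lemma one_mult_dim:
  fixes A :: "'a::comm_ring_1 mat"
  shows "dim_row A = k \<Longrightarrow> 1\<^sub>m k * A = A" and "dim_col A = k \<Longrightarrow> A * 1\<^sub>m k = A"
  by (auto intro: left_mult_one_mat' right_mult_one_mat')

lemma zero_add_dim:
  fixes A :: "'a::comm_ring_1 mat"
  shows "dim_row A = r \<Longrightarrow> dim_col A = c \<Longrightarrow> 0\<^sub>m r c + A = A"
    and "dim_row A = r \<Longrightarrow> dim_col A = c \<Longrightarrow> A + 0\<^sub>m r c = A"
    and "dim_row A = r \<Longrightarrow> dim_col A = c \<Longrightarrow> 0\<^sub>m r c - A = - A"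
    and "dim_row A = r \<Longrightarrow> dim_col A = c \<Longrightarrow> A - 0\<^sub>m r c = A"
    and "- 0\<^sub>m r c = (0\<^sub>m r c :: 'a mat)" and "k \<cdot>\<^sub>m 0\<^sub>m r c = (0\<^sub>m r c :: 'a mat)"
  by (auto intro!: eq_matI)

lemmas mat_trivial = zero_mult_dim one_mult_dim zero_add_dim

lemma mult_four_block_dim:
  fixes A1 :: "'a::comm_ring_1 mat"
  assumes "dim_row B1 = dim_row A1" "dim_col C1 = dim_col A1" "dim_row C1 = dim_row D1"
    "dim_col B1 = dim_col D1" "dim_row B2 = dim_row A2" "dim_col C2 = dim_col A2"
    "dim_row C2 = dim_row D2" "dim_col B2 = dim_col D2"
    "dim_col A1 = dim_row A2" "dim_col D1 = dim_row D2"
  shows "four_block_mat A1 B1 C1 D1 * four_block_mat A2 B2 C2 D2 =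
    four_block_mat (A1 * A2 + B1 * C2) (A1 * B2 + B1 * D2) (C1 * A2 + D1 * C2) (C1 * B2 + D1 * D2)"
  by (rule mult_four_block_mat[of A1 "dim_row A1" "dim_row A2" B1 "dim_row D2" C1 "dim_row D1" D1
        A2 "dim_col A2" B2 "dim_col D2"])
     (use assms in auto)

lemma four_block_arith:
  fixes A1 :: "'a::comm_ring_1 mat"
  assumes "dim_row B1 = dim_row A1" "dim_col C1 = dim_col A1" "dim_row C1 = dim_row D1"
    "dim_col B1 = dim_col D1"
  shows "dim_row B2 = dim_row A1 \<Longrightarrow> dim_col C2 = dim_col A1 \<Longrightarrow> dim_row C2 = dim_row D1 \<Longrightarrow>
      dim_col B2 = dim_col D1 \<Longrightarrow> dim_row A2 = dim_row A1 \<Longrightarrow> dim_col A2 = dim_col A1 \<Longrightarrow>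
      dim_row D2 = dim_row D1 \<Longrightarrow> dim_col D2 = dim_col D1 \<Longrightarrow>
      four_block_mat A1 B1 C1 D1 + four_block_mat A2 B2 C2 D2 =
      four_block_mat (A1 + A2) (B1 + B2) (C1 + C2) (D1 + D2)"
    and "dim_row B2 = dim_row A1 \<Longrightarrow> dim_col C2 = dim_col A1 \<Longrightarrow> dim_row C2 = dim_row D1 \<Longrightarrow>
      dim_col B2 = dim_col D1 \<Longrightarrow> dim_row A2 = dim_row A1 \<Longrightarrow> dim_col A2 = dim_col A1 \<Longrightarrow>
      dim_row D2 = dim_row D1 \<Longrightarrow> dim_col D2 = dim_col D1 \<Longrightarrow>
      four_block_mat A1 B1 C1 D1 - four_block_mat A2 B2 C2 D2 =
      four_block_mat (A1 - A2) (B1 - B2) (C1 - C2) (D1 - D2)"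
    and "- four_block_mat A1 B1 C1 D1 = four_block_mat (- A1) (- B1) (- C1) (- D1)"
    and "k \<cdot>\<^sub>m four_block_mat A1 B1 C1 D1 =
      four_block_mat (k \<cdot>\<^sub>m A1) (k \<cdot>\<^sub>m B1) (k \<cdot>\<^sub>m C1) (k \<cdot>\<^sub>m D1)"
  using assms by (auto intro!: eq_matI)

lemma dsum_assoc: "dsum A (dsum B C) = dsum (dsum A B) (C :: 'a::zero mat)"
  using assoc_four_block_mat[of A B C] by simp

lemma dsum_one: "dsum (1\<^sub>m p) (1\<^sub>m q) = (1\<^sub>m (p + q) :: 'a::{zero,one} mat)"
  by (simp add: four_block_one_mat)

text \<open>A block column with \<open>p\<close> zero rows above it, and a block row with \<open>p\<close> zero columns to its left.
  They are written as block matrices with empty blocks so that products with them are instances of the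
  block multiplication rule.\<close>

definition vcat0 :: "nat \<Rightarrow> 'a::zero mat \<Rightarrow> 'a mat" where
  "vcat0 p l = four_block_mat (0\<^sub>m p 0) (0\<^sub>m p (dim_col l)) (0\<^sub>m (dim_row l) 0) l"

definition hcat0 :: "nat \<Rightarrow> 'a::zero mat \<Rightarrow> 'a mat" where
  "hcat0 p r = four_block_mat (0\<^sub>m 0 p) (0\<^sub>m 0 (dim_col r)) (0\<^sub>m (dim_row r) p) r"

lemma vcat0_dim[simp]: "dim_row (vcat0 p l) = p + dim_row l" "dim_col (vcat0 p l) = dim_col l"
  and hcat0_dim[simp]: "dim_row (hcat0 p l) = dim_row l" "dim_col (hcat0 p l) = p + dim_col l"
  by (simp_all add: vcat0_def hcat0_def)

lemma four_block_vcat0: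
  fixes A :: "'a::comm_ring_1 mat"
  assumes "dim_row B = dim_row A" "dim_col C = dim_col A" "dim_row C = dim_row D"
    "dim_col B = dim_col D" "dim_col D = dim_row l" "dim_col A = p"
    "B * l = 0\<^sub>m (dim_row A) (dim_col l)"
  shows "four_block_mat A B C D * vcat0 p l = vcat0 (dim_row A) (D * l)"
  unfolding vcat0_def using assms by (simp add: mult_four_block_dim mat_trivial)

lemma hcat0_four_block:
  fixes A :: "'a::comm_ring_1 mat"
  assumes "dim_row B = dim_row A" "dim_col C = dim_col A" "dim_row C = dim_row D"
    "dim_col B = dim_col D" "dim_row D = dim_col r" "dim_row A = p"
    "r * C = 0\<^sub>m (dim_row r) (dim_col A)"
  shows "hcat0 p r * four_block_mat A B C D = hcat0 (dim_col A) (r * D)"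
  unfolding hcat0_def using assms by (simp add: mult_four_block_dim mat_trivial)

lemma vcat0_vcat0: "vcat0 p (vcat0 q l) = vcat0 (p + q) l"
  unfolding vcat0_def by (rule eq_matI) auto

lemma hcat0_hcat0: "hcat0 p (hcat0 q l) = hcat0 (p + q) l"
  unfolding hcat0_def by (rule eq_matI) auto

lemma vcat0_0: "vcat0 0 l = l" and hcat0_0: "hcat0 0 l = l"
  unfolding vcat0_def hcat0_def by (rule eq_matI, auto)+

section \<open>Equivalence over a subring\<close>

text \<open>Unimodular and biproper matrices are the matrices that are invertible over the ring of polynomials
  and over the ring of proper rational functions; the second is not a type but a subset of the
  field of rational functions. Working with an arbitrary subring \<open>S\<close> covers both, and constant
  invertible matrices as well.\<close>

locale entry_ring =
  fixes S :: "'a::comm_ring_1 set"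
  assumes S_0: "0 \<in> S" and S_1: "1 \<in> S"
    and S_add: "x \<in> S \<Longrightarrow> y \<in> S \<Longrightarrow> x + y \<in> S"
    and S_mult: "x \<in> S \<Longrightarrow> y \<in> S \<Longrightarrow> x * y \<in> S"
    and S_minus: "x \<in> S \<Longrightarrow> - x \<in> S"
begin

definition ent :: "'a mat \<Rightarrow> bool" where
  "ent X \<longleftrightarrow> (\<forall>i<dim_row X. \<forall>j<dim_col X. X $$ (i, j) \<in> S)"

lemma S_sum: "(\<And>i. i \<in> I \<Longrightarrow> f i \<in> S) \<Longrightarrow> sum f I \<in> S"
  by (induction I rule: infinite_finite_induct) (auto intro: S_0 S_add)

lemma ent_mult: "ent X \<Longrightarrow> ent Y \<Longrightarrow> dim_col X = dim_row Y \<Longrightarrow> ent (X * Y)"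
  by (auto simp: ent_def scalar_prod_def intro!: S_sum S_mult)

lemma ent_add: "ent X \<Longrightarrow> ent Y \<Longrightarrow> dim_row X = dim_row Y \<Longrightarrow> dim_col X = dim_col Y \<Longrightarrow> ent (X + Y)"
  by (auto simp: ent_def intro!: S_add)

lemma ent_minus: "ent X \<Longrightarrow> ent Y \<Longrightarrow> dim_row X = dim_row Y \<Longrightarrow> dim_col X = dim_col Y \<Longrightarrow> ent (X - Y)"
  using S_add S_minus by (fastforce simp: ent_def diff_conv_add_uminus simp del: add_uminus_conv_diff)

lemma ent_uminus: "ent X \<Longrightarrow> ent (- X)"
  by (auto simp: ent_def intro!: S_minus)

lemma ent_smult: "k \<in> S \<Longrightarrow> ent X \<Longrightarrow> ent (k \<cdot>\<^sub>m X)"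
  by (auto simp: ent_def intro!: S_mult)

lemma ent_zero: "ent (0\<^sub>m r c)" and ent_one: "ent (1\<^sub>m r)"
  by (auto simp: ent_def one_mat_def intro: S_0 S_1)

lemma ent_four_block:
  "ent A \<Longrightarrow> ent B \<Longrightarrow> ent C \<Longrightarrow> ent D \<Longrightarrow> dim_row B = dim_row A \<Longrightarrow> dim_col C = dim_col A \<Longrightarrow>
   dim_row C = dim_row D \<Longrightarrow> dim_col B = dim_col D \<Longrightarrow> ent (four_block_mat A B C D)"
  by (auto simp: ent_def)

lemmas ent_intros = ent_mult ent_add ent_minus ent_uminus ent_smult ent_zero ent_one ent_four_block

definition S_unit :: "nat \<Rightarrow> 'a mat \<Rightarrow> bool" where
  "S_unit N U \<longleftrightarrow> U \<in> carrier_mat N N \<and> ent U \<and>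
     (\<exists>U' \<in> carrier_mat N N. ent U' \<and> U * U' = 1\<^sub>m N \<and> U' * U = 1\<^sub>m N)"

lemma S_unitI:
  "U \<in> carrier_mat N N \<Longrightarrow> U' \<in> carrier_mat N N \<Longrightarrow> ent U \<Longrightarrow> ent U' \<Longrightarrow> U * U' = 1\<^sub>m N \<Longrightarrow>
   U' * U = 1\<^sub>m N \<Longrightarrow> S_unit N U"
  by (auto simp: S_unit_def)

lemma S_unit_dim: "S_unit N U \<Longrightarrow> dim_row U = N" "S_unit N U \<Longrightarrow> dim_col U = N"
  by (auto simp: S_unit_def)

lemma S_unit_one: "S_unit N (1\<^sub>m N)"
  by (rule S_unitI[of _ _ "1\<^sub>m N"]) (auto intro: ent_one)

lemma S_unit_mult:
  assumes "S_unit N U" "S_unit N V" shows "S_unit N (U * V)"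
proof -
  obtain U' V' where u: "U' \<in> carrier_mat N N" "ent U'" "U * U' = 1\<^sub>m N" "U' * U = 1\<^sub>m N"
    and v: "V' \<in> carrier_mat N N" "ent V'" "V * V' = 1\<^sub>m N" "V' * V = 1\<^sub>m N"
    using assms by (auto simp: S_unit_def)
  note d = S_unit_dim[OF assms(1)] S_unit_dim[OF assms(2)] carrier_matD[OF u(1)] carrier_matD[OF v(1)]
  show ?thesis
  proof (rule S_unitI[of _ _ "V' * U'"])
    have "U * V * (V' * U') = U * ((V * V') * U')" by (simp add: mult_assoc_dim d)
    thus "U * V * (V' * U') = 1\<^sub>m N" by (simp add: v u one_mult_dim d)
    have "V' * U' * (U * V) = V' * ((U' * U) * V)" by (simp add: mult_assoc_dim d)
    thus "V' * U' * (U * V) = 1\<^sub>m N" by (simp add: v u one_mult_dim d)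
    show "ent (U * V)" "ent (V' * U')"
      using assms u v by (simp_all add: S_unit_def ent_mult d)
  qed (rule carrier_matI; simp add: d)+
qed

lemma S_unit_dsum:
  assumes "S_unit M U" "S_unit N V" shows "S_unit (M + N) (dsum U V)"
proof -
  obtain U' V' where u: "U' \<in> carrier_mat M M" "ent U'" "U * U' = 1\<^sub>m M" "U' * U = 1\<^sub>m M"
    and v: "V' \<in> carrier_mat N N" "ent V'" "V * V' = 1\<^sub>m N" "V' * V = 1\<^sub>m N"
    using assms by (auto simp: S_unit_def)
  note d = S_unit_dim[OF assms(1)] S_unit_dim[OF assms(2)] carrier_matD[OF u(1)] carrier_matD[OF v(1)]
  show ?thesis
  proof (rule S_unitI[of _ _ "dsum U' V'"])
    show "ent (dsum U V)" "ent (dsum U' V')"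
      using assms u v by (simp_all add: S_unit_def ent_intros d)
    show "dsum U V \<in> carrier_mat (M + N) (M + N)" "dsum U' V' \<in> carrier_mat (M + N) (M + N)"
      by (rule carrier_matI; simp add: d)+
  qed (simp_all add: d mult_four_block_dim mat_trivial u v)
qed

lemma S_unit_diag: "S_unit M U \<Longrightarrow> S_unit N V \<Longrightarrow> K = M + N \<Longrightarrow>
    S_unit K (four_block_mat U (0\<^sub>m M N) (0\<^sub>m N M) V)"
  using S_unit_dsum[of M U N V] by (simp add: S_unit_dim)

lemma S_unit_lower:
  assumes "C \<in> carrier_mat q p" "ent C"
  shows "S_unit (p + q) (four_block_mat (1\<^sub>m p) (0\<^sub>m p q) C (1\<^sub>m q))"
proof (rule S_unitI[of _ _ "four_block_mat (1\<^sub>m p) (0\<^sub>m p q) (- C) (1\<^sub>m q)"])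
  have "C + - C = 0\<^sub>m q p" "- C + C = 0\<^sub>m q p" using assms by (auto intro!: eq_matI)
  thus "four_block_mat (1\<^sub>m p) (0\<^sub>m p q) C (1\<^sub>m q) * four_block_mat (1\<^sub>m p) (0\<^sub>m p q) (- C) (1\<^sub>m q) = 1\<^sub>m (p + q)"
    "four_block_mat (1\<^sub>m p) (0\<^sub>m p q) (- C) (1\<^sub>m q) * four_block_mat (1\<^sub>m p) (0\<^sub>m p q) C (1\<^sub>m q) = 1\<^sub>m (p + q)"
    using assms by (auto simp: mult_four_block_dim mat_trivial)
qed (use assms in \<open>auto intro!: ent_intros\<close>)

lemma S_unit_upper:
  assumes "B \<in> carrier_mat p q" "ent B"
  shows "S_unit (p + q) (four_block_mat (1\<^sub>m p) B (0\<^sub>m q p) (1\<^sub>m q))"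
proof (rule S_unitI[of _ _ "four_block_mat (1\<^sub>m p) (- B) (0\<^sub>m q p) (1\<^sub>m q)"])
  have "B + - B = 0\<^sub>m p q" "- B + B = 0\<^sub>m p q" using assms by (auto intro!: eq_matI)
  thus "four_block_mat (1\<^sub>m p) B (0\<^sub>m q p) (1\<^sub>m q) * four_block_mat (1\<^sub>m p) (- B) (0\<^sub>m q p) (1\<^sub>m q) = 1\<^sub>m (p + q)"
    "four_block_mat (1\<^sub>m p) (- B) (0\<^sub>m q p) (1\<^sub>m q) * four_block_mat (1\<^sub>m p) B (0\<^sub>m q p) (1\<^sub>m q) = 1\<^sub>m (p + q)"
    using assms by (auto simp: mult_four_block_dim mat_trivial)
qed (use assms in \<open>auto intro!: ent_intros\<close>)

lemma S_unit_uminus: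
  assumes "S_unit N U" shows "S_unit N (- U)"
proof -
  obtain U' where u: "U' \<in> carrier_mat N N" "ent U'" "U * U' = 1\<^sub>m N" "U' * U = 1\<^sub>m N"
    using assms by (auto simp: S_unit_def)
  note d = S_unit_dim[OF assms(1)] carrier_matD[OF u(1)]
  show ?thesis
  proof (rule S_unitI[of _ _ "- U'"])
    show "ent (- U)" "ent (- U')" using assms u by (simp_all add: S_unit_def ent_uminus)
    show "- U \<in> carrier_mat N N" "- U' \<in> carrier_mat N N" by (rule carrier_matI; simp add: d)+
    have "- U * - U' = U * U'" "- U' * - U = U' * U"
      using d by (auto intro!: eq_matI)
    thus "- U * - U' = 1\<^sub>m N" "- U' * - U = 1\<^sub>m N" using u by simp_all
  qed
qed

text \<open>\<open>F\<close> with the ports \<open>l\<close> and \<open>r\<close> stands for all block matrices with the upper blocks \<open>F\<close>, \<open>l C\<close> and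
  the lower left block \<open>B r\<close>: an equivalence that carries the ports along acts on all of them
  simultaneously, and on every perturbation \<open>F + l D r\<close>.\<close>

definition port_eqv ::
  "nat \<Rightarrow> 'a mat \<Rightarrow> 'a mat \<Rightarrow> 'a mat \<Rightarrow> 'a mat \<Rightarrow> 'a mat \<Rightarrow> 'a mat \<Rightarrow> bool" where
  "port_eqv N F l r F' l' r' \<longleftrightarrow>
    dim_row F = N \<and> dim_col F = N \<and> dim_row l = N \<and> dim_col r = N \<and>
    (\<exists>U V. S_unit N U \<and> S_unit N V \<and> U * F * V = F' \<and> U * l = l' \<and> r * V = r')"

lemma port_eqvI:
  "dim_row F = N \<Longrightarrow> dim_col F = N \<Longrightarrow> dim_row l = N \<Longrightarrow> dim_col r = N \<Longrightarrow> S_unit N U \<Longrightarrow> S_unit N V \<Longrightarrow>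
   U * F * V = F' \<Longrightarrow> U * l = l' \<Longrightarrow> r * V = r' \<Longrightarrow> port_eqv N F l r F' l' r'"
  by (auto simp: port_eqv_def)

lemma port_eqv_trans:
  assumes "port_eqv N F l r F' l' r'" "port_eqv N F' l' r' F'' l'' r''"
  shows "port_eqv N F l r F'' l'' r''"
proof -
  obtain U V U' V' where
    u: "S_unit N U" "S_unit N V" "U * F * V = F'" "U * l = l'" "r * V = r'"
    "S_unit N U'" "S_unit N V'" "U' * F' * V' = F''" "U' * l' = l''" "r' * V' = r''"
    using assms by (auto simp: port_eqv_def)
  have F: "dim_row F = N" "dim_col F = N" "dim_row l = N" "dim_col r = N"
    using assms by (auto simp: port_eqv_def)
  note d = S_unit_dim[OF u(1)] S_unit_dim[OF u(2)] S_unit_dim[OF u(6)] S_unit_dim[OF u(7)]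
    F
  show ?thesis
  proof (rule port_eqvI[OF F, of "U' * U" "V * V'"])
    show "U' * U * F * (V * V') = F''"
      unfolding u(8)[symmetric] u(3)[symmetric] by (simp add: mult_assoc_dim d)
    show "U' * U * l = l''" unfolding u(9)[symmetric] u(4)[symmetric] by (simp add: mult_assoc_dim d)
    show "r * (V * V') = r''" unfolding u(10)[symmetric] u(5)[symmetric] by (simp add: mult_assoc_dim d)
  qed (use u in \<open>auto intro: S_unit_mult\<close>)
qed

lemma port_eqv_dsum_one:
  assumes "port_eqv N F l r F' l' r'"
  shows "port_eqv (p + N) (dsum (1\<^sub>m p) F) (vcat0 p l) (hcat0 p r)
           (dsum (1\<^sub>m p) F') (vcat0 p l') (hcat0 p r')"
proof -
  obtain U V where
    u: "S_unit N U" "S_unit N V" "U * F * V = F'" "U * l = l'" "r * V = r'"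
    using assms by (auto simp: port_eqv_def)
  have F: "dim_row F = N" "dim_col F = N" "dim_row l = N" "dim_col r = N"
    using assms by (auto simp: port_eqv_def)
  note d = S_unit_dim[OF u(1)] S_unit_dim[OF u(2)] F
  have d': "dim_row F' = N" "dim_col F' = N" using d by (auto simp flip: u(3))
  show ?thesis
    by (rule port_eqvI[of _ _ _ _ "dsum (1\<^sub>m p) U" "dsum (1\<^sub>m p) V"])
       (use u d d' in \<open>simp_all add: mult_four_block_dim mat_trivial four_block_vcat0 hcat0_four_block
          S_unit_diag S_unit_one\<close>)
qed

text \<open>The row operations of the elimination only add multiples of the pivot rows to the rows below,
  and the ports vanish on the pivot rows and columns; so the ports do not change.\<close>

lemma port_eqv_pivot:
  assumes X: "X \<in> carrier_mat p q" and Y: "Y \<in> carrier_mat q p" and D: "D \<in> carrier_mat q q"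
    and ent: "ent X" "ent Y" and l: "dim_row l = q" and r: "dim_col r = q"
  shows "port_eqv (p + q) (four_block_mat (- 1\<^sub>m p) X Y D) (vcat0 p l) (hcat0 p r)
           (dsum (1\<^sub>m p) (D + Y * X)) (vcat0 p l) (hcat0 p r)"
proof -
  note d = carrier_matD[OF X] carrier_matD[OF Y] carrier_matD[OF D] l r
  let ?N = "dsum (- 1\<^sub>m p) (1\<^sub>m q)"
  let ?U = "four_block_mat (1\<^sub>m p) (0\<^sub>m p q) Y (1\<^sub>m q)"
  let ?V = "four_block_mat (1\<^sub>m p) X (0\<^sub>m q p) (1\<^sub>m q)"
  have "- Y + Y = 0\<^sub>m q p" "- X + X = 0\<^sub>m p q" "- (- 1\<^sub>m p) = (1\<^sub>m p :: 'a mat)"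
    using d by (auto intro!: eq_matI)
  moreover have "Y * X + D = D + Y * X" using d by (auto intro!: eq_matI)
  moreover have "X + - X = 0\<^sub>m p q" using d by (auto intro!: eq_matI)
  ultimately have "?N * ?U * four_block_mat (- 1\<^sub>m p) X Y D * ?V = dsum (1\<^sub>m p) (D + Y * X)"
    by (simp add: mult_four_block_dim mat_trivial d uminus_mult_dim)
  moreover have "S_unit (p + q) (?N * ?U)" "S_unit (p + q) ?V"
    using X Y ent by (auto intro!: S_unit_diag S_unit_one S_unit_mult S_unit_lower S_unit_upper
        S_unit_uminus)
  moreover have "?N * ?U * vcat0 p l = vcat0 p l" "hcat0 p r * ?V = hcat0 p r"
    using d by (simp_all add: mult_assoc_dim mat_trivial four_block_vcat0 hcat0_four_block)
  ultimately show ?thesis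
    by (intro port_eqvI[of _ _ _ _ "?N * ?U" ?V]) (use d in auto)
qed

end

section \<open>Fiedler products\<close>

lemma mult_minus_dim:
  fixes A B C :: "'a::comm_ring_1 mat"
  shows "dim_row C = dim_row B \<Longrightarrow> dim_col C = dim_col B \<Longrightarrow> dim_col A = dim_row B \<Longrightarrow>
      A * (B - C) = A * B - A * C"
    and "dim_row A = dim_row B \<Longrightarrow> dim_col A = dim_col B \<Longrightarrow> dim_col B = dim_row C \<Longrightarrow>
      (A - B) * C = A * C - B * C"
  by (rule mult_minus_distrib_mat[of A "dim_row A" "dim_row B" B "dim_col B" C]; fastforce)
     (rule minus_mult_distrib_mat[of A "dim_row B" "dim_row C" B C "dim_col C"]; fastforce)

text \<open>The Fiedler matrix \<open>M\<^sub>i\<close> without its leading identity block.\<close>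

definition fiedler_step :: "nat \<Rightarrow> 'a::comm_ring_1 mat \<Rightarrow> nat \<Rightarrow> 'a mat" where
  "fiedler_step n A q = dsum (four_block_mat (- A) (1\<^sub>m n) (1\<^sub>m n) (0\<^sub>m n n)) (1\<^sub>m q)"

text \<open>Fiedler matrices commute unless their indices are adjacent. A product of \<open>M\<^sub>0, \<dots>, M\<^sub>k\<close> in any
  order is therefore determined by telling, for each \<open>i\<close>, whether \<open>M\<^sub>i\<close> stands to the left
  or to the right of \<open>M\<^bsub>i-1\<^esub>\<close>; \<open>c i\<close> means left.\<close>

fun fiedler_word :: "nat \<Rightarrow> (nat \<Rightarrow> 'a::comm_ring_1 mat) \<Rightarrow> (nat \<Rightarrow> bool) \<Rightarrow> nat \<Rightarrow> 'a mat" where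
  "fiedler_word n a c 0 = - a 0"
| "fiedler_word n a c (Suc k) =
     (let W = dsum (1\<^sub>m n) (fiedler_word n a c k); M = fiedler_step n (a (Suc k)) (k * n)
      in if c (Suc k) then M * W else W * M)"

text \<open>\<open>A\<^sub>0\<close> occurs only in the innermost factor \<open>- A\<^sub>0\<close>; the ports collect the factors to its left and to
  its right.\<close>

fun port_col :: "nat \<Rightarrow> (nat \<Rightarrow> 'a::comm_ring_1 mat) \<Rightarrow> (nat \<Rightarrow> bool) \<Rightarrow> nat \<Rightarrow> 'a mat" where
  "port_col n a c 0 = 1\<^sub>m n"
| "port_col n a c (Suc k) =
     (let e = vcat0 n (port_col n a c k)
      in if c (Suc k) then fiedler_step n (a (Suc k)) (k * n) * e else e)"

fun port_row :: "nat \<Rightarrow> (nat \<Rightarrow> 'a::comm_ring_1 mat) \<Rightarrow> (nat \<Rightarrow> bool) \<Rightarrow> nat \<Rightarrow> 'a mat" where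
  "port_row n a c 0 = 1\<^sub>m n"
| "port_row n a c (Suc k) =
     (let e = hcat0 n (port_row n a c k)
      in if c (Suc k) then e else e * fiedler_step n (a (Suc k)) (k * n))"

text \<open>The off-diagonal blocks and the trailing block of \<open>fiedler_step n A q\<close> in the partition after the
  first \<open>n\<close> rows and columns.\<close>

definition pcol :: "nat \<Rightarrow> nat \<Rightarrow> 'a::comm_ring_1 mat" where
  "pcol n q = four_block_mat (1\<^sub>m n) (0\<^sub>m n 0) (0\<^sub>m q n) (0\<^sub>m q 0)"

definition prow :: "nat \<Rightarrow> nat \<Rightarrow> 'a::comm_ring_1 mat" where
  "prow n q = four_block_mat (1\<^sub>m n) (0\<^sub>m n q) (0\<^sub>m 0 n) (0\<^sub>m 0 q)"

definition pcompl :: "nat \<Rightarrow> nat \<Rightarrow> 'a::comm_ring_1 mat" where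
  "pcompl n q = four_block_mat (0\<^sub>m n n) (0\<^sub>m n q) (0\<^sub>m q n) (1\<^sub>m q)"

lemma port_dim[simp]:
  "dim_row (pcol n q) = n + q" "dim_col (pcol n q) = n"
  "dim_row (prow n q) = n" "dim_col (prow n q) = n + q"
  "dim_row (pcompl n q) = n + q" "dim_col (pcompl n q) = n + q"
  by (simp_all add: pcol_def prow_def pcompl_def)

lemma four_block_empty: "four_block_mat A (0\<^sub>m (dim_row A) 0) (0\<^sub>m 0 (dim_col A)) (0\<^sub>m 0 0) = A"
  by (rule eq_matI) auto

lemma four_block_empty': "dim_row A = r \<Longrightarrow> dim_col A = s \<Longrightarrow>
    four_block_mat A (0\<^sub>m r 0) (0\<^sub>m 0 s) (0\<^sub>m 0 0) = A"
  using four_block_empty[of A] by simp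

lemma port_mult:
  fixes w11 :: "'a::comm_ring_1 mat"
  assumes "dim_row w12 = dim_row w11" "dim_col w21 = dim_col w11" "dim_row w21 = dim_row w22"
    "dim_col w12 = dim_col w22"
  shows "dim_row w11 = n \<Longrightarrow> dim_row w22 = q \<Longrightarrow> prow n q * four_block_mat w11 w12 w21 w22 =
      four_block_mat w11 w12 (0\<^sub>m 0 (dim_col w11)) (0\<^sub>m 0 (dim_col w22))"
    and "dim_col w11 = n \<Longrightarrow> dim_col w22 = q \<Longrightarrow> four_block_mat w11 w12 w21 w22 * pcol n q =
      four_block_mat w11 (0\<^sub>m (dim_row w11) 0) w21 (0\<^sub>m (dim_row w22) 0)"
    and "dim_row w11 = n \<Longrightarrow> dim_row w22 = q \<Longrightarrow> pcompl n q * four_block_mat w11 w12 w21 w22 =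
      four_block_mat (0\<^sub>m n (dim_col w11)) (0\<^sub>m n (dim_col w22)) w21 w22"
    and "dim_col w11 = n \<Longrightarrow> dim_col w22 = q \<Longrightarrow> four_block_mat w11 w12 w21 w22 * pcompl n q =
      four_block_mat (0\<^sub>m (dim_row w11) n) w12 (0\<^sub>m (dim_row w22) n) w22"
  unfolding prow_def pcol_def pcompl_def using assms
  by (simp_all add: mult_four_block_dim mat_trivial)

lemma prow_pcol: "prow n q * pcol n q = 1\<^sub>m n"
  unfolding prow_def pcol_def
  by (simp add: mult_four_block_dim mat_trivial four_block_empty')

lemma pcompl_pcol: "pcompl n q * pcol n q = 0\<^sub>m (n + q) n"
  and prow_pcompl: "prow n q * pcompl n q = 0\<^sub>m n (n + q)"
  unfolding prow_def pcol_def pcompl_def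
  by (auto simp: mult_four_block_dim mat_trivial intro!: eq_matI)

lemma mult_prow:
  fixes A :: "'a::comm_ring_1 mat"
  shows "dim_col A = n \<Longrightarrow> dim_row A = k \<Longrightarrow>
      A * prow n q = four_block_mat A (0\<^sub>m k q) (0\<^sub>m 0 n) (0\<^sub>m 0 q)"
    "dim_row A = n \<Longrightarrow> dim_col A = k \<Longrightarrow>
      pcol n q * A = four_block_mat A (0\<^sub>m n 0) (0\<^sub>m q k) (0\<^sub>m q 0)"
proof -
  assume A: "dim_col A = n" "dim_row A = k"
  have *: "four_block_mat A (0\<^sub>m k 0) (0\<^sub>m 0 n) (0\<^sub>m 0 0) = A"
    using A by (simp add: four_block_empty')
  have "four_block_mat A (0\<^sub>m k 0) (0\<^sub>m 0 n) (0\<^sub>m 0 0) * prow n q =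
      four_block_mat A (0\<^sub>m k q) (0\<^sub>m 0 n) (0\<^sub>m 0 q)"
    unfolding prow_def using A by (simp_all add: mult_four_block_dim mat_trivial)
  thus "A * prow n q = four_block_mat A (0\<^sub>m k q) (0\<^sub>m 0 n) (0\<^sub>m 0 q)" unfolding * .
next
  assume A: "dim_row A = n" "dim_col A = k"
  have *: "four_block_mat A (0\<^sub>m n 0) (0\<^sub>m 0 k) (0\<^sub>m 0 0) = A"
    using A by (simp add: four_block_empty')
  have "pcol n q * four_block_mat A (0\<^sub>m n 0) (0\<^sub>m 0 k) (0\<^sub>m 0 0) =
      four_block_mat A (0\<^sub>m n 0) (0\<^sub>m q k) (0\<^sub>m q 0)"
    unfolding pcol_def using A by (simp_all add: mult_four_block_dim mat_trivial)
  thus "pcol n q * A = four_block_mat A (0\<^sub>m n 0) (0\<^sub>m q k) (0\<^sub>m q 0)" unfolding * .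
qed

lemma pcol_mult_prow:
  fixes H :: "'a::comm_ring_1 mat"
  assumes "dim_row H = n" "dim_col H = n"
  shows "pcol n q * (H * prow n q) = dsum H (0\<^sub>m q q)"
  unfolding mult_prow(1)[OF assms(2,1)] pcol_def using assms by (simp add: mult_four_block_dim mat_trivial)

lemma prow_mult_dsum:
  fixes A :: "'a::comm_ring_1 mat"
  assumes "dim_row A = n" "dim_col A = n"
  shows "prow n q * four_block_mat A (0\<^sub>m n q) (0\<^sub>m q n) (1\<^sub>m q) = A * prow n q"
    "four_block_mat A (0\<^sub>m n q) (0\<^sub>m q n) (1\<^sub>m q) * pcol n q = pcol n q * A"
  unfolding mult_prow(1)[OF assms(2,1)] mult_prow(2)[OF assms] using assms by (simp_all add: port_mult)

lemma fiedler_step_split: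
  assumes "dim_row A = n" "dim_col A = n"
  shows "fiedler_step n A q = four_block_mat (- A) (prow n q) (pcol n q) (pcompl n q)"
  unfolding fiedler_step_def prow_def pcol_def pcompl_def using assms
  by (intro eq_matI) auto

lemma fiedler_step_dim[simp]:
  "dim_row A = n \<Longrightarrow> dim_row (fiedler_step n A q) = n + n + q"
  "dim_col A = n \<Longrightarrow> dim_col (fiedler_step n A q) = n + n + q"
  by (simp_all add: fiedler_step_def)

definition fiedler_step_inv :: "nat \<Rightarrow> 'a::comm_ring_1 mat \<Rightarrow> nat \<Rightarrow> 'a mat" where
  "fiedler_step_inv n A q = four_block_mat (0\<^sub>m n n) (prow n q) (pcol n q) (dsum A (1\<^sub>m q))"

lemma fiedler_step_inv_dim[simp]:
  "dim_row A = n \<Longrightarrow> dim_row (fiedler_step_inv n A q) = n + n + q"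
  "dim_col A = n \<Longrightarrow> dim_col (fiedler_step_inv n A q) = n + n + q"
  by (simp_all add: fiedler_step_inv_def)

lemma fiedler_step_inv:
  fixes A :: "'a::comm_ring_1 mat"
  assumes A: "dim_row A = n" "dim_col A = n"
  shows "fiedler_step n A q * fiedler_step_inv n A q = 1\<^sub>m (n + n + q)"
    "fiedler_step_inv n A q * fiedler_step n A q = 1\<^sub>m (n + n + q)"
proof -
  have 1: "pcol n q * prow n q = four_block_mat (1\<^sub>m n :: 'a mat) (0\<^sub>m n q) (0\<^sub>m q n) (0\<^sub>m q q)"
    using pcol_mult_prow[of "1\<^sub>m n :: 'a mat" n q] by (simp add: mat_trivial)
  have 2: "pcompl n q * four_block_mat A (0\<^sub>m n q) (0\<^sub>m q n) (1\<^sub>m q) = pcompl n q"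
    "four_block_mat A (0\<^sub>m n q) (0\<^sub>m q n) (1\<^sub>m q) * pcompl n q = pcompl n q"
    using A by (simp_all add: port_mult mat_trivial) (simp_all add: pcompl_def)
  have 3: "four_block_mat (1\<^sub>m n :: 'a mat) (0\<^sub>m n q) (0\<^sub>m q n) (0\<^sub>m q q) + pcompl n q = 1\<^sub>m (n + q)"
    unfolding pcompl_def by (simp add: four_block_arith mat_trivial)
  have 4: "- (A * prow n q) + A * prow n q = 0\<^sub>m n (n + q)" "- (pcol n q * A) + pcol n q * A = 0\<^sub>m (n + q) n"
    using A by (auto intro!: eq_matI)
  show "fiedler_step n A q * fiedler_step_inv n A q = 1\<^sub>m (n + n + q)"
    using A by (simp add: fiedler_step_split fiedler_step_inv_def mult_four_block_dim mat_trivial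
        prow_pcol pcompl_pcol prow_mult_dsum uminus_mult_dim 1 2 3 4 add.assoc)
  show "fiedler_step_inv n A q * fiedler_step n A q = 1\<^sub>m (n + n + q)"
    using A by (simp add: fiedler_step_split fiedler_step_inv_def mult_four_block_dim mat_trivial
        prow_pcol prow_pcompl prow_mult_dsum uminus_mult_dim 1 2 3 4 add.assoc)
qed

lemma fiedler_word_dim:
  assumes "\<And>i. i \<le> k \<Longrightarrow> a i \<in> carrier_mat n n"
  shows "dim_row (fiedler_word n a c k) = Suc k * n \<and> dim_col (fiedler_word n a c k) = Suc k * n"
  using assms
proof (induction k)
  case (Suc k)
  have "dim_row (a (Suc k)) = n" "dim_col (a (Suc k)) = n" using Suc.prems[of "Suc k"] by auto
  with Suc show ?case by (simp add: Let_def)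
qed (use assms in auto)

lemma port_dims:
  assumes "\<And>i. i \<le> k \<Longrightarrow> a i \<in> carrier_mat n n"
  shows "dim_row (port_col n a c k) = Suc k * n \<and> dim_col (port_col n a c k) = n \<and>
    dim_row (port_row n a c k) = n \<and> dim_col (port_row n a c k) = Suc k * n"
  using assms
proof (induction k)
  case (Suc k)
  have "dim_row (a (Suc k)) = n" "dim_col (a (Suc k)) = n" using Suc.prems[of "Suc k"] by auto
  with Suc show ?case by (simp add: Let_def)
qed (use assms in auto)

text \<open>The Horner scheme for \<open>- \<Sum>\<^bsub>q\<le>k\<^esub> x\<^bsup>k-q\<^esup> a\<^sub>q\<close>, and the one for
  \<open>x\<^bsup>k+1\<^esup> H + \<Sum>\<^bsub>q\<le>k\<^esub> x\<^sup>q a\<^sub>q\<close>, in the form in which they arise from block elimination.\<close>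

fun shifted_coeff :: "nat \<Rightarrow> 'a::comm_ring_1 \<Rightarrow> (nat \<Rightarrow> 'a mat) \<Rightarrow> nat \<Rightarrow> 'a mat" where
  "shifted_coeff n x a 0 = - a 0"
| "shifted_coeff n x a (Suc k) = - a (Suc k) + x \<cdot>\<^sub>m shifted_coeff n x a k"

fun horner :: "'a::comm_ring_1 \<Rightarrow> (nat \<Rightarrow> 'a mat) \<Rightarrow> 'a mat \<Rightarrow> nat \<Rightarrow> 'a mat" where
  "horner x a H 0 = x \<cdot>\<^sub>m H + a 0"
| "horner x a H (Suc k) = horner x a (x \<cdot>\<^sub>m H + a (Suc k)) k"

context entry_ring
begin

lemma S_unit_fiedler_step_inv:
  assumes "A \<in> carrier_mat n n" "ent A"
  shows "S_unit (n + n + q) (fiedler_step_inv n A q)" "S_unit (n + n + q) (fiedler_step n A q)"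
proof -
  have d: "dim_row A = n" "dim_col A = n" using assms by auto
  have e: "ent (pcol n q)" "ent (prow n q)" "ent (pcompl n q)"
    unfolding pcol_def prow_def pcompl_def by (simp_all add: ent_intros)
  have e': "ent (fiedler_step n A q)" "ent (fiedler_step_inv n A q)"
    unfolding fiedler_step_split[OF d] fiedler_step_inv_def using d assms e by (simp_all add: ent_intros)
  have c: "fiedler_step n A q \<in> carrier_mat (n + n + q) (n + n + q)"
    "fiedler_step_inv n A q \<in> carrier_mat (n + n + q) (n + n + q)"
    by (rule carrier_matI; simp add: d)+
  show "S_unit (n + n + q) (fiedler_step_inv n A q)" "S_unit (n + n + q) (fiedler_step n A q)"
    by (rule S_unitI[OF c(2) c(1) e'(2) e'(1)], simp_all add: fiedler_step_inv d)
       (rule S_unitI[OF c(1) c(2) e'(1) e'(2)], simp_all add: fiedler_step_inv d)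
qed

text \<open>The blocks besides \<open>- A\<^bsub>k+1\<^esub>\<close> in the new factor consist of zeros and identities. Hence \<open>I - x w\<^sub>2\<^sub>2\<close>
  for the longer word is block triangular with diagonal blocks \<open>I\<close> and \<open>I - x w\<^sub>2\<^sub>2\<close> for the
  shorter word. By induction it is invertible over \<open>S\<close> for every \<open>x\<close>, and the Schur complement
  obeys a Horner recursion.\<close>

lemma fiedler_word_schur:
  assumes x: "x \<in> S" and a: "\<And>i. i \<le> k \<Longrightarrow> a i \<in> carrier_mat n n" "\<And>i. i \<le> k \<Longrightarrow> ent (a i)"
  shows "\<exists>w11 w12 w21 w22 y. fiedler_word n a c k = four_block_mat w11 w12 w21 w22 \<and>
    w11 \<in> carrier_mat n n \<and> w12 \<in> carrier_mat n (k * n) \<and> w21 \<in> carrier_mat (k * n) n \<and>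
    w22 \<in> carrier_mat (k * n) (k * n) \<and> y \<in> carrier_mat (k * n) (k * n) \<and>
    ent w11 \<and> ent w12 \<and> ent w21 \<and> ent w22 \<and> ent y \<and>
    (1\<^sub>m (k * n) - x \<cdot>\<^sub>m w22) * y = 1\<^sub>m (k * n) \<and> y * (1\<^sub>m (k * n) - x \<cdot>\<^sub>m w22) = 1\<^sub>m (k * n) \<and>
    w11 + x \<cdot>\<^sub>m (w12 * (y * w21)) = shifted_coeff n x a k"
  using a
proof (induction k)
  case 0
  have d: "dim_row (a 0) = n" "dim_col (a 0) = n" using 0(1)[of 0] by auto
  show ?case
    apply (rule exI[of _ "- a 0"], rule exI[of _ "0\<^sub>m n 0"], rule exI[of _ "0\<^sub>m 0 n"],
        rule exI[of _ "0\<^sub>m 0 0"], rule exI[of _ "0\<^sub>m 0 0"])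
    using 0(1)[of 0] 0(2)[of 0] d by (auto simp: four_block_empty' mat_trivial ent_intros)
next
  case (Suc k)
  define q where "q = k * n"
  define W where "W = fiedler_word n a c k"
  define A where "A = a (Suc k)"
  have A: "dim_row A = n" "dim_col A = n" "ent A"
    using Suc.prems(1)[of "Suc k"] Suc.prems(2)[of "Suc k"] by (auto simp: A_def)
  obtain w11 w12 w21 w22 y where W': "W = four_block_mat w11 w12 w21 w22"
    and c: "w11 \<in> carrier_mat n n" "w12 \<in> carrier_mat n q" "w21 \<in> carrier_mat q n"
      "w22 \<in> carrier_mat q q" "y \<in> carrier_mat q q"
    and e: "ent w11" "ent w12" "ent w21" "ent w22" "ent y"
    and y: "(1\<^sub>m q - x \<cdot>\<^sub>m w22) * y = 1\<^sub>m q" "y * (1\<^sub>m q - x \<cdot>\<^sub>m w22) = 1\<^sub>m q"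
    and f: "w11 + x \<cdot>\<^sub>m (w12 * (y * w21)) = shifted_coeff n x a k"
    using Suc unfolding q_def W_def by fastforce
  note d = c[THEN carrier_matD(1)] c[THEN carrier_matD(2)]
  have Wd: "dim_row W = n + q" "dim_col W = n + q" unfolding W' using d by simp_all
  have fw: "fiedler_word n a c (Suc k) =
     (if c (Suc k) then four_block_mat (- A) (prow n q * W) (pcol n q) (pcompl n q * W)
      else four_block_mat (- A) (prow n q) (W * pcol n q) (W * pcompl n q))"
    unfolding fiedler_word.simps Let_def W_def[symmetric] A_def[symmetric] q_def[symmetric]
      fiedler_step_split[OF A(1,2)]
    by (auto simp: mult_four_block_dim mat_trivial A Wd)
  have N: "Suc k * n = n + q" by (simp add: q_def)
  have fin: "- A + x \<cdot>\<^sub>m (w11 + x \<cdot>\<^sub>m (w12 * (y * w21))) = shifted_coeff n x a (Suc k)"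
    using f by (simp add: A_def)
  have eW: "ent W" unfolding W' using e d by (simp add: ent_intros)
  have ep: "ent (pcol n q)" "ent (prow n q)" "ent (pcompl n q)"
    unfolding pcol_def prow_def pcompl_def by (simp_all add: ent_intros)
  note base = A Wd eW ep e x d
  show ?case
  proof (cases "c (Suc k)")
    case True
    define y' where "y' = four_block_mat (1\<^sub>m n) (0\<^sub>m n q) (x \<cdot>\<^sub>m (y * w21)) y"
    have y'd: "dim_row y' = n + q" "dim_col y' = n + q" by (simp_all add: y'_def d)
    have *: "pcompl n q * W = four_block_mat (0\<^sub>m n n) (0\<^sub>m n q) w21 w22"
      "prow n q * W = four_block_mat w11 w12 (0\<^sub>m 0 n) (0\<^sub>m 0 q)"
      unfolding W' by (simp_all add: port_mult d)
    have "1\<^sub>m (n + q) - x \<cdot>\<^sub>m (pcompl n q * W) =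
      four_block_mat (1\<^sub>m n) (0\<^sub>m n q) (0\<^sub>m q n) (1\<^sub>m q)
        - x \<cdot>\<^sub>m four_block_mat (0\<^sub>m n n) (0\<^sub>m n q) w21 w22"
      unfolding * by simp
    also have "\<dots> = four_block_mat (1\<^sub>m n) (0\<^sub>m n q) (- (x \<cdot>\<^sub>m w21)) (1\<^sub>m q - x \<cdot>\<^sub>m w22)"
      by (simp add: four_block_arith d mat_trivial del: four_block_one_mat)
    finally have P: "1\<^sub>m (n + q) - x \<cdot>\<^sub>m (pcompl n q * W) = \<dots>" .
    have z1: "- (x \<cdot>\<^sub>m w21) + (1\<^sub>m q - x \<cdot>\<^sub>m w22) * (x \<cdot>\<^sub>m (y * w21)) = 0\<^sub>m q n"
    proof -
      have "(1\<^sub>m q - x \<cdot>\<^sub>m w22) * (x \<cdot>\<^sub>m (y * w21)) = x \<cdot>\<^sub>m (((1\<^sub>m q - x \<cdot>\<^sub>m w22) * y) * w21)"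
        by (simp add: smult_mult_dim mult_assoc_dim d)
      also have "\<dots> = x \<cdot>\<^sub>m w21" by (simp add: y mat_trivial d)
      finally show ?thesis using d by (auto intro!: eq_matI)
    qed
    have z3: "- (x \<cdot>\<^sub>m w21) + x \<cdot>\<^sub>m ((1\<^sub>m q - x \<cdot>\<^sub>m w22) * (y * w21)) = 0\<^sub>m q n"
      using z1 by (simp add: smult_mult_dim d)
    have z2: "x \<cdot>\<^sub>m (y * w21) + - (x \<cdot>\<^sub>m (y * w21)) = 0\<^sub>m q n" using d by (auto intro!: eq_matI)
    have inv: "(1\<^sub>m (n + q) - x \<cdot>\<^sub>m (pcompl n q * W)) * y' = 1\<^sub>m (n + q)"
      "y' * (1\<^sub>m (n + q) - x \<cdot>\<^sub>m (pcompl n q * W)) = 1\<^sub>m (n + q)"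
      unfolding P y'_def by (simp_all add: mult_four_block_dim d mat_trivial z1 z2 z3 y uminus_mult_dim smult_mult_dim)
    have "y' * pcol n q = four_block_mat (1\<^sub>m n) (0\<^sub>m n 0) (x \<cdot>\<^sub>m (y * w21)) (0\<^sub>m q 0)"
      unfolding y'_def by (simp add: port_mult d)
    hence "prow n q * W * (y' * pcol n q) = w11 + x \<cdot>\<^sub>m (w12 * (y * w21))"
      unfolding * by (simp add: mult_four_block_dim mat_trivial d smult_mult_dim four_block_empty')
    hence fin': "- A + x \<cdot>\<^sub>m (prow n q * W * (y' * pcol n q)) = shifted_coeff n x a (Suc k)"
      using fin by simp
    have F: "fiedler_word n a c (Suc k) = four_block_mat (- A) (prow n q * W) (pcol n q) (pcompl n q * W)"
      unfolding fw using True by simp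
    have cs: "- A \<in> carrier_mat n n" "prow n q * W \<in> carrier_mat n (n + q)" "pcol n q \<in> carrier_mat (n + q) n"
      "pcompl n q * W \<in> carrier_mat (n + q) (n + q)" "y' \<in> carrier_mat (n + q) (n + q)"
      by (rule carrier_matI; simp add: A Wd y'd)+
    have es: "ent (- A)" "ent (prow n q * W)" "ent (pcol n q)" "ent (pcompl n q * W)" "ent y'"
      unfolding y'_def using base by (simp_all add: ent_intros)
    show ?thesis unfolding N
      apply (rule exI[of _ "- A"], rule exI[of _ "prow n q * W"], rule exI[of _ "pcol n q"],
        rule exI[of _ "pcompl n q * W"], rule exI[of _ y'])
      by (intro conjI F cs es inv fin')
  next
    case False
    define y' where "y' = four_block_mat (1\<^sub>m n) (x \<cdot>\<^sub>m (w12 * y)) (0\<^sub>m q n) y"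
    have y'd: "dim_row y' = n + q" "dim_col y' = n + q" by (simp_all add: y'_def d)
    have *: "W * pcompl n q = four_block_mat (0\<^sub>m n n) w12 (0\<^sub>m q n) w22"
      "W * pcol n q = four_block_mat w11 (0\<^sub>m n 0) w21 (0\<^sub>m q 0)"
      unfolding W' by (simp_all add: port_mult d)
    have "1\<^sub>m (n + q) - x \<cdot>\<^sub>m (W * pcompl n q) =
      four_block_mat (1\<^sub>m n) (0\<^sub>m n q) (0\<^sub>m q n) (1\<^sub>m q)
        - x \<cdot>\<^sub>m four_block_mat (0\<^sub>m n n) w12 (0\<^sub>m q n) w22"
      unfolding * by simp
    also have "\<dots> = four_block_mat (1\<^sub>m n) (- (x \<cdot>\<^sub>m w12)) (0\<^sub>m q n) (1\<^sub>m q - x \<cdot>\<^sub>m w22)"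
      by (simp add: four_block_arith d mat_trivial del: four_block_one_mat)
    finally have P: "1\<^sub>m (n + q) - x \<cdot>\<^sub>m (W * pcompl n q) = \<dots>" .
    have z1: "- (x \<cdot>\<^sub>m w12) + (x \<cdot>\<^sub>m (w12 * y)) * (1\<^sub>m q - x \<cdot>\<^sub>m w22) = 0\<^sub>m n q"
    proof -
      have "(x \<cdot>\<^sub>m (w12 * y)) * (1\<^sub>m q - x \<cdot>\<^sub>m w22) = x \<cdot>\<^sub>m (w12 * (y * (1\<^sub>m q - x \<cdot>\<^sub>m w22)))"
        by (simp add: smult_mult_dim mult_assoc_dim d)
      also have "\<dots> = x \<cdot>\<^sub>m w12" by (simp add: y mat_trivial d)
      finally show ?thesis using d by (auto intro!: eq_matI)
    qed
    have z3: "- (x \<cdot>\<^sub>m w12) + x \<cdot>\<^sub>m ((w12 * y) * (1\<^sub>m q - x \<cdot>\<^sub>m w22)) = 0\<^sub>m n q"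
      using z1 by (simp add: smult_mult_dim d)
    have z2: "x \<cdot>\<^sub>m (w12 * y) + - (x \<cdot>\<^sub>m (w12 * y)) = 0\<^sub>m n q" using d by (auto intro!: eq_matI)
    have inv: "(1\<^sub>m (n + q) - x \<cdot>\<^sub>m (W * pcompl n q)) * y' = 1\<^sub>m (n + q)"
      "y' * (1\<^sub>m (n + q) - x \<cdot>\<^sub>m (W * pcompl n q)) = 1\<^sub>m (n + q)"
      unfolding P y'_def by (simp_all add: mult_four_block_dim d mat_trivial z1 z2 z3 y uminus_mult_dim smult_mult_dim)
    have "prow n q * y' = four_block_mat (1\<^sub>m n) (x \<cdot>\<^sub>m (w12 * y)) (0\<^sub>m 0 n) (0\<^sub>m 0 q)"
      unfolding y'_def by (simp add: port_mult d)
    hence "(prow n q * y') * (W * pcol n q) = w11 + x \<cdot>\<^sub>m (w12 * (y * w21))"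
      unfolding * by (simp add: mult_four_block_dim mat_trivial d smult_mult_dim mult_assoc_dim four_block_empty')
    hence "prow n q * (y' * (W * pcol n q)) = w11 + x \<cdot>\<^sub>m (w12 * (y * w21))"
      by (simp add: mult_assoc_dim Wd y'd)
    hence fin': "- A + x \<cdot>\<^sub>m (prow n q * (y' * (W * pcol n q))) = shifted_coeff n x a (Suc k)"
      using fin by simp
    have F: "fiedler_word n a c (Suc k) = four_block_mat (- A) (prow n q) (W * pcol n q) (W * pcompl n q)"
      unfolding fw using False by simp
    have cs: "- A \<in> carrier_mat n n" "prow n q \<in> carrier_mat n (n + q)" "W * pcol n q \<in> carrier_mat (n + q) n"
      "W * pcompl n q \<in> carrier_mat (n + q) (n + q)" "y' \<in> carrier_mat (n + q) (n + q)"
      by (rule carrier_matI; simp add: A Wd y'd)+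
    have es: "ent (- A)" "ent (prow n q)" "ent (W * pcol n q)" "ent (W * pcompl n q)" "ent y'"
      unfolding y'_def using base by (simp_all add: ent_intros)
    show ?thesis unfolding N
      apply (rule exI[of _ "- A"], rule exI[of _ "prow n q"], rule exI[of _ "W * pcol n q"],
        rule exI[of _ "W * pcompl n q"], rule exI[of _ y'])
      by (intro conjI F cs es inv fin')
  qed
qed

text \<open>The factor \<open>M\<^bsub>k+1\<^esub>\<close> is invertible over \<open>S\<close> for every value of \<open>A\<^bsub>k+1\<^esub>\<close>. Multiplying by its inverse on the
  side on which it stands removes it from the word, and from the port on this side, and leaves a
  pivot \<open>-I\<close> in the corner. Eliminating the pivot replaces \<open>H\<close> by \<open>x H + A\<^bsub>k+1\<^esub>\<close>.\<close>

lemma fiedler_word_pencil_eqv: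
  assumes x: "x \<in> S" and a: "\<And>i. i \<le> k \<Longrightarrow> a i \<in> carrier_mat n n" "\<And>i. i \<le> k \<Longrightarrow> ent (a i)"
    and H: "H \<in> carrier_mat n n" "ent H"
  shows "port_eqv (Suc k * n) (x \<cdot>\<^sub>m dsum H (1\<^sub>m (k * n)) - fiedler_word n a c k)
    (port_col n a c k) (port_row n a c k)
    (dsum (1\<^sub>m (k * n)) (horner x a H k)) (vcat0 (k * n) (1\<^sub>m n)) (hcat0 (k * n) (1\<^sub>m n))"
  using a H
proof (induction k arbitrary: H)
  case 0
  have d: "dim_row (a 0) = n" "dim_col (a 0) = n" "dim_row H = n" "dim_col H = n"
    using 0(1)[of 0] 0(3) by auto
  have "x \<cdot>\<^sub>m dsum H (1\<^sub>m (0 * n)) - fiedler_word n a c 0 = dsum (1\<^sub>m (0 * n)) (horner x a H 0)"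
    using d by (intro eq_matI) auto
  thus ?case using d
    by (intro port_eqvI[of _ _ _ _ "1\<^sub>m n" "1\<^sub>m n"]) (auto intro: S_unit_one simp: vcat0_0 hcat0_0)
next
  case (Suc k)
  define q where "q = k * n"
  define W where "W = fiedler_word n a c k"
  define A where "A = a (Suc k)"
  have A: "dim_row A = n" "dim_col A = n" "ent A" "A \<in> carrier_mat n n"
    using Suc.prems(1)[of "Suc k"] Suc.prems(2)[of "Suc k"] by (auto simp: A_def)
  have Hd: "dim_row H = n" "dim_col H = n" using Suc.prems by auto
  have Wd: "dim_row W = n + q" "dim_col W = n + q"
    using fiedler_word_dim[of k a n c] Suc.prems(1) by (auto simp: W_def q_def)
  define l where "l = port_col n a c k"
  define r where "r = port_row n a c k"
  have lr: "dim_row l = n + q" "dim_col l = n" "dim_row r = n" "dim_col r = n + q"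
    using port_dims[of k a n c] Suc.prems(1) by (auto simp: l_def r_def q_def)
  let ?M = "fiedler_step n A q" and ?Mi = "fiedler_step_inv n A q"
  have M1: "?Mi * ?M = 1\<^sub>m (n + n + q)" "?M * ?Mi = 1\<^sub>m (n + n + q)"
    using fiedler_step_inv[OF A(1,2)] by auto
  have M2: "?Mi * (?M * X) = X" if "dim_row X = n + n + q" for X
  proof -
    have "?Mi * (?M * X) = (?Mi * ?M) * X" using that A by (simp add: mult_assoc_dim)
    thus ?thesis using that by (simp add: M1 mat_trivial)
  qed
  have M3: "(X * ?M) * ?Mi = X" if "dim_col X = n + n + q" for X
    using that A by (simp add: mult_assoc_dim M1 mat_trivial)
  have ep: "ent (pcol n q)" "ent (prow n q)" "ent (pcompl n q)"
    unfolding pcol_def prow_def pcompl_def by (simp_all add: ent_intros)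
  define F where "F = x \<cdot>\<^sub>m dsum H (1\<^sub>m (Suc k * n)) - fiedler_word n a c (Suc k)"
  define l' where "l' = port_col n a c (Suc k)"
  define r' where "r' = port_row n a c (Suc k)"
  have lr': "dim_row l' = n + (n + q)" "dim_col r' = n + (n + q)"
    using port_dims[of "Suc k" a n c] Suc.prems(1) by (auto simp: l'_def r'_def q_def)
  define H' where "H' = x \<cdot>\<^sub>m H + A"
  have H': "H' \<in> carrier_mat n n" "ent H'" "dim_row H' = n" "dim_col H' = n"
    using Suc.prems(3,4) A x by (auto simp: H'_def intro!: ent_intros)
  have Wf: "fiedler_word n a c (Suc k) = (if c (Suc k) then ?M * dsum (1\<^sub>m n) W else dsum (1\<^sub>m n) W * ?M)"
    by (simp add: Let_def W_def A_def q_def)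
  have N: "Suc k * n = n + q" "Suc (Suc k) * n = n + (n + q)" by (simp_all add: q_def)
  have Fd: "dim_row F = n + (n + q)" "dim_col F = n + (n + q)"
    using A Wd Hd unfolding F_def Wf by (auto simp: q_def)
  \<comment> \<open>The Horner step: the Schur complement of the pivot is the pencil of the shorter word, with
    \<open>H' = x H + A\<^bsub>k+1\<^esub>\<close> instead of \<open>H\<close>.\<close>
  have D: "(x \<cdot>\<^sub>m dsum A (1\<^sub>m q) - W) + x \<cdot>\<^sub>m (x \<cdot>\<^sub>m dsum H (0\<^sub>m q q)) = x \<cdot>\<^sub>m dsum H' (1\<^sub>m q) - W"
    unfolding H'_def using Hd A Wd by (intro eq_matI) (auto simp: algebra_simps)
  have IH: "port_eqv (n + q) (x \<cdot>\<^sub>m dsum H' (1\<^sub>m q) - W) l r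
      (dsum (1\<^sub>m q) (horner x a H' k)) (vcat0 q (1\<^sub>m n)) (hcat0 q (1\<^sub>m n))"
    using Suc.IH[OF _ _ H'(1,2)] Suc.prems(1,2) by (simp add: W_def l_def r_def q_def)
  have hd: "horner x a H (Suc k) = horner x a H' k" by (simp add: H'_def A_def)
  have tail: "port_eqv (n + (n + q)) (dsum (1\<^sub>m n) (x \<cdot>\<^sub>m dsum H' (1\<^sub>m q) - W)) (vcat0 n l) (hcat0 n r)
      (dsum (1\<^sub>m (n + q)) (horner x a H' k)) (vcat0 (n + q) (1\<^sub>m n)) (hcat0 (n + q) (1\<^sub>m n))"
    using port_eqv_dsum_one[OF IH, of n]
    by (simp only: vcat0_vcat0 hcat0_hcat0 dsum_assoc dsum_one)
  have cD: "x \<cdot>\<^sub>m dsum A (1\<^sub>m q) - W \<in> carrier_mat (n + q) (n + q)"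
    by (rule carrier_matI; simp add: Wd A)
  have pivot: "port_eqv (n + (n + q)) (four_block_mat (- 1\<^sub>m n) X Y (x \<cdot>\<^sub>m dsum A (1\<^sub>m q) - W))
      (vcat0 n l) (hcat0 n r)
      (dsum (1\<^sub>m n) (x \<cdot>\<^sub>m dsum H' (1\<^sub>m q) - W)) (vcat0 n l) (hcat0 n r)"
    if "X \<in> carrier_mat n (n + q)" "Y \<in> carrier_mat (n + q) n" "ent X" "ent Y"
      "Y * X = x \<cdot>\<^sub>m (x \<cdot>\<^sub>m dsum H (0\<^sub>m q q))" for X Y
  proof -
    have "port_eqv (n + (n + q)) (four_block_mat (- 1\<^sub>m n) X Y (x \<cdot>\<^sub>m dsum A (1\<^sub>m q) - W))
      (vcat0 n l) (hcat0 n r)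
      (dsum (1\<^sub>m n) ((x \<cdot>\<^sub>m dsum A (1\<^sub>m q) - W) + Y * X)) (vcat0 n l) (hcat0 n r)"
      by (rule port_eqv_pivot[OF that(1,2) cD that(3,4) lr(1,4)])
    thus ?thesis unfolding that(5) D .
  qed
  have head: "port_eqv (n + (n + q)) F l' r'
     (four_block_mat (- 1\<^sub>m n) X Y (x \<cdot>\<^sub>m dsum A (1\<^sub>m q) - W)) (vcat0 n l) (hcat0 n r)"
    if "X = (if c (Suc k) then x \<cdot>\<^sub>m prow n q else x \<cdot>\<^sub>m (H * prow n q))"
       "Y = (if c (Suc k) then x \<cdot>\<^sub>m (pcol n q * H) else x \<cdot>\<^sub>m pcol n q)" for X Y
  proof (cases "c (Suc k)")
    case True
    have "?Mi * F = ?Mi * (x \<cdot>\<^sub>m dsum H (1\<^sub>m (n + q))) - ?Mi * (?M * dsum (1\<^sub>m n) W)"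
      unfolding F_def Wf N using True Wd Hd A
      by (simp add: mult_minus_dim)
    also have "?Mi * (?M * dsum (1\<^sub>m n) W) = dsum (1\<^sub>m n) W"
      by (rule M2) (simp add: Wd)
    also have "?Mi * (x \<cdot>\<^sub>m dsum H (1\<^sub>m (n + q))) - dsum (1\<^sub>m n) W =
        x \<cdot>\<^sub>m four_block_mat (0\<^sub>m n n) (prow n q) (pcol n q * H) (dsum A (1\<^sub>m q))
        - dsum (1\<^sub>m n) W"
      using Wd Hd A by (simp add: fiedler_step_inv_def smult_mult_dim mult_four_block_dim mat_trivial)
    also have "\<dots> = four_block_mat (- 1\<^sub>m n) X Y (x \<cdot>\<^sub>m dsum A (1\<^sub>m q) - W)"
      using True Wd Hd A that by (simp add: four_block_arith mat_trivial)
    finally have 1: "?Mi * F = \<dots>" .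
    have 2: "l' = ?M * vcat0 n l" "r' = hcat0 n r"
      using True by (simp_all add: l'_def r'_def l_def r_def A_def q_def Let_def)
    show ?thesis
      by (rule port_eqvI[of _ _ _ _ ?Mi "1\<^sub>m (n + (n + q))"])
         (use S_unit_fiedler_step_inv[OF A(4,3), of q] 1 Fd lr lr' A Wd in
           \<open>simp_all add: S_unit_one mat_trivial 2 M2 add.assoc\<close>)
  next
    case False
    have "F * ?Mi = (x \<cdot>\<^sub>m dsum H (1\<^sub>m (n + q))) * ?Mi - (dsum (1\<^sub>m n) W * ?M) * ?Mi"
      unfolding F_def Wf N using False Wd Hd A
      by (simp add: mult_minus_dim)
    also have "(dsum (1\<^sub>m n) W * ?M) * ?Mi = dsum (1\<^sub>m n) W"
      by (rule M3) (simp add: Wd)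
    also have "(x \<cdot>\<^sub>m dsum H (1\<^sub>m (n + q))) * ?Mi - dsum (1\<^sub>m n) W =
        x \<cdot>\<^sub>m four_block_mat (0\<^sub>m n n) (H * prow n q) (pcol n q) (dsum A (1\<^sub>m q))
        - dsum (1\<^sub>m n) W"
      using Wd Hd A by (simp add: fiedler_step_inv_def smult_mult_dim mult_four_block_dim mat_trivial)
    also have "\<dots> = four_block_mat (- 1\<^sub>m n) X Y (x \<cdot>\<^sub>m dsum A (1\<^sub>m q) - W)"
      using False Wd Hd A that by (simp add: four_block_arith mat_trivial)
    finally have 1: "F * ?Mi = \<dots>" .
    have 2: "r' = hcat0 n r * ?M" "l' = vcat0 n l"
      using False by (simp_all add: l'_def r'_def l_def r_def A_def q_def Let_def)
    show ?thesis
      by (rule port_eqvI[of _ _ _ _ "1\<^sub>m (n + (n + q))" ?Mi])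
         (use S_unit_fiedler_step_inv[OF A(4,3), of q] 1 Fd lr lr' A Wd in
           \<open>simp_all add: S_unit_one mat_trivial 2 M3 add.assoc\<close>)
  qed
  define X where "X = (if c (Suc k) then x \<cdot>\<^sub>m prow n q else x \<cdot>\<^sub>m (H * prow n q))"
  define Y where "Y = (if c (Suc k) then x \<cdot>\<^sub>m (pcol n q * H) else x \<cdot>\<^sub>m pcol n q)"
  have "port_eqv (n + (n + q)) F l' r'
     (dsum (1\<^sub>m (n + q)) (horner x a H' k)) (vcat0 (n + q) (1\<^sub>m n)) (hcat0 (n + q) (1\<^sub>m n))"
  proof (rule port_eqv_trans[OF head[OF X_def Y_def] port_eqv_trans[OF pivot tail]])
    show "X \<in> carrier_mat n (n + q)" "Y \<in> carrier_mat (n + q) n" "ent X" "ent Y"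
      using Hd Suc.prems(4) x ep by (auto simp: X_def Y_def ent_intros intro!: carrier_matI)
    show "Y * X = x \<cdot>\<^sub>m (x \<cdot>\<^sub>m dsum H (0\<^sub>m q q))"
      using Hd by (simp add: X_def Y_def smult_mult_dim mult_assoc_dim pcol_mult_prow)
  qed
  thus ?case unfolding F_def l'_def r'_def hd N .
qed

end

section \<open>Reversal\<close>

text \<open>Reversal of rows and columns is conjugation by the flip permutation. It exchanges \<open>M\<^bsub>i-m\<^esub>\<close> with a
  matrix of the form \<open>M\<^sub>i\<close>, which reduces the words with negative indices to Fiedler words.\<close>

definition rv :: "'a mat \<Rightarrow> 'a mat" where
  "rv X = mat (dim_row X) (dim_col X) (\<lambda>(i, j). X $$ (dim_row X - 1 - i, dim_col X - 1 - j))"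

lemma rv_dim[simp]: "dim_row (rv X) = dim_row X" "dim_col (rv X) = dim_col X"
  by (simp_all add: rv_def)

lemma rv_index[simp]: "i < dim_row X \<Longrightarrow> j < dim_col X \<Longrightarrow>
    rv X $$ (i, j) = X $$ (dim_row X - 1 - i, dim_col X - 1 - j)"
  by (simp add: rv_def)

lemma rv_rv: "rv (rv X) = X"
  by (rule eq_matI) auto

lemma rv_mult:
  fixes X Y :: "'a::comm_ring_1 mat"
  assumes "dim_col X = dim_row Y" shows "rv (X * Y) = rv X * rv Y"
proof (rule eq_matI, goal_cases)
  case (1 i j)
  have "(\<Sum>k = 0..<dim_row Y. X $$ (dim_row X - Suc i, k) * Y $$ (k, dim_col Y - Suc j)) =
    (\<Sum>k = 0..<dim_row Y. X $$ (dim_row X - Suc i, dim_row Y - Suc k) * Y $$ (dim_row Y - Suc k, dim_col Y - Suc j))"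
    by (rule sum.reindex_bij_witness[of _ "\<lambda>k. dim_row Y - Suc k" "\<lambda>k. dim_row Y - Suc k"]) auto
  thus ?case using 1 assms by (auto simp: scalar_prod_def)
qed auto

lemma rv_arith:
  fixes X Y :: "'a::comm_ring_1 mat"
  shows "dim_row X = dim_row Y \<Longrightarrow> dim_col X = dim_col Y \<Longrightarrow> rv (X + Y) = rv X + rv Y"
    and "dim_row X = dim_row Y \<Longrightarrow> dim_col X = dim_col Y \<Longrightarrow> rv (X - Y) = rv X - rv Y"
    and "rv (- X) = - rv X" and "rv (k \<cdot>\<^sub>m X) = k \<cdot>\<^sub>m rv X"
  by (auto intro!: eq_matI)

lemma rv_one: "rv (1\<^sub>m r) = (1\<^sub>m r :: 'a::comm_ring_1 mat)" and rv_zero: "rv (0\<^sub>m r c) = (0\<^sub>m r c :: 'a mat)"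
  by (auto intro!: eq_matI)

lemma rv_four_block:
  assumes "dim_row B = dim_row A" "dim_col C = dim_col A" "dim_row C = dim_row D"
    "dim_col B = dim_col D"
  shows "rv (four_block_mat A B C D) = four_block_mat (rv D) (rv C) (rv B) (rv A)"
proof (rule eq_matI)
  fix i j assume "i < dim_row (four_block_mat (rv D) (rv C) (rv B) (rv A))"
    "j < dim_col (four_block_mat (rv D) (rv C) (rv B) (rv A))"
  hence ij: "i < dim_row D + dim_row A" "j < dim_col D + dim_col A" by simp_all
  define u where "u = dim_row A + dim_row D - 1 - i"
  define v where "v = dim_col A + dim_col D - 1 - j"
  have uv: "u < dim_row A + dim_row D" "v < dim_col A + dim_col D" using ij by (auto simp: u_def v_def)
  have u1: "\<not> u < dim_row A" "u - dim_row A = dim_row D - Suc i" if "i < dim_row D"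
    using that by (auto simp: u_def)
  have u2: "u < dim_row A" "u = dim_row A - Suc (i - dim_row D)" "i - dim_row D < dim_row A"
    if "\<not> i < dim_row D" using that ij by (auto simp: u_def)
  have v1: "\<not> v < dim_col A" "v - dim_col A = dim_col D - Suc j" if "j < dim_col D"
    using that by (auto simp: v_def)
  have v2: "v < dim_col A" "v = dim_col A - Suc (j - dim_col D)" "j - dim_col D < dim_col A"
    if "\<not> j < dim_col D" using that ij by (auto simp: v_def)
  have "rv (four_block_mat A B C D) $$ (i, j) = four_block_mat A B C D $$ (u, v)"
    using ij by (simp add: u_def v_def)
  also have "\<dots> = (if u < dim_row A then if v < dim_col A then A $$ (u, v) else B $$ (u, v - dim_col A)
      else if v < dim_col A then C $$ (u - dim_row A, v) else D $$ (u - dim_row A, v - dim_col A))"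
    using uv by simp
  also have "\<dots> = (if i < dim_row D then if j < dim_col D then rv D $$ (i, j) else rv C $$ (i, j - dim_col D)
      else if j < dim_col D then rv B $$ (i - dim_row D, j) else rv A $$ (i - dim_row D, j - dim_col D))"
  proof (cases "i < dim_row D")
    case True
    show ?thesis
    proof (cases "j < dim_col D")
      case jT: True
      show ?thesis using True jT u1 v1 by simp
    next
      case jF: False
      show ?thesis using True jF u1 v2 assms by simp
    qed
  next
    case False
    show ?thesis
    proof (cases "j < dim_col D")
      case jT: True
      show ?thesis using False jT u2 v1 assms by simp
    next
      case jF: False
      show ?thesis using False jF u2 v2 by simp
    qed
  qed
  also have "\<dots> = four_block_mat (rv D) (rv C) (rv B) (rv A) $$ (i, j)" using ij by simp
  finally show "rv (four_block_mat A B C D) $$ (i, j) = four_block_mat (rv D) (rv C) (rv B) (rv A) $$ (i, j)" .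
qed (use assms in auto)

definition power_sum :: "nat \<Rightarrow> nat \<Rightarrow> 'a::comm_ring_1 \<Rightarrow> (nat \<Rightarrow> 'a mat) \<Rightarrow> 'a mat" where
  "power_sum n m x a = mat n n (\<lambda>(i, j). \<Sum>k\<le>m. x ^ k * a k $$ (i, j))"

lemma shifted_coeff_dim:
  "(\<And>i. i \<le> k \<Longrightarrow> a i \<in> carrier_mat n n) \<Longrightarrow>
    dim_row (shifted_coeff n x a k) = n \<and> dim_col (shifted_coeff n x a k) = n"
  by (induction k) force+

lemma shifted_coeff_index:
  "(\<And>i. i \<le> k \<Longrightarrow> a i \<in> carrier_mat n n) \<Longrightarrow> i < n \<Longrightarrow> j < n \<Longrightarrow>
    shifted_coeff n x a k $$ (i, j) = - (\<Sum>q\<le>k. x ^ (k - q) * a q $$ (i, j))"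
proof (induction k)
  case (Suc k)
  have d: "dim_row (a (Suc k)) = n" "dim_col (a (Suc k)) = n" using Suc.prems(1)[of "Suc k"] by auto
  have "x * (\<Sum>q\<le>k. x ^ (k - q) * a q $$ (i, j)) = (\<Sum>q\<le>k. x ^ (Suc k - q) * a q $$ (i, j))"
    by (auto simp: sum_distrib_left Suc_diff_le mult.assoc intro!: sum.cong)
  thus ?case using Suc shifted_coeff_dim[of k a n x] d by simp
next
  case 0
  have "dim_row (a 0) = n" "dim_col (a 0) = n" using 0(1)[of 0] by auto
  thus ?case using 0 by simp
qed

lemma horner_dim:
  "(\<And>i. i \<le> k \<Longrightarrow> a i \<in> carrier_mat n n) \<Longrightarrow> H \<in> carrier_mat n n \<Longrightarrow> horner x a H k \<in> carrier_mat n n"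
  by (induction k arbitrary: H) auto

lemma horner_index:
  "(\<And>i. i \<le> k \<Longrightarrow> a i \<in> carrier_mat n n) \<Longrightarrow> H \<in> carrier_mat n n \<Longrightarrow> i < n \<Longrightarrow> j < n \<Longrightarrow>
    horner x a H k $$ (i, j) = x ^ Suc k * H $$ (i, j) + (\<Sum>q\<le>k. x ^ q * a q $$ (i, j))"
proof (induction k arbitrary: H)
  case (Suc k)
  have "dim_row (a (Suc k)) = n" "dim_col (a (Suc k)) = n" using Suc.prems(1)[of "Suc k"] by auto
  thus ?case using Suc by (simp add: algebra_simps)
next
  case 0
  have "dim_row (a 0) = n" "dim_col (a 0) = n" using 0(1)[of 0] by auto
  thus ?case using 0 by simp
qed

lemma dsum_four_block:
  assumes d: "dim_row Z11 = p" "dim_col Z11 = p" "dim_row Z12 = p" "dim_col Z12 = n"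
    "dim_row Z21 = n" "dim_col Z21 = p" "dim_row Z22 = n" "dim_col Z22 = n"
  shows "dsum (four_block_mat Z11 Z12 Z21 Z22) (1\<^sub>m q) =
    four_block_mat Z11 (Z12 * prow n q) (pcol n q * Z21) (dsum Z22 (1\<^sub>m q :: 'a::comm_ring_1 mat))"
  unfolding mult_prow(1)[OF d(4,3)] mult_prow(2)[OF d(5,6)]
proof (rule eq_matI, goal_cases)
  case (1 i j)
  hence ij: "i < p + n + q" "j < p + n + q" by (simp_all add: d)
  show ?case using ij
    by (cases "i < p"; cases "j < p"; cases "i < p + n"; cases "j < p + n")
       (simp_all add: d less_diff_conv2 not_less add.commute)
qed (simp_all add: d)

context entry_ring
begin

lemma ent_rv: "ent X \<Longrightarrow> ent (rv X)"
  by (auto simp: ent_def)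

lemma ent_shifted_coeff:
  "(\<And>i. i \<le> k \<Longrightarrow> a i \<in> carrier_mat n n) \<Longrightarrow> (\<And>i. i \<le> k \<Longrightarrow> ent (a i)) \<Longrightarrow> x \<in> S \<Longrightarrow>
    ent (shifted_coeff n x a k)"
proof (induction k)
  case (Suc k)
  have "dim_row (a (Suc k)) = n" "dim_col (a (Suc k)) = n" using Suc.prems(1)[of "Suc k"] by auto
  thus ?case using Suc shifted_coeff_dim[of k a n x] by (simp add: ent_intros)
qed (simp add: ent_intros)

text \<open>The two words overlap in one block row and one block column only. The part of the reversed word
  outside the overlap enters with \<open>x Z\<^sub>1\<^sub>1 - I\<close>, which is invertible over \<open>S\<close> by \<open>fiedler_word_schur\<close>.
  Eliminating it collapses the reversed word to its Schur complement, the part of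
  \<open>\<Sum>\<^sub>i x\<^sup>i a\<^sub>i\<close> of degree above \<open>h\<close> divided by \<open>x\<^bsup>h+1\<^esup>\<close>. What remains is the pencil of a single Fiedler
  word. The ports lie outside the eliminated rows and columns. The choice \<open>b\<^sub>j = - rv (a\<^bsub>m-j\<^esub>)\<close> compensates
  the reversal.\<close>

lemma generalized_fiedler_eqv:
  fixes a :: "nat \<Rightarrow> 'a mat"
  assumes h: "h < m" and x: "x \<in> S" and a: "\<And>i. i \<le> m \<Longrightarrow> a i \<in> carrier_mat n n" "\<And>i. i \<le> m \<Longrightarrow> ent (a i)"
    and k: "k = m - h - 1" and b: "b = (\<lambda>j. - rv (a (m - j)))"
  shows "port_eqv (m * n)
    (x \<cdot>\<^sub>m dsum (rv (fiedler_word n b c2 k)) (1\<^sub>m (h * n)) - dsum (1\<^sub>m (k * n)) (fiedler_word n a c1 h))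
    (vcat0 (k * n) (port_col n a c1 h)) (hcat0 (k * n) (port_row n a c1 h))
    (dsum (1\<^sub>m ((m - 1) * n)) (power_sum n m x a))
    (vcat0 ((m - 1) * n) (1\<^sub>m n)) (hcat0 ((m - 1) * n) (1\<^sub>m n))"
proof -
  define p where "p = k * n"
  define q where "q = h * n"
  have bc: "b i \<in> carrier_mat n n" "ent (b i)" if "i \<le> k" for i
    using a(1)[of "m - i"] a(2)[of "m - i"] by (auto simp: b intro!: ent_intros ent_rv carrier_matI)
  obtain w11 w12 w21 w22 y where W': "fiedler_word n b c2 k = four_block_mat w11 w12 w21 w22"
    and c: "w11 \<in> carrier_mat n n" "w12 \<in> carrier_mat n p" "w21 \<in> carrier_mat p n"
      "w22 \<in> carrier_mat p p" "y \<in> carrier_mat p p"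
    and e: "ent w11" "ent w12" "ent w21" "ent w22" "ent y"
    and y: "(1\<^sub>m p - x \<cdot>\<^sub>m w22) * y = 1\<^sub>m p" "y * (1\<^sub>m p - x \<cdot>\<^sub>m w22) = 1\<^sub>m p"
    and f: "w11 + x \<cdot>\<^sub>m (w12 * (y * w21)) = shifted_coeff n x b k"
    using fiedler_word_schur[where k = k and a = b and n = n and c = c2, OF x bc] unfolding p_def by blast
  note d = c[THEN carrier_matD(1)] c[THEN carrier_matD(2)]
  define Z11 where "Z11 = rv w22"
  define Z12 where "Z12 = rv w21"
  define Z21 where "Z21 = rv w12"
  define Z22 where "Z22 = rv w11"
  define Y where "Y = rv y"
  have Z: "rv (fiedler_word n b c2 k) = four_block_mat Z11 Z12 Z21 Z22"
    unfolding W' Z11_def Z12_def Z21_def Z22_def by (rule rv_four_block) (simp_all add: d)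
  have zd: "dim_row Z11 = p" "dim_col Z11 = p" "dim_row Z12 = p" "dim_col Z12 = n"
    "dim_row Z21 = n" "dim_col Z21 = p" "dim_row Z22 = n" "dim_col Z22 = n" "dim_row Y = p" "dim_col Y = p"
    by (simp_all add: Z11_def Z12_def Z21_def Z22_def Y_def d)
  have ze: "ent Z11" "ent Z12" "ent Z21" "ent Z22" "ent Y"
    using e by (simp_all add: Z11_def Z12_def Z21_def Z22_def Y_def ent_rv)
  have "rv (1\<^sub>m p - x \<cdot>\<^sub>m w22) = 1\<^sub>m p - x \<cdot>\<^sub>m Z11"
    by (simp add: Z11_def rv_arith rv_one d)
  hence Y: "(1\<^sub>m p - x \<cdot>\<^sub>m Z11) * Y = 1\<^sub>m p" "Y * (1\<^sub>m p - x \<cdot>\<^sub>m Z11) = 1\<^sub>m p"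
    unfolding Y_def using arg_cong[OF y(1), of rv] arg_cong[OF y(2), of rv]
    by (simp_all add: rv_mult rv_one d)
  define f' where "f' = rv (shifted_coeff n x b k)"
  have sd: "dim_row (shifted_coeff n x b k) = n" "dim_col (shifted_coeff n x b k) = n"
    using shifted_coeff_dim[of k b n x] bc by auto
  have f': "Z22 + x \<cdot>\<^sub>m (Z21 * (Y * Z12)) = f'"
    unfolding f'_def f[symmetric] Z22_def Z21_def Z12_def Y_def
    by (simp add: rv_arith rv_mult d)
  have f'c: "f' \<in> carrier_mat n n" "ent f'"
    unfolding f'_def using sd ent_shifted_coeff[of k b n x] bc x by (auto intro: ent_rv)
  define W where "W = fiedler_word n a c1 h"
  have Wd: "dim_row W = n + q" "dim_col W = n + q"
    using fiedler_word_dim[of h a n c1] a(1) h by (auto simp: W_def q_def)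
  define l where "l = port_col n a c1 h"
  define r where "r = port_row n a c1 h"
  have lr: "dim_row l = n + q" "dim_col r = n + q"
    using port_dims[of h a n c1] a(1) h by (auto simp: l_def r_def q_def)
  define D where "D = x \<cdot>\<^sub>m dsum Z22 (1\<^sub>m q) - W"
  define F where "F = x \<cdot>\<^sub>m dsum (four_block_mat Z11 Z12 Z21 Z22) (1\<^sub>m q) - dsum (1\<^sub>m p) W"
  have Fd: "dim_row F = p + (n + q)" "dim_col F = p + (n + q)" unfolding F_def using zd Wd by simp_all
  have F: "F = four_block_mat (x \<cdot>\<^sub>m Z11 - 1\<^sub>m p) (x \<cdot>\<^sub>m (Z12 * prow n q)) (x \<cdot>\<^sub>m (pcol n q * Z21)) D"
    unfolding F_def D_def dsum_four_block[OF zd(1-8)]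
    by (simp add: four_block_arith zd Wd mat_trivial)
  define X where "X = x \<cdot>\<^sub>m (Y * (Z12 * prow n q))"
  define X' where "X' = x \<cdot>\<^sub>m (pcol n q * Z21)"
  have Xd: "dim_row X = p" "dim_col X = n + q" "dim_row X' = n + q" "dim_col X' = p"
    "dim_row D = n + q" "dim_col D = n + q"
    unfolding X_def X'_def D_def using zd Wd by simp_all
  have ep: "ent (pcol n q)" "ent (prow n q)"
    unfolding pcol_def prow_def by (simp_all add: ent_intros)
  have eX: "ent X" "ent X'" unfolding X_def X'_def using ze ep zd x by (simp_all add: ent_intros)
  have Ym: "Y * (x \<cdot>\<^sub>m Z11 - 1\<^sub>m p) = - 1\<^sub>m p"
  proof -
    have "x \<cdot>\<^sub>m Z11 - 1\<^sub>m p = - (1\<^sub>m p - x \<cdot>\<^sub>m Z11)" using zd by (intro eq_matI) auto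
    thus ?thesis using zd Y by (simp add: uminus_mult_dim)
  qed
  have step1: "port_eqv (p + (n + q)) F (vcat0 p l) (hcat0 p r)
      (four_block_mat (- 1\<^sub>m p) X X' D) (vcat0 p l) (hcat0 p r)"
  proof (rule port_eqvI[of _ _ _ _ "dsum Y (1\<^sub>m (n + q))" "1\<^sub>m (p + (n + q))"])
    have "S_unit p Y"
      by (rule S_unitI[of _ _ "1\<^sub>m p - x \<cdot>\<^sub>m Z11"])
         (rule carrier_matI | use Y ze zd x in \<open>simp add: ent_intros\<close>)+
    thus "S_unit (p + (n + q)) (dsum Y (1\<^sub>m (n + q)))" using zd by (simp add: S_unit_diag S_unit_one)
    show "dsum Y (1\<^sub>m (n + q)) * F * 1\<^sub>m (p + (n + q)) = four_block_mat (- 1\<^sub>m p) X X' D"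
      unfolding F X_def X'_def using zd Xd
      by (simp add: mult_four_block_dim mat_trivial Ym smult_mult_dim)
  qed (use Fd lr zd in \<open>simp_all add: S_unit_one four_block_vcat0 mat_trivial\<close>)
  have cX: "X \<in> carrier_mat p (n + q)" "X' \<in> carrier_mat (n + q) p" "D \<in> carrier_mat (n + q) (n + q)"
    by (rule carrier_matI; simp add: Xd)+
  have "X' * X = x \<cdot>\<^sub>m (x \<cdot>\<^sub>m (pcol n q * ((Z21 * (Y * Z12)) * prow n q)))"
    unfolding X_def X'_def using zd by (simp add: smult_mult_dim mult_assoc_dim)
  also have "\<dots> = x \<cdot>\<^sub>m (x \<cdot>\<^sub>m dsum (Z21 * (Y * Z12)) (0\<^sub>m q q))"
    by (subst pcol_mult_prow) (simp_all add: zd)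
  finally have DX: "D + X' * X = x \<cdot>\<^sub>m dsum f' (1\<^sub>m q) - W"
    unfolding D_def f'[symmetric] using zd Wd by (intro eq_matI) (auto simp: algebra_simps)
  have step2: "port_eqv (p + (n + q)) (four_block_mat (- 1\<^sub>m p) X X' D) (vcat0 p l) (hcat0 p r)
      (dsum (1\<^sub>m p) (x \<cdot>\<^sub>m dsum f' (1\<^sub>m q) - W)) (vcat0 p l) (hcat0 p r)"
    using port_eqv_pivot[OF cX eX lr] unfolding DX .
  have "port_eqv (n + q) (x \<cdot>\<^sub>m dsum f' (1\<^sub>m q) - W) l r
      (dsum (1\<^sub>m q) (horner x a f' h)) (vcat0 q (1\<^sub>m n)) (hcat0 q (1\<^sub>m n))"
    using fiedler_word_pencil_eqv[OF x _ _ f'c, of h a c1] a h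
    unfolding q_def[symmetric] W_def[symmetric] l_def[symmetric] r_def[symmetric] by (simp add: q_def)
  from port_eqv_dsum_one[OF this, of p]
  have step3: "port_eqv (p + (n + q)) (dsum (1\<^sub>m p) (x \<cdot>\<^sub>m dsum f' (1\<^sub>m q) - W)) (vcat0 p l) (hcat0 p r)
     (dsum (1\<^sub>m (p + q)) (horner x a f' h)) (vcat0 (p + q) (1\<^sub>m n)) (hcat0 (p + q) (1\<^sub>m n))"
    by (simp only: vcat0_vcat0 hcat0_hcat0 dsum_assoc dsum_one)
  have "horner x a f' h = power_sum n m x a"
  proof (rule eq_matI)
    fix i j assume "i < dim_row (power_sum n m x a)" "j < dim_col (power_sum n m x a)"
    hence ij: "i < n" "j < n" by (auto simp: power_sum_def)
    have "shifted_coeff n x b k $$ (n - 1 - i, n - 1 - j) = - (\<Sum>q\<le>k. x ^ (k - q) * b q $$ (n - 1 - i, n - 1 - j))"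
      by (rule shifted_coeff_index) (use bc ij in auto)
    also have "\<dots> = (\<Sum>q\<le>k. x ^ (k - q) * a (m - q) $$ (i, j))"
      unfolding sum_negf[symmetric]
    proof (intro sum.cong refl)
      fix q assume "q \<in> {..k}"
      have "dim_row (a (m - q)) = n" "dim_col (a (m - q)) = n" using a(1)[of "m - q"] by auto
      thus "- (x ^ (k - q) * b q $$ (n - 1 - i, n - 1 - j)) = x ^ (k - q) * a (m - q) $$ (i, j)"
        using ij by (simp add: b)
    qed
    finally have "f' $$ (i, j) = (\<Sum>q\<le>k. x ^ (k - q) * a (m - q) $$ (i, j))"
      unfolding f'_def using ij sd by simp
    hence "x ^ Suc h * f' $$ (i, j) = (\<Sum>q\<le>k. x ^ (m - q) * a (m - q) $$ (i, j))"
      unfolding sum_distrib_left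
    proof (simp add: sum_distrib_left, intro sum.cong refl, goal_cases)
      case (1 q)
      have "x ^ (m - q) = x ^ (Suc h + (k - q))" by (rule arg_cong[of _ _ "\<lambda>e. x ^ e"]) (use 1 k h in auto)
      thus ?case by (simp add: power_add mult.assoc mult.left_commute)
    qed
    also have "\<dots> = (\<Sum>q\<in>{Suc h..m}. x ^ q * a q $$ (i, j))"
      by (rule sum.reindex_bij_witness[of _ "\<lambda>q. m - q" "\<lambda>q. m - q"]) (use k h in auto)
    finally have "horner x a f' h $$ (i, j) =
        (\<Sum>q\<in>{Suc h..m}. x ^ q * a q $$ (i, j)) + (\<Sum>q\<le>h. x ^ q * a q $$ (i, j))"
      using horner_index[of h a n f' i j x] a h ij f'c by auto
    also have "\<dots> = (\<Sum>q\<in>{..h} \<union> {Suc h..m}. x ^ q * a q $$ (i, j))"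
      by (subst sum.union_disjoint) auto
    also have "{..h} \<union> {Suc h..m} = {..m}" using h by auto
    finally show "horner x a f' h $$ (i, j) = power_sum n m x a $$ (i, j)"
      using ij by (simp add: power_sum_def)
  qed (use horner_dim[of h a n f' x] a h f'c in \<open>auto simp: power_sum_def\<close>)
  moreover have "p + (n + q) = m * n" "p + q = (m - 1) * n"
  proof -
    have "m * n = (k + h + 1) * n" "(m - 1) * n = (k + h) * n" using k h by auto
    thus "p + (n + q) = m * n" "p + q = (m - 1) * n" by (simp_all add: p_def q_def algebra_simps)
  qed
  ultimately show ?thesis
    using port_eqv_trans[OF step1 port_eqv_trans[OF step2 step3]]
    unfolding F_def Z p_def q_def W_def l_def r_def by simp
qed

end

section \<open>Column standard forms\<close>

text \<open>A column standard form is described by the strictly decreasing list of the ends of its strings,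
  followed by \<open>-1\<close>. In this form \<open>z\<^sub>r\<close> replaces one
  entry or inserts \<open>0\<close>.\<close>

fun strs :: "int list \<Rightarrow> int list list" where
  "strs (a # a' # r) = [a' + 1..a] # strs (a' # r)"
| "strs _ = []"

definition col_ends :: "nat \<Rightarrow> int list \<Rightarrow> bool" where
  "col_ends k ra \<longleftrightarrow> ra \<noteq> [] \<and> sorted_wrt (>) ra \<and> hd ra = int k \<and> last ra = -1"

lemma rev_map2_strs:
  "rev (map2 (\<lambda>a a'. [a + 1..a']) as (tl as)) = strs (rev as)"
proof (induction as)
  case (Cons a as)
  show ?case
  proof (cases as)
    case (Cons b bs)
    have app: "strs (xs @ [u, v]) = strs (xs @ [u]) @ [[v + 1..u]]" for xs u v
      by (induction xs rule: strs.induct) auto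
    show ?thesis using Cons.IH unfolding Cons by (simp add: app)
  qed simp
qed simp

lemma column_standard_iff: "column_standard k bs \<longleftrightarrow> (\<exists>ra. col_ends k ra \<and> bs = strs ra)"
proof
  assume "column_standard k bs"
  then obtain as where "as \<noteq> []" "sorted_wrt (<) as" "hd as = -1" "last as = int k"
    "bs = rev (map2 (\<lambda>a a'. [a + 1..a']) as (tl as))"
    by (auto simp: column_standard_def)
  thus "\<exists>ra. col_ends k ra \<and> bs = strs ra"
    by (intro exI[of _ "rev as"]) (auto simp: col_ends_def rev_map2_strs sorted_wrt_rev hd_rev last_rev)
next
  assume "\<exists>ra. col_ends k ra \<and> bs = strs ra"
  then obtain ra where "col_ends k ra" "bs = strs ra" by auto
  thus "column_standard k bs" unfolding column_standard_def
    by (intro exI[of _ "rev ra"])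
       (auto simp: col_ends_def rev_map2_strs sorted_wrt_rev hd_rev last_rev)
qed

lemma filter_upto_pair:
  "filter (\<lambda>x. x = i \<or> x = i + 1) [l..u] =
    (if l \<le> i \<and> i \<le> u then [i] else []) @ (if l \<le> i + 1 \<and> i + 1 \<le> u then [i + 1] else [])"
proof (induction "nat (u - l + 1)" arbitrary: u)
  case 0
  thus ?case by simp
next
  case (Suc d)
  hence "l \<le> u" by simp
  hence "[l..u] = [l..u - 1] @ [u]" by (rule upto_rec2)
  moreover have "d = nat (u - 1 - l + 1)" using Suc(2) by simp
  note Suc(1)[OF this]
  ultimately show ?case using \<open>l \<le> u\<close> by auto
qed

lemma strs_set: "sorted_wrt (>) ra \<Longrightarrow> ra \<noteq> [] \<Longrightarrow> set (concat (strs ra)) = {last ra + 1..hd ra}"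
proof (induction ra rule: strs.induct)
  case (1 a a' r)
  have "last (a' # r) \<le> a'" using 1(2) by (cases r) (auto dest: last_in_set intro: less_imp_le)
  thus ?case using 1 by auto
qed auto

text \<open>\<open>i\<close> ends a string if and only if \<open>i + 1\<close> stands before \<open>i\<close>. Interchanges of indices that differ by
  more than 1 preserve the relative order of \<open>i\<close> and \<open>i + 1\<close>; so the ends of the strings are
  invariants, and the column standard form is unique.\<close>

lemma filter_strs_pair:
  assumes "sorted_wrt (>) ra" "ra \<noteq> []" "last ra < i" "i < hd ra"
  shows "filter (\<lambda>x. x = i \<or> x = i + 1) (concat (strs ra)) =
    (if i \<in> set ra then [i + 1, i] else [i, i + 1])"
  using assms
proof (induction ra rule: strs.induct)
  case (1 a a' r)
  have s: "set (concat (strs (a' # r))) = {last (a' # r) + 1..a'}"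
    using strs_set[of "a' # r"] 1 by auto
  have lt: "\<forall>b\<in>set r. b < a'" "a' < a" using 1(2) by auto
  have split: "filter P (concat (strs (a # a' # r))) = filter P [a' + 1..a] @ filter P (concat (strs (a' # r)))" for P
    by simp
  consider "i < a'" | "i = a'" | "i > a'" by linarith
  thus ?case
  proof cases
    case 1
    with "1.IH" "1.prems" show ?thesis unfolding split filter_upto_pair by auto
  next
    case 2
    have l: "last (a' # r) < a'" using 1 2 by simp
    hence r: "r \<noteq> []" by auto
    then obtain b r' where r': "r = b # r'" by (cases r) auto
    have e: "filter (\<lambda>x. x = i \<or> x = i + 1) (concat (strs (a' # r))) = [i]"
    proof -
      have s': "set (concat (strs r)) = {last r + 1..b}"
        using strs_set[of r] 1 r r' by auto
      have "filter (\<lambda>x. x = i \<or> x = i + 1) (concat (strs r)) = []"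
        using s' 2 lt r' by (auto simp: filter_empty_conv)
      moreover have "b < a'" using lt r' by auto
      ultimately show ?thesis using 2 by (simp add: r' filter_upto_pair del: filter_concat)
    qed
    show ?thesis unfolding split e filter_upto_pair using 2 lt by auto
  next
    case 3
    have "filter (\<lambda>x. x = i \<or> x = i + 1) (concat (strs (a' # r))) = []"
      using s 3 by (auto simp: filter_empty_conv)
    moreover have "i \<notin> set (a # a' # r)" using 3 lt 1(5) by auto
    ultimately show ?thesis unfolding split filter_upto_pair using 3 1(5) by auto
  qed
qed auto

lemma comm_swap_filter_pair:
  "comm_swap xs ys \<Longrightarrow> filter (\<lambda>x. x = i \<or> x = i + 1) xs = filter (\<lambda>x. x = i \<or> x = i + 1) ys"
  by (induction rule: comm_swap.induct) auto

lemma comm_swaps_filter_pair: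
  "comm_swap\<^sup>*\<^sup>* xs ys \<Longrightarrow> filter (\<lambda>x. x = i \<or> x = i + 1) xs = filter (\<lambda>x. x = i \<or> x = i + 1) ys"
  by (induction rule: rtranclp_induct) (auto dest: comm_swap_filter_pair)

lemma col_ends_unique:
  assumes "col_ends k ra" "col_ends k rb" "comm_swap\<^sup>*\<^sup>* \<beta> (concat (strs ra))"
    "comm_swap\<^sup>*\<^sup>* \<beta> (concat (strs rb))"
  shows "ra = rb"
proof -
  have bound: "\<forall>i\<in>set r. -1 \<le> i \<and> i \<le> int k" "-1 \<in> set r" "int k \<in> set r" if "col_ends k r" for r
  proof -
    have s: "sorted_wrt (>) r" "r \<noteq> []" "hd r = int k" "last r = -1" using that by (auto simp: col_ends_def)
    show "-1 \<in> set r" "int k \<in> set r" using s last_in_set[of r] hd_in_set[of r] by auto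
    have "i \<le> hd r" if "i \<in> set r" for i using s(1) that by (cases r) auto
    moreover have "last r \<le> i" if "i \<in> set r" for i
      using s(1) that
    proof (induction r)
      case (Cons a r)
      thus ?case by (cases "r = []") (auto dest: last_in_set intro: less_imp_le)
    qed simp
    ultimately show "\<forall>i\<in>set r. -1 \<le> i \<and> i \<le> int k" using s by auto
  qed
  have "i \<in> set ra \<longleftrightarrow> i \<in> set rb" for i
  proof (cases "-1 < i \<and> i < int k")
    case True
    have "(if i \<in> set ra then [i + 1, i] else [i, i + 1]) = (if i \<in> set rb then [i + 1, i] else [i, i + 1])"
      using filter_strs_pair[of ra i] filter_strs_pair[of rb i] assms True
        comm_swaps_filter_pair[OF assms(3), of i] comm_swaps_filter_pair[OF assms(4), of i]
      unfolding col_ends_def by metis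
    thus ?thesis by (auto split: if_splits)
  next
    case False
    thus ?thesis using bound[OF assms(1)] bound[OF assms(2)] by force
  qed
  hence "set ra = set rb" by auto
  moreover have "sorted_wrt (<) (rev ra)" "sorted_wrt (<) (rev rb)"
    using assms by (auto simp: col_ends_def sorted_wrt_rev)
  hence "rev ra = sorted_list_of_set (set ra)" "rev rb = sorted_list_of_set (set rb)"
    by (metis set_rev strict_sorted_iff sorted_list_of_set.idem_if_sorted_distinct)+
  ultimately show ?thesis by (metis rev_rev_ident)
qed

lemma csf_eq:
  assumes "col_ends k ra" "comm_swap\<^sup>*\<^sup>* \<beta> (concat (strs ra))"
  shows "csf k \<beta> = strs ra"
  unfolding csf_def
proof (rule the_equality)
  show "column_standard k (strs ra) \<and> comm_swap\<^sup>*\<^sup>* \<beta> (concat (strs ra))"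
    using assms by (auto simp: column_standard_iff)
next
  fix bs assume "column_standard k bs \<and> comm_swap\<^sup>*\<^sup>* \<beta> (concat bs)"
  thus "bs = strs ra" using col_ends_unique[OF assms(1) _ assms(2)] by (auto simp: column_standard_iff)
qed

text \<open>Moving the index \<open>s\<close> to the next string replaces the string end \<open>s - 1\<close> by \<open>s\<close>. For \<open>s = 0\<close> the
  final \<open>-1\<close> stays and \<open>0\<close> is inserted before it.\<close>

fun move_end :: "int \<Rightarrow> int list \<Rightarrow> int list" where
  "move_end s (a # a' # r) =
     (if a' + 1 = s then if r = [] then [a, s, a'] else a # s # r else a # move_end s (a' # r))"
| "move_end s r = r"

lemma move_index_strs:
  assumes "sorted_wrt (>) ra"
  shows "move_index s (strs ra) = strs (move_end s ra)"
  using assms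
proof (induction s ra rule: move_end.induct)
  case (1 s a a' r)
  have lt: "a' < a" using 1(2) by simp
  hence h: "[a' + 1..a] = (a' + 1) # [a' + 2..a]" by (subst upto_rec1) (auto simp: add.commute)
  have nz: "move_end s (a' # r) \<noteq> [] \<and> hd (move_end s (a' # r)) = a'" for s
    by (cases r) auto
  show ?case
  proof (cases r)
    case Nil
    show ?thesis unfolding Nil using h by (auto simp: add.commute)
  next
    case (Cons b r')
    have ba: "b < a'" using 1(2) Cons by auto
    have e: "[b + 1..a'] @ [a' + 1] = [b + 1..a' + 1]"
      using ba upto_rec2[of "b + 1" "a' + 1"] by simp
    show ?thesis
    proof (cases "a' + 1 = s")
      case True
      thus ?thesis unfolding Cons using h e by (auto simp: algebra_simps)
    next
      case False
      have IH: "move_index s (strs (a' # r)) = strs (move_end s (a' # r))"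
        using 1 False by auto
      obtain u where u: "move_end s (a' # r) = a' # u" using nz[of s] by (cases "move_end s (a' # r)") auto
      show ?thesis using IH False h u unfolding Cons by simp
    qed
  qed
qed auto

lemma move_end_col_ends:
  assumes r: "col_ends k ra" and s: "s - 1 \<in> set ra" "s \<notin> set ra" "s < int k"
  shows "col_ends k (move_end s ra)" "s \<in> set (move_end s ra)"
    "\<And>d. d \<in> set ra \<Longrightarrow> d \<noteq> s - 1 \<Longrightarrow> d \<in> set (move_end s ra)"
proof -
  have main: "sorted_wrt (>) (move_end s ra) \<and> move_end s ra \<noteq> [] \<and> hd (move_end s ra) = hd ra \<and>
    last (move_end s ra) = last ra \<and> s \<in> set (move_end s ra) \<and>
    (\<forall>d\<in>set ra. d \<noteq> s - 1 \<longrightarrow> d \<in> set (move_end s ra)) \<and> set (move_end s ra) \<subseteq> insert s (set ra)"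
    if "sorted_wrt (>) ra" "s - 1 \<in> set ra" "s \<notin> set ra" "s < hd ra"
    using that
  proof (induction s ra rule: move_end.induct)
    case (1 s a a' r)
    show ?case
    proof (cases "a' + 1 = s")
      case True
      have sa: "s < a" "\<forall>b\<in>set r. b < a'" "s = a' + 1" using 1(2-) True by auto
      show ?thesis
      proof (cases "r = []")
        case True
        thus ?thesis using sa by auto
      next
        case False
        have "\<forall>b\<in>set r. b < s" using sa by auto
        moreover have "sorted_wrt (>) r" using 1(2) by simp
        ultimately show ?thesis using sa False 1(2) by auto
      qed
    next
      case False
      have m: "s - 1 \<in> set (a' # r)" using 1 False by auto
      have "s \<noteq> a'" using 1 by auto
      have "s - 1 \<le> a'" using m 1(2) by auto
      hence "s < a'" using False \<open>s \<noteq> a'\<close> by linarith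
      hence "sorted_wrt (>) (move_end s (a' # r)) \<and> move_end s (a' # r) \<noteq> [] \<and>
        hd (move_end s (a' # r)) = a' \<and> last (move_end s (a' # r)) = last (a' # r) \<and>
        s \<in> set (move_end s (a' # r)) \<and> (\<forall>d\<in>set (a' # r). d \<noteq> s - 1 \<longrightarrow> d \<in> set (move_end s (a' # r))) \<and>
        set (move_end s (a' # r)) \<subseteq> insert s (set (a' # r))"
        using 1 False m by auto
      moreover have "\<forall>b\<in>insert s (set (a' # r)). b < a" using 1(2) 1(5) by auto
      ultimately show ?thesis using False by auto
    qed
  qed auto
  show "col_ends k (move_end s ra)" "s \<in> set (move_end s ra)"
    "\<And>d. d \<in> set ra \<Longrightarrow> d \<noteq> s - 1 \<Longrightarrow> d \<in> set (move_end s ra)"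
    using main r s by (auto simp: col_ends_def)
qed

lemma string_ends:
  assumes "sorted_wrt (>) ra" "[s..t] \<in> set (strs ra)" "s < t"
  shows "s - 1 \<in> set ra \<and> s \<notin> set ra"
  using assms
proof (induction ra rule: strs.induct)
  case (1 a a' r)
  show ?case
  proof (cases "[s..t] = [a' + 1..a]")
    case True
    have lt: "a' < a" using 1(2) by simp
    have "hd [s..t] = s" "hd [a' + 1..a] = a' + 1" using 1(4) lt by (simp_all add: upto_rec1)
    hence st: "s = a' + 1" using True by simp
    have "last [s..t] = t" "last [a' + 1..a] = a" using 1(4) lt by (simp_all add: upto_rec2)
    hence "t = a" using True by simp
    thus ?thesis using st 1 by auto
  next
    case False
    hence "[s..t] \<in> set (strs (a' # r))" using 1 by simp
    hence IH: "s - 1 \<in> set (a' # r) \<and> s \<notin> set (a' # r)" using 1 by auto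
    hence "s - 1 \<le> a'" "s \<noteq> a'" using 1(2) by auto
    moreover have "s \<noteq> a"
    proof
      assume "s = a"
      hence "s = a' + 1" using \<open>s - 1 \<le> a'\<close> 1(2) by auto
      have ss: "t \<in> set (concat (strs (a' # r)))" using \<open>[s..t] \<in> set (strs (a' # r))\<close> 1(4)
        by (auto simp: Bex_def intro!: exI[of _ "[s..t]"])
      have "t \<le> a'" using ss strs_set[of "a' # r"] 1(2) by auto
      thus False using \<open>s = a' + 1\<close> 1(4) by simp
    qed
    ultimately show ?thesis using IH by auto
  qed
qed auto

text \<open>The greedy search for \<open>d + 1, d + 2, \<dots>\<close> in a tuple; the result is the last value found.
  The companion predicate says that the search never meets the value that it found last.\<close>

fun track :: "int \<Rightarrow> int list \<Rightarrow> int" where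
  "track d [] = d"
| "track d (s # ss) = track (if s = d + 1 then d + 1 else d) ss"

fun avoids :: "int \<Rightarrow> int list \<Rightarrow> bool" where
  "avoids d [] = True"
| "avoids d (s # ss) \<longleftrightarrow> s \<noteq> d \<and> avoids (if s = d + 1 then d + 1 else d) ss"

lemma type1_Cons:
  assumes "type1_right_index_tuple k \<beta> (s # t)"
  shows "type1_right_index k \<beta> s" "type1_right_index_tuple k (z_r k \<beta> s) t"
proof -
  show "type1_right_index k \<beta> s" using assms unfolding type1_right_index_tuple_def by (force dest: spec[of _ 0])
  show "type1_right_index_tuple k (z_r k \<beta> s) t"
    unfolding type1_right_index_tuple_def
  proof (intro allI impI)
    fix i assume "i < length t"
    hence "type1_right_index k (foldl (z_r k) \<beta> (take (Suc i) (s # t))) ((s # t) ! Suc i)"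
      using assms unfolding type1_right_index_tuple_def by fastforce
    thus "type1_right_index k (foldl (z_r k) (z_r k \<beta> s) (take i t)) (t ! i)" by simp
  qed
qed

lemma type1_range: "type1_right_index_tuple k \<beta> t \<Longrightarrow> set t \<subseteq> {0..int k - 1}"
  unfolding type1_right_index_tuple_def by (auto simp: type1_right_index_def in_set_conv_nth)

text \<open>Suppose that \<open>d\<close> is the end of a string. A right index \<open>s\<close> of type-1 is the start of a string of
  length at least 2, hence not an end, and \<open>s \<noteq> d\<close>. Moving it makes \<open>s\<close> an end at the expense of
  \<open>s - 1\<close>. So \<open>d\<close> stays an end if \<open>s \<noteq> d + 1\<close>, and otherwise \<open>d + 1\<close> becomes one.\<close>

lemma type1_avoids:
  assumes "col_ends k ra" "comm_swap\<^sup>*\<^sup>* \<beta> (concat (strs ra))" "d \<in> set ra"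
    "type1_right_index_tuple k \<beta> t"
  shows "avoids d t"
  using assms
proof (induction t arbitrary: \<beta> ra d)
  case (Cons s t)
  note t1 = type1_Cons[OF Cons.prems(4)]
  have csf: "csf k \<beta> = strs ra" by (rule csf_eq[OF Cons.prems(1,2)])
  have srt: "sorted_wrt (>) ra" using Cons.prems(1) by (simp add: col_ends_def)
  have s: "s - 1 \<in> set ra" "s \<notin> set ra" "s < int k"
    using t1(1) string_ends[OF srt] by (auto simp: type1_right_index_def csf)
  note m = move_end_col_ends[OF Cons.prems(1) s]
  have z: "z_r k \<beta> s = concat (strs (move_end s ra))"
    by (simp add: z_r_def csf move_index_strs[OF srt])
  have "(if s = d + 1 then d + 1 else d) \<in> set (move_end s ra)" using m(2,3) Cons.prems(3) by auto
  from Cons.IH[OF m(1) _ this, of "z_r k \<beta> s"] t1(2) s Cons.prems(3) show ?case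
    by (auto simp: z)
qed simp

lemma track_mono: "c \<le> track c xs"
proof (induction xs arbitrary: c)
  case (Cons x xs)
  show ?case using Cons[of c] Cons[of "c + 1"] by (cases "x = c + 1") simp_all
qed simp

text \<open>Taking the earliest possible occurrence of each entry is optimal for finding a subtuple.\<close>

lemma subseq_upto_track: "subseq [c + 1..p] xs \<longleftrightarrow> p \<le> track c xs"
proof (induction xs arbitrary: c)
  case Nil
  show ?case by (cases "c + 1 \<le> p") (auto simp: upto_rec1)
next
  case (Cons x xs)
  show ?case
  proof (cases "c + 1 \<le> p")
    case True
    hence e: "[c + 1..p] = (c + 1) # [c + 1 + 1..p]" by (rule upto_rec1)
    show ?thesis
    proof (cases "x = c + 1")
      case True
      thus ?thesis using Cons.IH[of "c + 1"] e by simp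
    next
      case False
      thus ?thesis using Cons.IH[of c] e by simp
    qed
  next
    case False
    hence "[c + 1..p] = []" by simp
    moreover have "p \<le> track c (x # xs)" using track_mono[of c "x # xs"] False by simp
    ultimately show ?thesis by simp
  qed
qed

lemma track_append: "track c (xs @ ys) = track (track c xs) ys"
  by (induction xs arbitrary: c) auto

lemma c0_track: "0 \<le> track (-1) \<beta> \<Longrightarrow> int (c0 \<beta>) = track (-1) \<beta>"
proof -
  assume t: "0 \<le> track (-1) \<beta>"
  have "c0 \<beta> = nat (track (-1) \<beta>)"
    unfolding c0_def
  proof (rule Greatest_equality)
    show "subseq [0..int (nat (track (- 1) \<beta>))] \<beta>"
      using subseq_upto_track[of "-1" "track (-1) \<beta>" \<beta>] t by simp
    show "p \<le> nat (track (- 1) \<beta>)" if "subseq [0..int p] \<beta>" for p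
      using subseq_upto_track[of "-1" "int p" \<beta>] that by simp
  qed
  thus ?thesis using t by simp
qed

section \<open>The simple admissible tuple\<close>

definition pairs :: "nat \<Rightarrow> nat \<Rightarrow> int list" where
  "pairs k p = concat (map (\<lambda>j. [int k - 1 - 2 * int j .. int k - 2 * int j]) [0..<(k - p) div 2])"

lemma pairs_rec: "p + 2 \<le> k \<Longrightarrow> pairs k p = [int k - 1, int k] @ pairs (k - 2) p"
proof -
  assume k: "p + 2 \<le> k"
  have "(k - p) div 2 = Suc ((k - 2 - p) div 2)" using k by (auto simp: le_div_geq)
  moreover have "[0..<Suc N] = 0 # map Suc [0..<N]" for N by (simp add: upt_conv_Cons map_Suc_upt)
  moreover have "[int k - 1..int k] = [int k - 1, int k]" by (simp add: upto_rec1)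
  moreover have "int (k - 2) = int k - 2" using k by simp
  ultimately show ?thesis unfolding pairs_def
    by (simp add: o_def algebra_simps)
qed

lemma pairs_self: "pairs p p = []" by (simp add: pairs_def)

lemma admissible_induct[consumes 2, case_names base step]:
  assumes "p \<le> k" "even (k - p)"
    and base: "P p" and step: "\<And>k. p \<le> k \<Longrightarrow> even (k - p) \<Longrightarrow> P k \<Longrightarrow> P (k + 2)"
  shows "P (k::nat)"
proof -
  obtain d where d: "k - p = 2 * d" using assms(2) by (rule evenE)
  have "P (p + 2 * d)"
    by (induction d) (use base step in \<open>auto\<close>)
  thus ?thesis using d assms(1) by (metis le_add_diff_inverse)
qed

lemma admissible_pairs: "admissible_tuple k p w \<longleftrightarrow> p \<le> k \<and> even (k - p) \<and> w = pairs k p @ [0..int p]"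
  by (simp add: admissible_tuple_def pairs_def)

text \<open>The column standard form of \<open>(0, 2, 1, 4, 3, \<dots>, h, h - 1)\<close> is \<open>(h, h-2:h-1, \<dots>, 2:3, 0:1)\<close>. It is found
  by induction: appending \<open>k + 2, k + 1\<close>, the index \<open>k + 2\<close> moves to the front and \<open>k + 1\<close> moves
  left until it meets \<open>k\<close>.\<close>

lemma simple_csf:
  assumes "even h"
  shows "\<exists>ra. col_ends h ra \<and> int (min 1 h) \<in> set ra \<and> comm_swap\<^sup>*\<^sup>* (rev (pairs h 0 @ [0])) (concat (strs ra))"
proof -
  have swap_front: "comm_swap\<^sup>*\<^sup>* (xs @ ys @ [x] @ zs) (xs @ [x] @ ys @ zs)"
    if "\<forall>y\<in>set ys. \<bar>y - x\<bar> > 1" for xs ys zs x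
    using that
  proof (induction ys arbitrary: zs rule: rev_induct)
    case (snoc y ys)
    have "comm_swap (xs @ (ys @ [y]) @ [x] @ zs) (xs @ ys @ [x] @ y # zs)"
      using comm_swap.intros[of y x "xs @ ys" zs] snoc.prems by simp
    with snoc.IH[of "y # zs"] snoc.prems show ?case
      by (auto intro: converse_rtranclp_into_rtranclp)
  qed simp
  have right: "comm_swap\<^sup>*\<^sup>* (xs @ zs) (ys @ zs)" if "comm_swap\<^sup>*\<^sup>* xs ys" for xs ys zs
    using that
  proof (induction rule: rtranclp_induct)
    case (step y z)
    have "comm_swap (y @ zs) (z @ zs)"
      using step(2)
    proof cases
      case (1 i j us vs)
      thus ?thesis using comm_swap.intros[of i j us "vs @ zs"] by simp
    qed
    with step show ?case by (auto intro: rtranclp.rtrancl_into_rtrancl)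
  qed simp
  have "\<exists>r. col_ends h (int h # r) \<and> r \<noteq> [] \<and> hd r = int h - 1 \<and> int (min 1 h) \<in> set (int h # r) \<and>
    comm_swap\<^sup>*\<^sup>* (rev (pairs h 0 @ [0])) (concat (strs (int h # r)))"
  proof (rule admissible_induct[where p = 0 and k = h])
    show "even (h - 0)" using assms by simp
  next
    show "\<exists>r. col_ends 0 (int 0 # r) \<and> r \<noteq> [] \<and> hd r = int 0 - 1 \<and> int (min 1 0) \<in> set (int 0 # r) \<and>
      comm_swap\<^sup>*\<^sup>* (rev (pairs 0 0 @ [0])) (concat (strs (int 0 # r)))"
      by (intro exI[of _ "[-1]"]) (auto simp: col_ends_def pairs_self)
  next
    fix k :: nat assume step: "even (k - 0)" "\<exists>r. col_ends k (int k # r) \<and> r \<noteq> [] \<and> hd r = int k - 1 \<and>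
      int (min 1 k) \<in> set (int k # r) \<and> comm_swap\<^sup>*\<^sup>* (rev (pairs k 0 @ [0])) (concat (strs (int k # r)))"
    then obtain r where r: "col_ends k (int k # r)" "r \<noteq> []" "hd r = int k - 1" "int (min 1 k) \<in> set (int k # r)"
      "comm_swap\<^sup>*\<^sup>* (rev (pairs k 0 @ [0])) (concat (strs (int k # r)))" by auto
    obtain b r' where r': "r = b # r'" using r(2) by (cases r) auto
    have b: "b = int k - 1" using r r' by simp
    define Y where "Y = concat (strs r)"
    have Ys: "\<forall>y\<in>set Y. y < int k"
    proof -
      have "set Y = {last r + 1..hd r}" unfolding Y_def
        by (rule strs_set) (use r(1,2) in \<open>auto simp: col_ends_def\<close>)
      thus ?thesis using r(3) by auto
    qed
    have c: "concat (strs (int k # r)) = int k # Y"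
      unfolding r' Y_def b by simp
    let ?r = "(int k + 1) # r"
    have t: "concat (strs (int (k + 2) # ?r)) = [int k + 2] @ [int k] @ [int k + 1] @ Y"
      unfolding r' Y_def b by (simp add: upto_rec1)
    have "rev (pairs (k + 2) 0 @ [0]) = rev (pairs k 0 @ [0]) @ [int k + 2, int k + 1]"
      by (subst pairs_rec) simp_all
    moreover have "comm_swap\<^sup>*\<^sup>* (rev (pairs k 0 @ [0]) @ [int k + 2, int k + 1]) ((int k # Y) @ [int k + 2, int k + 1])"
      using right[OF r(5), of "[int k + 2, int k + 1]"] unfolding c .
    moreover have "comm_swap\<^sup>*\<^sup>* ((int k # Y) @ [int k + 2, int k + 1]) ([int k + 2] @ (int k # Y) @ [int k + 1])"
      using swap_front[of "int k # Y" "int k + 2" "[]" "[int k + 1]"] Ys by force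
    moreover have "comm_swap\<^sup>*\<^sup>* ([int k + 2] @ (int k # Y) @ [int k + 1]) ([int k + 2] @ [int k] @ [int k + 1] @ Y)"
      using swap_front[of Y "int k + 1" "[int k + 2, int k]" "[]"] Ys by force
    ultimately have "comm_swap\<^sup>*\<^sup>* (rev (pairs (k + 2) 0 @ [0])) (concat (strs (int (k + 2) # ?r)))"
      unfolding t by (metis rtranclp_trans)
    moreover have "col_ends (k + 2) (int (k + 2) # ?r)" using r(1,2) by (auto simp: col_ends_def)
    moreover have "int (min 1 (k + 2)) \<in> set (int (k + 2) # ?r)"
    proof (cases "k = 0")
      case False
      hence "k \<ge> 2" using step by (cases k) (auto, presburger)
      thus ?thesis using r(4) by auto
    qed simp
    ultimately show "\<exists>r. col_ends (k + 2) (int (k + 2) # r) \<and> r \<noteq> [] \<and> hd r = int (k + 2) - 1 \<and>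
      int (min 1 (k + 2)) \<in> set (int (k + 2) # r) \<and>
      comm_swap\<^sup>*\<^sup>* (rev (pairs (k + 2) 0 @ [0])) (concat (strs (int (k + 2) # r)))"
      by (intro exI[of _ ?r]) auto
  qed auto
  thus ?thesis by blast
qed

lemma track_skip: "\<forall>x\<in>set xs. x > c + 1 \<Longrightarrow> track c xs = c"
  by (induction xs) auto

lemma pairs_gt: "\<forall>x\<in>set (pairs k p). x > int p"
  unfolding pairs_def by auto

lemma simple_track:
  assumes "even h"
  shows "track (-1) (pairs h 0 @ [0] @ sym_compl h 0) = int (min 1 h)"
proof -
  have 1: "track (-1) (pairs h 0) = -1" using pairs_gt[of h 0] by (intro track_skip) auto
  show ?thesis
  proof (cases "h = 0")
    case True
    thus ?thesis using 1 by (simp add: track_append sym_compl_def rev_c_def)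
  next
    case False
    then obtain d where d: "h = 2 * Suc d" using assms by (metis dvdE not0_implies_Suc mult_0_right)
    have e: "sym_compl h 0 = map (\<lambda>j. int h - 1 - 2 * int j) [0..<d] @ [1]"
      by (simp add: sym_compl_def rev_c_def d)
    have "track 0 (map (\<lambda>j. int h - 1 - 2 * int j) [0..<d]) = 0"
      by (rule track_skip) (auto simp: d)
    hence "track 0 (sym_compl h 0) = 1" by (simp add: track_append e)
    thus ?thesis using 1 d by (simp add: track_append)
  qed
qed

lemma simple_compl_walk:
  assumes "even h"
  shows "avoids 0 (sym_compl h 0)" "track 0 (sym_compl h 0) = int (min 1 h)"
    "set (sym_compl h 0) \<subseteq> {1..int h - 1}"
proof -
  have "avoids c (xs @ [y])" if "\<forall>x\<in>set xs. x > c + 1" "y \<noteq> c" for c y :: int and xs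
    using that by (induction xs) auto
  note av = this
  have "track (-1) (pairs h 0) = -1" using pairs_gt[of h 0] by (intro track_skip) auto
  thus "track 0 (sym_compl h 0) = int (min 1 h)"
    using simple_track[OF assms] by (simp add: track_append)
  show "set (sym_compl h 0) \<subseteq> {1..int h - 1}"
    using assms by (auto simp: sym_compl_def rev_c_def elim!: evenE)
  show "avoids 0 (sym_compl h 0)"
  proof (cases "h = 0")
    case True
    thus ?thesis by (simp add: sym_compl_def rev_c_def)
  next
    case False
    then obtain d where d: "h = 2 * Suc d" using assms by (metis dvdE not0_implies_Suc mult_0_right)
    have e: "sym_compl h 0 = map (\<lambda>j. int h - 1 - 2 * int j) [0..<d] @ [1]"
      by (simp add: sym_compl_def rev_c_def d)
    show ?thesis unfolding e by (rule av) (auto simp: d)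
  qed
qed

lemma sym_compl_range:
  assumes "p \<le> k" "even (k - p)"
  shows "set (sym_compl k p) \<subseteq> {0..int k - 1}" "p = 0 \<Longrightarrow> 0 \<notin> set (sym_compl k p)"
proof -
  obtain d where d: "k - p = 2 * d" using assms(2) by (rule evenE)
  hence k: "k = p + 2 * d" using assms(1) by simp
  have r: "set (rev_c p) \<subseteq> {0..int p - 1}" by (auto simp: rev_c_def)
  have "set (map (\<lambda>j. int k - 1 - 2 * int j) [0..<d]) \<subseteq> {int p + 1..int k - 1}"
    by (auto simp: k)
  thus "set (sym_compl k p) \<subseteq> {0..int k - 1}" "p = 0 \<Longrightarrow> 0 \<notin> set (sym_compl k p)"
    unfolding sym_compl_def using r by (auto simp: k rev_c_def)
qed

section \<open>Dependence on the coefficients\<close>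

lemma dsum_one_minus:
  fixes W l r X :: "'a::comm_ring_1 mat"
  assumes "dim_row W = dim_row l" "dim_col W = dim_col r" "dim_col l = dim_row X" "dim_col X = dim_row r"
  shows "dsum (1\<^sub>m n) (W - l * (X * r)) = dsum (1\<^sub>m n) W - vcat0 n l * (X * hcat0 n r)"
proof -
  have X: "X = four_block_mat (0\<^sub>m 0 0) (0\<^sub>m 0 (dim_col X)) (0\<^sub>m (dim_row X) 0) X"
    by (rule eq_matI) auto
  have "X * hcat0 n r = hcat0 n (X * r)"
    by (subst X) (use assms in \<open>simp add: hcat0_def mult_four_block_dim mat_trivial\<close>)
  moreover have "vcat0 n l * hcat0 n (X * r) = dsum (0\<^sub>m n n) (l * (X * r))"
    unfolding vcat0_def hcat0_def using assms by (simp add: mult_four_block_dim mat_trivial)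
  ultimately show ?thesis using assms by (simp add: four_block_arith mat_trivial)
qed

text \<open>\<open>A\<^sub>0\<close> occurs in exactly one factor, so the word is an affine function of it.\<close>

lemma fiedler_word_update:
  fixes a :: "nat \<Rightarrow> 'a::comm_ring_1 mat"
  assumes a: "\<And>i. i \<le> k \<Longrightarrow> a i \<in> carrier_mat n n" and X: "X \<in> carrier_mat n n"
  shows "fiedler_word n (a(0 := a 0 + X)) c k =
    fiedler_word n a c k - port_col n a c k * (X * port_row n a c k)"
  using a
proof (induction k)
  case 0
  have "dim_row (a 0) = n" "dim_col (a 0) = n" using 0[of 0] by auto
  thus ?case using X by (intro eq_matI) (auto simp: mat_trivial)
next
  case (Suc k)
  define W where "W = fiedler_word n a c k"
  define l where "l = port_col n a c k"
  define r where "r = port_row n a c k"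
  define M where "M = fiedler_step n (a (Suc k)) (k * n)"
  have ad: "dim_row (a (Suc k)) = n" "dim_col (a (Suc k)) = n" using Suc.prems[of "Suc k"] by auto
  have d: "dim_row W = n + k * n" "dim_col W = n + k * n" "dim_row l = n + k * n" "dim_col l = n"
    "dim_row r = n" "dim_col r = n + k * n" "dim_row X = n" "dim_col X = n"
    "dim_row M = n + (n + k * n)" "dim_col M = n + (n + k * n)"
    using fiedler_word_dim[of k a n c] port_dims[of k a n c] Suc.prems ad X
    by (auto simp: W_def l_def r_def M_def)
  have IH: "fiedler_word n (a(0 := a 0 + X)) c k = W - l * (X * r)"
    unfolding W_def l_def r_def by (rule Suc.IH) (simp add: Suc.prems)
  have D: "dsum (1\<^sub>m n) (W - l * (X * r)) = dsum (1\<^sub>m n) W - vcat0 n l * (X * hcat0 n r)"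
    by (rule dsum_one_minus) (simp_all add: d)
  show ?case
    unfolding fiedler_word.simps port_col.simps port_row.simps Let_def IH D W_def[symmetric]
      l_def[symmetric] r_def[symmetric] fun_upd_other[of "Suc k" 0, OF Suc_not_Zero] M_def[symmetric]
    by (simp add: mult_minus_dim mult_assoc_dim d)
qed

context comm_ring_hom
begin

lemma mat_hom_mult_dim: "dim_col A = dim_row B \<Longrightarrow> mat\<^sub>h (A * B) = mat\<^sub>h A * mat\<^sub>h B"
  by (rule mat_hom_mult[of A "dim_row A" "dim_row B" B "dim_col B"]) auto

lemma mat_hom_four_block:
  "dim_row B = dim_row A \<Longrightarrow> dim_col C = dim_col A \<Longrightarrow> dim_row C = dim_row D \<Longrightarrow>
    dim_col B = dim_col D \<Longrightarrow> mat\<^sub>h (four_block_mat A B C D) =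
    four_block_mat (mat\<^sub>h A) (mat\<^sub>h B) (mat\<^sub>h C) (mat\<^sub>h D)"
  by (rule map_four_block_mat[of A "dim_row A" "dim_col A" B "dim_col D" C "dim_row D" D]) auto

lemma mat_hom_basic:
  "mat\<^sub>h (1\<^sub>m r) = 1\<^sub>m r" "mat\<^sub>h (0\<^sub>m r s) = 0\<^sub>m r s" "mat\<^sub>h (- A) = - mat\<^sub>h A"
  "mat\<^sub>h (k \<cdot>\<^sub>m A) = hom k \<cdot>\<^sub>m mat\<^sub>h A"
  "dim_row A = dim_row B \<Longrightarrow> dim_col A = dim_col B \<Longrightarrow> mat\<^sub>h (A - B) = mat\<^sub>h A - mat\<^sub>h B"
  "dim_row A = dim_row B \<Longrightarrow> dim_col A = dim_col B \<Longrightarrow> mat\<^sub>h (A + B) = mat\<^sub>h A + mat\<^sub>h B"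
  by (auto intro!: eq_matI simp: hom_distribs one_mat_def)

lemma fiedler_step_hom:
  "dim_row A = n \<Longrightarrow> dim_col A = n \<Longrightarrow> mat\<^sub>h (fiedler_step n A q) = fiedler_step n (mat\<^sub>h A) q"
  unfolding fiedler_step_def by (simp add: mat_hom_four_block mat_hom_basic)

lemma fiedler_word_hom:
  assumes "\<And>i. i \<le> k \<Longrightarrow> a i \<in> carrier_mat n n"
  shows "mat\<^sub>h (fiedler_word n a c k) = fiedler_word n (\<lambda>i. mat\<^sub>h (a i)) c k"
  using assms
proof (induction k)
  case 0
  show ?case by (simp add: mat_hom_basic)
next
  case (Suc k)
  have ad: "dim_row (a (Suc k)) = n" "dim_col (a (Suc k)) = n" using Suc.prems[of "Suc k"] by auto
  have IH: "mat\<^sub>h (fiedler_word n a c k) = fiedler_word n (\<lambda>i. mat\<^sub>h (a i)) c k" using Suc by simp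
  have d: "dim_row (fiedler_word n a c k) = n + k * n" "dim_col (fiedler_word n a c k) = n + k * n"
    using fiedler_word_dim[of k a n c] Suc.prems by auto
  have d': "dim_row (fiedler_word n (\<lambda>i. mat\<^sub>h (a i)) c k) = n + k * n"
     "dim_col (fiedler_word n (\<lambda>i. mat\<^sub>h (a i)) c k) = n + k * n"
    using d unfolding IH[symmetric] by simp_all
  show ?case
    unfolding fiedler_word.simps Let_def
    by (auto simp: mat_hom_mult_dim mat_hom_four_block mat_hom_basic fiedler_step_hom ad d d' IH)
qed

lemma rv_hom: "mat\<^sub>h (rv A) = rv (mat\<^sub>h A)"
  by (rule eq_matI) auto

end

section \<open>Fiedler matrices\<close>

text \<open>The block column with an identity block in the rows \<open>p, \<dots>, p + n - 1\<close>. The offset is not required to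
  be a multiple of \<open>n\<close>, which makes the lemmas about padding with zeros and identities uniform.\<close>

definition ucol :: "nat \<Rightarrow> nat \<Rightarrow> nat \<Rightarrow> 'a::comm_ring_1 mat" where
  "ucol N p n = mat N n (\<lambda>(i, j). if i = p + j then 1 else 0)"

lemma ucol_dim[simp]: "dim_row (ucol N p n) = N" "dim_col (ucol N p n) = n"
  by (simp_all add: ucol_def)

lemma mult_ucol:
  fixes X :: "'a::comm_ring_1 mat"
  assumes "dim_col X = N" "p + n \<le> N"
  shows "X * ucol N p n = mat (dim_row X) n (\<lambda>(i, j). X $$ (i, p + j))"
proof (rule eq_matI, goal_cases)
  case (1 i j)
  have "(\<Sum>k = 0..<N. X $$ (i, k) * (if k = p + j then 1 else 0)) = X $$ (i, p + j)"
    using 1 assms by (simp add: if_distrib[of "\<lambda>x. _ * x"] sum.delta cong: if_cong)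
  thus ?case using 1 assms by (simp add: scalar_prod_def ucol_def)
qed auto

lemma ucol_fixed:
  fixes X :: "'a::comm_ring_1 mat"
  assumes "dim_row X = r" "dim_col X = r" "N = p + (r + q)" "u + n \<le> p \<or> p + r \<le> u \<and> u + n \<le> N"
  shows "dsum (1\<^sub>m p) (dsum X (1\<^sub>m q)) * ucol N u n = ucol N u n"
proof (subst mult_ucol)
  show "u + n \<le> N" using assms by auto
  show "mat (dim_row (dsum (1\<^sub>m p) (dsum X (1\<^sub>m q)))) n (\<lambda>(i, j). dsum (1\<^sub>m p) (dsum X (1\<^sub>m q)) $$ (i, u + j)) = ucol N u n"
  proof (rule eq_matI, goal_cases)
    case (1 i j)
    hence ij: "i < N" "j < n" by simp_all
    from assms(4) show ?case
    proof
      assume u: "u + n \<le> p"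
      show ?thesis using ij u assms(1-3) by (cases "i < p") (simp_all add: ucol_def)
    next
      assume u: "p + r \<le> u \<and> u + n \<le> N"
      hence j: "\<not> u + j < p" "\<not> u + j - p < r" "u + j < p + (r + q)" "u + j - p - r < q" using ij assms(3) by auto
      have e: "i - p - r = u + j - p - r \<longleftrightarrow> i = u + j" if "\<not> i < p + r" using u that ij by auto
      show ?thesis
      proof (cases "i < p + r")
        case True
        hence "i \<noteq> u + j" using u by simp
        thus ?thesis using ij u assms(1-3) j True by (cases "i < p") (simp_all add: ucol_def less_diff_conv2)
      next
        case False
        hence "\<not> i < p" "\<not> i - p < r" "i - p - r < q" using ij assms(3) by auto
        thus ?thesis using ij assms(1-3) j e[OF False] by (simp add: ucol_def)
      qed
    qed
  qed (use assms in auto)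
qed (use assms in auto)

lemma ucol_step:
  fixes A :: "'a::comm_ring_1 mat"
  assumes "dim_row A = n" "dim_col A = n" "N = p + (n + n + q)"
  shows "dsum (1\<^sub>m p) (fiedler_step n A q) * ucol N (p + n) n = ucol N p n"
proof (subst mult_ucol)
  show "mat (dim_row (dsum (1\<^sub>m p) (fiedler_step n A q))) n (\<lambda>(i, j). dsum (1\<^sub>m p) (fiedler_step n A q) $$ (i, p + n + j)) = ucol N p n"
  proof (rule eq_matI, goal_cases)
    case (1 i j)
    hence ij: "i < N" "j < n" by simp_all
    show ?case using ij assms
      by (cases "i < p"; cases "i < p + n"; cases "i < p + n + n")
         (auto simp: ucol_def fiedler_step_def)
  qed (use assms in auto)
qed (use assms in auto)

lemma transpose_four_block_dim:
  "dim_row B = dim_row A \<Longrightarrow> dim_col C = dim_col A \<Longrightarrow> dim_row C = dim_row D \<Longrightarrow>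
    dim_col B = dim_col D \<Longrightarrow> transpose_mat (four_block_mat A B C D) =
    four_block_mat (transpose_mat A) (transpose_mat C) (transpose_mat B) (transpose_mat D)"
  by (rule transpose_four_block_mat[of A "dim_row A" "dim_col A" B "dim_col D" C "dim_row D"]) auto

lemma transpose_one_zero:
  "transpose_mat (1\<^sub>m n :: 'a::comm_ring_1 mat) = 1\<^sub>m n"
  "transpose_mat (0\<^sub>m n k :: 'a mat) = 0\<^sub>m k n"
  by (rule eq_matI; auto)+

lemma transpose_fiedler_step:
  "dim_row A = n \<Longrightarrow> dim_col A = n \<Longrightarrow>
    transpose_mat (fiedler_step n A q) = fiedler_step n (transpose_mat A) q"
  unfolding fiedler_step_def by (rule eq_matI) auto

lemma transpose_mult_dim:
  fixes A B :: "'a::comm_ring_1 mat"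
  shows "dim_col A = dim_row B \<Longrightarrow> transpose_mat (A * B) = transpose_mat B * transpose_mat A"
  by (rule transpose_mult[of A "dim_row A" "dim_row B" B "dim_col B"]) auto

lemma urow_fixed:
  fixes X :: "'a::comm_ring_1 mat"
  assumes "dim_row X = r" "dim_col X = r" "N = p + (r + q)" "u + n \<le> p \<or> p + r \<le> u \<and> u + n \<le> N"
  shows "transpose_mat (ucol N u n) * dsum (1\<^sub>m p) (dsum X (1\<^sub>m q)) = transpose_mat (ucol N u n)"
proof -
  have "dsum (1\<^sub>m p) (dsum (transpose_mat X) (1\<^sub>m q)) * ucol N u n = ucol N u n"
    by (rule ucol_fixed) (use assms in auto)
  hence "transpose_mat (dsum (1\<^sub>m p) (dsum (transpose_mat X) (1\<^sub>m q)) * ucol N u n) = transpose_mat (ucol N u n)"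
    by simp
  thus ?thesis
    by (subst (asm) transpose_mult_dim) (use assms in \<open>simp_all add: transpose_four_block_dim transpose_one_zero\<close>)
qed

lemma urow_step:
  fixes A :: "'a::comm_ring_1 mat"
  assumes "dim_row A = n" "dim_col A = n" "N = p + (n + n + q)"
  shows "transpose_mat (ucol N (p + n) n) * dsum (1\<^sub>m p) (fiedler_step n A q) = transpose_mat (ucol N p n)"
proof -
  have "dsum (1\<^sub>m p) (fiedler_step n (transpose_mat A) q) * ucol N (p + n) n = ucol N p n"
    by (rule ucol_step) (use assms in auto)
  hence "transpose_mat (dsum (1\<^sub>m p) (fiedler_step n (transpose_mat A) q) * ucol N (p + n) n) = transpose_mat (ucol N p n)"
    by simp
  thus ?thesis
    by (subst (asm) transpose_mult_dim)
       (use assms in \<open>simp_all add: transpose_four_block_dim transpose_one_zero transpose_fiedler_step\<close>)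
qed

lemma vcat0_ucol: "vcat0 p (ucol N u n) = ucol (p + N) (p + u) n"
  unfolding vcat0_def ucol_def by (rule eq_matI) auto

lemma hcat0_urow: "hcat0 p (transpose_mat (ucol N u n)) = transpose_mat (ucol (p + N) (p + u) n)"
  unfolding hcat0_def ucol_def by (rule eq_matI) auto

lemma ucol_0: "ucol n 0 n = 1\<^sub>m n"
  unfolding ucol_def by (rule eq_matI) auto

text \<open>In the product for an admissible tuple \<open>(k-1:k, \<dots>, p+1:p+2, 0:p)\<close>, the factors \<open>M\<^bsub>p+1\<^esub>, M\<^bsub>p+3\<^esub>, \<dots>\<close>
  stand to the left of their predecessors and all other factors to the right.\<close>

definition adm_side :: "nat \<Rightarrow> nat \<Rightarrow> bool" where
  "adm_side p i \<longleftrightarrow> p < i \<and> odd (i - p)"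

text \<open>The row port is fixed by all factors, since \<open>M\<^sub>1\<close>, the only one that would move it, is on the
  other side. The column port is moved up one block by \<open>M\<^sub>1\<close> and then fixed, since \<open>M\<^sub>2\<close> is on the
  other side.\<close>

lemma simple_ports:
  fixes a :: "nat \<Rightarrow> 'a::comm_ring_1 mat"
  assumes "\<And>i. i \<le> k \<Longrightarrow> a i \<in> carrier_mat n n"
  shows "port_col n a (adm_side 0) k = ucol (Suc k * n) ((k - min 1 k) * n) n \<and>
    port_row n a (adm_side 0) k = transpose_mat (ucol (Suc k * n) (k * n) n)"
  using assms
proof (induction k)
  case 0
  show ?case by (simp add: ucol_0 transpose_one_zero)
next
  case (Suc k)
  have ad: "dim_row (a (Suc k)) = n" "dim_col (a (Suc k)) = n" using Suc.prems[of "Suc k"] by auto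
  define M where "M = fiedler_step n (a (Suc k)) (k * n)"
  have M: "M = dsum (1\<^sub>m 0) M" by (rule eq_matI) auto
  have M': "M = dsum (1\<^sub>m 0) (dsum (four_block_mat (- a (Suc k)) (1\<^sub>m n) (1\<^sub>m n) (0\<^sub>m n n)) (1\<^sub>m (k * n)))"
    using M by (simp add: M_def fiedler_step_def)
  have IH: "port_col n a (adm_side 0) k = ucol (Suc k * n) ((k - min 1 k) * n) n"
    "port_row n a (adm_side 0) k = transpose_mat (ucol (Suc k * n) (k * n) n)"
    using Suc by auto
  have c: "vcat0 n (port_col n a (adm_side 0) k) = ucol (Suc (Suc k) * n) (n + (k - min 1 k) * n) n"
    "hcat0 n (port_row n a (adm_side 0) k) = transpose_mat (ucol (Suc (Suc k) * n) (Suc k * n) n)"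
    unfolding IH vcat0_ucol hcat0_urow by simp_all
  have r: "transpose_mat (ucol (Suc (Suc k) * n) (Suc k * n) n) * M = transpose_mat (ucol (Suc (Suc k) * n) (Suc k * n) n)"
    if "k > 0"
  proof -
    have e: "n + n \<le> Suc k * n" "Suc k * n + n = Suc (Suc k) * n" using that by (cases k; simp)+
    show ?thesis
      by (subst M', rule urow_fixed[of _ "n + n" _ _ "k * n"]) (simp_all add: ad e del: mult_Suc, simp_all)
  qed
  have l: "M * ucol (Suc (Suc k) * n) (n + (k - 1) * n) n = ucol (Suc (Suc k) * n) (n + (k - 1) * n) n"
    if k1: "k > 1"
  proof -
    obtain k' where "k = Suc (Suc k')"
    proof
      show "k = Suc (Suc (k - 2))" using k1 by simp
    qed
    then have k: "(k - 1) * n = n + k' * n" "k * n = n + (n + k' * n)" by simp_all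
    have e: "n + (k - 1) * n = k * n" unfolding k by simp
    have e': "n + n \<le> k * n" "k * n + n \<le> Suc (Suc k) * n" by (simp add: k(2), simp)
    show ?thesis unfolding e
      by (subst M', rule ucol_fixed[of _ "n + n" _ _ "k * n"]) (simp_all add: ad e' del: mult_Suc, simp_all)
  qed
  have l0: "M * ucol (Suc (Suc k) * n) (n + 0) n = ucol (Suc (Suc k) * n) 0 n"
    using ucol_step[of "a (Suc k)" n "Suc (Suc k) * n" 0 "k * n"] ad unfolding M_def[symmetric] M[symmetric]
    by simp
  show ?case
  proof (cases "odd (Suc k)")
    case True
    hence a: "adm_side 0 (Suc k)" by (simp add: adm_side_def)
    have "M * ucol (Suc (Suc k) * n) (n + (k - min 1 k) * n) n = ucol (Suc (Suc k) * n) (k * n) n"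
    proof (cases "k = 0")
      case True
      thus ?thesis using l0 by simp
    next
      case False
      hence "k > 1" using \<open>odd (Suc k)\<close> by (cases k; cases "k - 1") auto
      moreover from this have "n + (k - 1) * n = k * n" by (cases k) auto
      ultimately show ?thesis using l by simp
    qed
    thus ?thesis using a c by (simp add: Let_def M_def)
  next
    case False
    hence a: "\<not> adm_side 0 (Suc k)" by (simp add: adm_side_def)
    have k: "k > 0" using False by (cases k) auto
    moreover from this have "n + (k - 1) * n = k * n" by (cases k) auto
    ultimately show ?thesis using a c r by (simp add: Let_def M_def)
  qed
qed

interpretation cx: entry_ring "UNIV :: complex set"
  by unfold_locales auto

locale fiedler_coeffs =
  fixes n m :: nat and a :: "nat \<Rightarrow> cmat"
  assumes m: "m \<ge> 1" and a: "\<And>i. i \<le> m \<Longrightarrow> a i \<in> carrier_mat n n"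
begin

abbreviation "F i \<equiv> fiedler n m a i"
abbreviation "FP t \<equiv> fiedler_prod n m a t"

lemma ad: "i \<le> m \<Longrightarrow> dim_row (a i) = n" "i \<le> m \<Longrightarrow> dim_col (a i) = n"
  using a by auto

lemma fiedler_zero: "F 0 = dsum (1\<^sub>m ((m - 1) * n)) (- a 0)"
  by (simp add: fiedler_def four_block_empty four_block_empty')

lemma fiedler_pos:
  "1 \<le> k \<Longrightarrow> k < m \<Longrightarrow> F (int k) = dsum (1\<^sub>m ((m - k - 1) * n)) (fiedler_step n (a k) ((k - 1) * n))"
  using ad[of k] by (simp add: fiedler_def Let_def fiedler_step_def four_block_empty')

lemma fiedler_Suc:
  "Suc k < m \<Longrightarrow> F (int (Suc k)) = dsum (1\<^sub>m ((m - Suc k - 1) * n)) (fiedler_step n (a (Suc k)) (k * n))"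
  using fiedler_pos[of "Suc k"] by simp

lemma fiedler_neg:
  "1 \<le> k \<Longrightarrow> k < m \<Longrightarrow> F (- int k) = dsum (1\<^sub>m ((m - k - 1) * n))
     (dsum (four_block_mat (0\<^sub>m n n) (1\<^sub>m n) (1\<^sub>m n) (a k)) (1\<^sub>m ((k - 1) * n)))"
  using ad[of k] by (simp add: fiedler_def Let_def four_block_empty')

lemma fiedler_last: "F (- int m) = dsum (a m) (1\<^sub>m ((m - 1) * n))"
  using m by (simp add: fiedler_def Let_def four_block_empty')

lemma index_cases:
  assumes "- int m \<le> i" "i < int m"
  obtains "i = 0" | k where "1 \<le> k" "k < m" "i = int k" | k where "1 \<le> k" "k < m" "i = - int k" | "i = - int m"
proof -
  consider "i = 0" | "i = - int m" | "0 < i" | "- int m < i" "i < 0" using assms by linarith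
  thus ?thesis
  proof cases
    case 3
    thus ?thesis using that(2)[of "nat i"] assms by auto
  next
    case 4
    thus ?thesis using that(3)[of "nat (- i)"] assms by auto
  qed (use that in auto)
qed

lemma block_size:
  assumes "1 \<le> k" "k < m"
  shows "m * n = (m - k - 1) * n + (n + n + (k - 1) * n)"
proof -
  obtain k' where k: "k = Suc k'" using assms(1) by (cases k) auto
  obtain q where q: "m = Suc k + q" using assms(2) by (metis Suc_leI le_iff_add)
  show ?thesis unfolding q k by (simp add: algebra_simps)
qed

lemma block_size1: "m * n = (m - 1) * n + n"
  using m by (cases m) auto

lemma fiedler_dim:
  assumes "- int m \<le> i" "i < int m"
  shows "dim_row (F i) = m * n \<and> dim_col (F i) = m * n"
  using assms
proof (cases rule: index_cases)
  case 1
  thus ?thesis using block_size1 ad[of 0] by (simp add: fiedler_zero)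
next
  case (2 k)
  show ?thesis unfolding 2(3) fiedler_pos[OF 2(1,2)] using block_size[OF 2(1,2)] ad[of k] 2 by simp
next
  case (3 k)
  show ?thesis unfolding 3(3) fiedler_neg[OF 3(1,2)] using block_size[OF 3(1,2)] ad[of k] 3 by simp
next
  case 4
  thus ?thesis using block_size1 ad[of m] by (simp add: fiedler_last)
qed

abbreviation valid :: "int list \<Rightarrow> bool" where
  "valid t \<equiv> set t \<subseteq> {- int m..int m - 1}"

lemma prod_Nil: "FP [] = 1\<^sub>m (m * n)"
  and prod_Cons: "FP (i # t) = F i * FP t"
  by (simp_all add: fiedler_prod_def)

lemma prod_dim: "valid t \<Longrightarrow> dim_row (FP t) = m * n \<and> dim_col (FP t) = m * n"
  by (induction t) (auto simp: prod_Nil prod_Cons fiedler_dim)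

lemma prod_single: "valid [i] \<Longrightarrow> FP [i] = F i"
  using fiedler_dim[of i] by (simp add: prod_Cons prod_Nil mat_trivial)

lemma prod_append: "valid s \<Longrightarrow> valid t \<Longrightarrow> FP (s @ t) = FP s * FP t"
proof (induction s)
  case Nil
  thus ?case using prod_dim[of t] by (simp add: prod_Nil mat_trivial)
next
  case (Cons i s)
  thus ?case using prod_dim[of t] prod_dim[of s] fiedler_dim[of i] by (simp add: prod_Cons mult_assoc_dim)
qed

subsection \<open>Block unit vectors\<close>

text \<open>The block unit vector \<open>e\<^bsub>m-d\<^esub>\<close>. Blocks are counted from the bottom, so that \<open>M\<^sub>i\<close> and \<open>M\<^bsub>-i\<^esub>\<close> act on
  the blocks \<open>d = i\<close> and \<open>d = i - 1\<close>.\<close>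

definition bcol :: "nat \<Rightarrow> cmat" where
  "bcol d = ucol (m * n) ((m - d - 1) * n) n"

abbreviation "brow d \<equiv> transpose_mat (bcol d)"

lemma bcol_dim[simp]: "dim_row (bcol d) = m * n" "dim_col (bcol d) = n"
  by (simp_all add: bcol_def)

lemma offset_le: "d < m \<Longrightarrow> e < d \<Longrightarrow> (m - d - 1) * n + n \<le> (m - e - 1) * n"
proof -
  assume "d < m" "e < d"
  hence "Suc (m - d - 1) \<le> m - e - 1" by simp
  hence "Suc (m - d - 1) * n \<le> (m - e - 1) * n" by (rule mult_le_mono1)
  thus ?thesis by simp
qed

lemma offset_top: "d < m \<Longrightarrow> (m - d - 1) * n + n \<le> m * n"
proof -
  assume "d < m"
  hence "Suc (m - d - 1) \<le> m" by simp
  hence "Suc (m - d - 1) * n \<le> m * n" by (rule mult_le_mono1)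
  thus ?thesis by simp
qed

lemma fiedler_fixes:
  assumes i: "- int m \<le> i" "i < int m" and d: "d < m" "int d \<noteq> \<bar>i\<bar>" "int d \<noteq> \<bar>i\<bar> - 1"
  shows "F i * bcol d = bcol d \<and> brow d * F i = brow d"
proof -
  have mid: "(m - d - 1) * n + n \<le> (m - k - 1) * n \<or>
      (m - k - 1) * n + (n + n) \<le> (m - d - 1) * n \<and> (m - d - 1) * n + n \<le> m * n"
    if "1 \<le> k" "k < m" "d \<noteq> k" "d \<noteq> k - 1" for k
  proof (cases "k < d")
    case True
    thus ?thesis using offset_le d by auto
  next
    case False
    hence "Suc d < k" using that by auto
    hence "(m - k - 1) * n + n \<le> (m - Suc d - 1) * n" "(m - Suc d - 1) * n + n \<le> (m - d - 1) * n"
      using offset_le[of k "Suc d"] offset_le[of "Suc d" d] that by auto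
    thus ?thesis using offset_top[OF d(1)] by linarith
  qed
  have gen: "dsum (1\<^sub>m p) (dsum X (1\<^sub>m q)) * bcol d = bcol d \<and> brow d * dsum (1\<^sub>m p) (dsum X (1\<^sub>m q)) = brow d"
    if "dim_row X = r" "dim_col X = r" "m * n = p + (r + q)"
      "(m - d - 1) * n + n \<le> p \<or> p + r \<le> (m - d - 1) * n \<and> (m - d - 1) * n + n \<le> m * n"
    for X :: cmat and p q r
    unfolding bcol_def using ucol_fixed[OF that] urow_fixed[OF that] by simp
  have e: "dsum X (1\<^sub>m 0) = X" "dsum (1\<^sub>m 0) X = X" for X :: cmat
    by (rule eq_matI; auto)+
  show ?thesis
    using i
  proof (cases rule: index_cases)
    case 1
    have "(m - d - 1) * n + n \<le> (m - 1) * n" using offset_le[of d 0] d 1 by auto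
    thus ?thesis using gen[of "- a 0" n "(m - 1) * n" 0] block_size1 ad[of 0] unfolding 1 fiedler_zero e by simp
  next
    case (2 k)
    have "int d \<noteq> int k" "int d \<noteq> int k - 1" using d 2 by auto
    hence "d \<noteq> k" "d \<noteq> k - 1" using 2(1) by auto
    note M = mid[OF 2(1,2) this]
    show ?thesis unfolding 2(3) fiedler_pos[OF 2(1,2)] fiedler_step_def
      by (rule gen[OF _ _ block_size[OF 2(1,2)] M]) (use ad[of k] 2 in simp_all)
  next
    case (3 k)
    have "int d \<noteq> int k" "int d \<noteq> int k - 1" using d 3 by auto
    hence "d \<noteq> k" "d \<noteq> k - 1" using 3(1) by auto
    note M = mid[OF 3(1,2) this]
    show ?thesis unfolding 3(3) fiedler_neg[OF 3(1,2)]
      by (rule gen[OF _ _ block_size[OF 3(1,2)] M]) (use ad[of k] 3 in simp_all)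
  next
    case 4
    have "d < m - 1" using d 4 m by auto
    hence "n \<le> (m - d - 1) * n" by (cases "m - d - 1") auto
    thus ?thesis using gen[of "a m" n 0 "(m - 1) * n"] block_size1 ad[of m] offset_top[OF d(1)]
      unfolding 4 fiedler_last e by simp
  qed
qed

lemma fiedler_moves:
  assumes "Suc d < m"
  shows "F (int (Suc d)) * bcol d = bcol (Suc d) \<and> brow d * F (int (Suc d)) = brow (Suc d)"
proof -
  have off: "(m - d - 1) * n = (m - Suc d - 1) * n + n"
  proof -
    have "m - d - 1 = Suc (m - Suc d - 1)" using assms by simp
    thus ?thesis by simp
  qed
  have s: "m * n = (m - Suc d - 1) * n + (n + n + (Suc d - 1) * n)" using block_size[of "Suc d"] assms by simp
  show ?thesis unfolding bcol_def off fiedler_Suc[OF assms]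
    using ucol_step[OF _ _ s, of "a (Suc d)"] urow_step[OF _ _ s, of "a (Suc d)"] ad[of "Suc d"] assms
    by simp
qed

lemma prod_fixes:
  assumes "d < m" "valid t" "\<forall>i\<in>set t. int d \<noteq> \<bar>i\<bar> \<and> int d \<noteq> \<bar>i\<bar> - 1"
  shows "FP t * bcol d = bcol d \<and> brow d * FP t = brow d"
  using assms(2,3)
proof (induction t)
  case Nil
  show ?case by (simp add: prod_Nil mat_trivial)
next
  case (Cons i t)
  have F: "F i * bcol d = bcol d \<and> brow d * F i = brow d" using fiedler_fixes[of i d] Cons.prems assms(1) by auto
  have IH: "FP t * bcol d = bcol d \<and> brow d * FP t = brow d" using Cons by auto
  have d: "dim_row (F i) = m * n" "dim_col (F i) = m * n" "dim_row (FP t) = m * n" "dim_col (FP t) = m * n"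
    using fiedler_dim[of i] prod_dim[of t] Cons.prems by auto
  have "brow d * (F i * FP t) = (brow d * F i) * FP t" by (simp add: mult_assoc_dim d)
  thus ?case using F IH by (simp add: prod_Cons mult_assoc_dim d)
qed

text \<open>Both products apply the factors to the block unit vector in the order in which the indices
  appear in \<open>t\<close>, since \<open>M\<^bsub>rev t\<^esub>\<close> acts from the left and \<open>M\<^sub>t\<close> from the right. The factor with
  index \<open>d + 1\<close> moves the vector one block up; all other factors fix it because \<open>t\<close> avoids \<open>d\<close>.\<close>

lemma prod_walk:
  assumes "avoids (int d) t" "d < m" "set t \<subseteq> {0..int m - 1}"
  shows "FP (rev t) * bcol d = bcol (nat (track (int d) t)) \<and> brow d * FP t = brow (nat (track (int d) t)) \<and>
    track (int d) t < int m"
  using assms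
proof (induction t arbitrary: d)
  case Nil
  thus ?case by (simp add: prod_Nil mat_trivial)
next
  case (Cons s t)
  define d' where "d' = (if s = int d + 1 then Suc d else d)"
  have d': "d' < m" using Cons.prems by (auto simp: d'_def)
  have dd: "(if s = int d + 1 then int d + 1 else int d) = int d'" by (simp add: d'_def)
  have IH: "FP (rev t) * bcol d' = bcol (nat (track (int d') t)) \<and> brow d' * FP t = brow (nat (track (int d') t)) \<and>
    track (int d') t < int m"
    using Cons.IH[OF _ d'] Cons.prems dd by auto
  have F: "F s * bcol d = bcol d' \<and> brow d * F s = brow d'"
  proof (cases "s = int d + 1")
    case True
    thus ?thesis using fiedler_moves[of d] Cons.prems by (auto simp: d'_def add.commute)
  next
    case False
    thus ?thesis using fiedler_fixes[of s d] Cons.prems by (auto simp: d'_def)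
  qed
  have v: "valid (rev t)" "valid [s]" "valid t" using Cons.prems by auto
  have d: "dim_row (F s) = m * n" "dim_col (F s) = m * n" "dim_row (FP t) = m * n" "dim_col (FP t) = m * n"
    "dim_row (FP (rev t)) = m * n" "dim_col (FP (rev t)) = m * n"
    using fiedler_dim[of s] prod_dim[of t] prod_dim[of "rev t"] v by auto
  have "brow d * (F s * FP t) = (brow d * F s) * FP t" by (simp add: mult_assoc_dim d)
  moreover have "track (int d) (s # t) = track (int d') t" using dd by simp
  moreover have "FP (rev (s # t)) = FP (rev t) * F s"
    using prod_append[OF v(1,2)] prod_single[OF v(2)] by simp
  ultimately show ?case using F IH unfolding prod_Cons
    by (simp add: mult_assoc_dim d del: track.simps rev.simps)
qed

subsection \<open>Invertibility\<close>

lemma fiedler_unit: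
  assumes i: "- int m \<le> i" "i < int m" and "i = 0 \<Longrightarrow> invertible_mat (a 0)" "i = - int m \<Longrightarrow> invertible_mat (a m)"
  shows "cx.S_unit (m * n) (F i)"
proof -
  have ent: "cx.ent X" for X by (simp add: cx.ent_def)
  have inv: "cx.S_unit n X" if X: "X \<in> carrier_mat n n" "invertible_mat X" for X
  proof -
    obtain Y where Y': "X * Y = 1\<^sub>m (dim_row X)" "Y * X = 1\<^sub>m (dim_row Y)"
      using X(2) unfolding invertible_mat_def inverts_mat_def by blast
    hence Y: "X * Y = 1\<^sub>m n" "Y * X = 1\<^sub>m (dim_row Y)" using X(1) by auto
    have "dim_col Y = n" using arg_cong[OF Y(1), of dim_col] by simp
    moreover have "dim_row Y = n" using arg_cong[OF Y(2), of dim_col] X(1) by simp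
    ultimately show ?thesis using Y X(1) by (intro cx.S_unitI[of X n Y]) (auto simp: ent)
  qed
  have neg: "cx.S_unit (n + n) (four_block_mat (0\<^sub>m n n) (1\<^sub>m n) (1\<^sub>m n) X)" if "X \<in> carrier_mat n n" for X
  proof -
    have 0: "- X + X = 0\<^sub>m n n" "X + - X = 0\<^sub>m n n" using that by (auto intro!: eq_matI)
    show ?thesis
      by (rule cx.S_unitI[of _ _ "four_block_mat (- X) (1\<^sub>m n) (1\<^sub>m n) (0\<^sub>m n n)"])
         (use that 0 in \<open>auto simp: ent mult_four_block_dim mat_trivial\<close>)
  qed
  show ?thesis using i
  proof (cases rule: index_cases)
    case 1
    show ?thesis unfolding 1 fiedler_zero
      using cx.S_unit_diag[OF cx.S_unit_one cx.S_unit_uminus[OF inv[OF a[of 0]]] block_size1] assms(3) 1 ad[of 0] by simp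
  next
    case (2 k)
    have "cx.S_unit (m * n) (dsum (1\<^sub>m ((m - k - 1) * n)) (fiedler_step n (a k) ((k - 1) * n)))"
      using cx.S_unit_diag[OF cx.S_unit_one cx.S_unit_fiedler_step_inv(2)[OF a ent] block_size[OF 2(1,2)]] 2 ad[of k]
      by simp
    thus ?thesis unfolding 2(3) fiedler_pos[OF 2(1,2)] .
  next
    case (3 k)
    have "cx.S_unit (n + n + (k - 1) * n) (dsum (four_block_mat (0\<^sub>m n n) (1\<^sub>m n) (1\<^sub>m n) (a k)) (1\<^sub>m ((k - 1) * n)))"
      using cx.S_unit_diag[OF neg[OF a] cx.S_unit_one refl] 3 ad[of k] by simp
    from cx.S_unit_diag[OF cx.S_unit_one this block_size[OF 3(1,2)]]
    show ?thesis unfolding 3(3) fiedler_neg[OF 3(1,2)] using 3 ad[of k] by simp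
  next
    case 4
    show ?thesis unfolding 4 fiedler_last
      using cx.S_unit_diag[OF inv[OF a[of m]] cx.S_unit_one, of "m * n" "(m - 1) * n"] assms(4) 4 ad[of m] block_size1 by simp
  qed
qed

lemma prod_unit:
  assumes "valid t" "0 \<in> set t \<Longrightarrow> invertible_mat (a 0)" "- int m \<in> set t \<Longrightarrow> invertible_mat (a m)"
  shows "cx.S_unit (m * n) (FP t)"
  using assms
proof (induction t)
  case Nil
  show ?case by (simp add: prod_Nil cx.S_unit_one)
next
  case (Cons i t)
  have "cx.S_unit (m * n) (F i)" by (rule fiedler_unit) (use Cons.prems in auto)
  moreover have "cx.S_unit (m * n) (FP t)" using Cons by auto
  ultimately show ?case unfolding prod_Cons by (rule cx.S_unit_mult)
qed

subsection \<open>Admissible products\<close>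

lemma word_dim:
  assumes "k < m"
  shows "dim_row (fiedler_word n a c k) = Suc k * n" "dim_col (fiedler_word n a c k) = Suc k * n"
  using fiedler_word_dim[of k a n c] a assms by auto

lemma word_cong: "(\<And>i. i \<le> k \<Longrightarrow> c i = c' i) \<Longrightarrow> fiedler_word n a c k = fiedler_word n a c' k"
  by (induction k) (auto simp: Let_def)

lemma embed_left:
  assumes "Suc k < m" "c (Suc k)"
  shows "F (int (Suc k)) * dsum (1\<^sub>m ((m - k - 1) * n)) (fiedler_word n a c k) =
    dsum (1\<^sub>m ((m - Suc k - 1) * n)) (fiedler_word n a c (Suc k))"
proof -
  have off: "(m - k - 1) * n = (m - Suc k - 1) * n + n"
  proof -
    have "m - k - 1 = Suc (m - Suc k - 1)" using assms by simp
    thus ?thesis by simp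
  qed
  have s: "dsum (1\<^sub>m ((m - k - 1) * n)) (fiedler_word n a c k) =
      dsum (1\<^sub>m ((m - Suc k - 1) * n)) (dsum (1\<^sub>m n) (fiedler_word n a c k))"
    unfolding dsum_assoc dsum_one off ..
  show ?thesis unfolding s fiedler_Suc[OF assms(1)] fiedler_word.simps Let_def
    using assms word_dim[of k] ad[of "Suc k"] by (simp add: mult_four_block_dim mat_trivial)
qed

lemma embed_right:
  assumes "Suc k < m" "\<not> c (Suc k)"
  shows "dsum (1\<^sub>m ((m - k - 1) * n)) (fiedler_word n a c k) * F (int (Suc k)) =
    dsum (1\<^sub>m ((m - Suc k - 1) * n)) (fiedler_word n a c (Suc k))"
proof -
  have off: "(m - k - 1) * n = (m - Suc k - 1) * n + n"
  proof -
    have "m - k - 1 = Suc (m - Suc k - 1)" using assms by simp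
    thus ?thesis by simp
  qed
  have s: "dsum (1\<^sub>m ((m - k - 1) * n)) (fiedler_word n a c k) =
      dsum (1\<^sub>m ((m - Suc k - 1) * n)) (dsum (1\<^sub>m n) (fiedler_word n a c k))"
    unfolding dsum_assoc dsum_one off ..
  show ?thesis unfolding s fiedler_Suc[OF assms(1)] fiedler_word.simps Let_def
    using assms word_dim[of k] ad[of "Suc k"] by (simp add: mult_four_block_dim mat_trivial)
qed

lemma embed_commute:
  assumes "Suc (Suc k) < m"
  shows "F (int (Suc (Suc k))) * dsum (1\<^sub>m ((m - k - 1) * n)) (fiedler_word n a c k) =
    dsum (1\<^sub>m ((m - k - 1) * n)) (fiedler_word n a c k) * F (int (Suc (Suc k)))"
proof -
  have off: "(m - k - 1) * n = (m - Suc (Suc k) - 1) * n + (n + n)"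
  proof -
    have "m - k - 1 = Suc (Suc (m - Suc (Suc k) - 1))" using assms by simp
    thus ?thesis by simp
  qed
  have s: "dsum (1\<^sub>m ((m - k - 1) * n)) (fiedler_word n a c k) =
      dsum (1\<^sub>m ((m - Suc (Suc k) - 1) * n)) (dsum (1\<^sub>m (n + n)) (fiedler_word n a c k))"
    unfolding dsum_assoc dsum_one off ..
  show ?thesis unfolding s fiedler_Suc[OF assms] fiedler_step_def
    using assms word_dim[of k] ad[of "Suc (Suc k)"] by (simp add: mult_four_block_dim mat_trivial)
qed

lemma prod_upto:
  assumes "p < m"
  shows "FP [0..int p] = dsum (1\<^sub>m ((m - p - 1) * n)) (fiedler_word n a (\<lambda>_. False) p)"
  using assms
proof (induction p)
  case 0
  have "FP [0..int 0] = F 0" using prod_single[of 0] m by simp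
  thus ?case by (simp add: fiedler_zero)
next
  case (Suc p)
  have "[0..int (Suc p)] = [0..int p] @ [int (Suc p)]" using upto_rec2[of 0 "int (Suc p)"] by simp
  hence "FP [0..int (Suc p)] = FP [0..int p] * F (int (Suc p))"
    using Suc.prems prod_append[of "[0..int p]" "[int (Suc p)]"] prod_single[of "int (Suc p)"] by auto
  thus ?case using Suc embed_right[of p "\<lambda>_. False"] by simp
qed

lemma pairs_valid: "k < m \<Longrightarrow> valid (pairs k p)"
  unfolding pairs_def by auto

text \<open>In \<open>M\<^bsub>k+1\<^esub> M\<^bsub>k+2\<^esub> W\<close>, where \<open>W\<close> is a word in \<open>M\<^sub>0, \<dots>, M\<^sub>k\<close>, the second factor commutes with \<open>W\<close>, which
  brings the product into the form \<open>M\<^bsub>k+1\<^esub> W M\<^bsub>k+2\<^esub>\<close> of a Fiedler word.\<close>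

lemma prod_admissible:
  assumes "k < m" "admissible_tuple k p w"
  shows "FP w = dsum (1\<^sub>m ((m - k - 1) * n)) (fiedler_word n a (adm_side p) k)"
proof -
  have w: "p \<le> k" "even (k - p)" "w = pairs k p @ [0..int p]" using assms by (auto simp: admissible_pairs)
  have "k < m \<longrightarrow> FP (pairs k p @ [0..int p]) = dsum (1\<^sub>m ((m - k - 1) * n)) (fiedler_word n a (adm_side p) k)"
  proof (rule admissible_induct[OF w(1,2)])
    have "fiedler_word n a (\<lambda>_. False) p = fiedler_word n a (adm_side p) p"
      by (rule word_cong) (simp add: adm_side_def)
    thus "p < m \<longrightarrow> FP (pairs p p @ [0..int p]) = dsum (1\<^sub>m ((m - p - 1) * n)) (fiedler_word n a (adm_side p) p)"
      using prod_upto by (simp add: pairs_self)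
  next
    fix k assume k: "p \<le> k" "even (k - p)"
      and IH: "k < m \<longrightarrow> FP (pairs k p @ [0..int p]) = dsum (1\<^sub>m ((m - k - 1) * n)) (fiedler_word n a (adm_side p) k)"
    show "k + 2 < m \<longrightarrow> FP (pairs (k + 2) p @ [0..int p]) =
      dsum (1\<^sub>m ((m - (k + 2) - 1) * n)) (fiedler_word n a (adm_side p) (k + 2))"
    proof
      assume km: "k + 2 < m"
      let ?W = "dsum (1\<^sub>m ((m - k - 1) * n)) (fiedler_word n a (adm_side p) k)"
      have W: "FP (pairs k p @ [0..int p]) = ?W" using IH km by simp
      have v: "valid (pairs k p @ [0..int p])" using pairs_valid[of k p] k km by auto
      have "pairs (k + 2) p @ [0..int p] = int (Suc k) # int (Suc (Suc k)) # (pairs k p @ [0..int p])"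
        using pairs_rec[of p "k + 2"] k by simp
      hence "FP (pairs (k + 2) p @ [0..int p]) = F (int (Suc k)) * (F (int (Suc (Suc k))) * ?W)"
        by (simp only: prod_Cons W)
      also have "\<dots> = F (int (Suc k)) * (?W * F (int (Suc (Suc k))))"
        using embed_commute[of k] km by simp
      also have "\<dots> = (F (int (Suc k)) * ?W) * F (int (Suc (Suc k)))"
        using prod_dim[OF v] fiedler_dim[of "int (Suc k)"] fiedler_dim[of "int (Suc (Suc k))"] km
        unfolding W by (simp only: mult_assoc_dim)
      also have "adm_side p (Suc k)" "\<not> adm_side p (Suc (Suc k))"
        using k by (auto simp: adm_side_def Suc_diff_le)
      hence "(F (int (Suc k)) * ?W) * F (int (Suc (Suc k))) =
        dsum (1\<^sub>m ((m - Suc (Suc k) - 1) * n)) (fiedler_word n a (adm_side p) (Suc (Suc k)))"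
        using embed_left[of k "adm_side p"] embed_right[of "Suc k" "adm_side p"] km by simp
      finally show "FP (pairs (k + 2) p @ [0..int p]) =
        dsum (1\<^sub>m ((m - (k + 2) - 1) * n)) (fiedler_word n a (adm_side p) (k + 2))" by simp
    qed
  qed
  thus ?thesis using assms w by simp
qed

end

lemma rv_dsum: "rv (dsum A B) = dsum (rv B) (rv (A :: 'a::comm_ring_1 mat))"
  using rv_four_block[of "0\<^sub>m (dim_row A) (dim_col B)" A "0\<^sub>m (dim_row B) (dim_col A)" B]
  by (simp add: rv_zero)

context fiedler_coeffs
begin

definition rev_coeff :: "nat \<Rightarrow> cmat" where
  "rev_coeff j = - rv (a (m - j))"

lemma rev_coeffs: "fiedler_coeffs n m rev_coeff"
  by unfold_locales (use m ad in \<open>auto simp: rev_coeff_def intro!: carrier_matI\<close>)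

lemma fiedler_reverse:
  assumes "0 \<le> i" "i < int m"
  shows "F (i - int m) = rv (fiedler n m rev_coeff i)"
proof -
  interpret r: fiedler_coeffs n m rev_coeff by (rule rev_coeffs)
  have neg: "- (- X) = X" for X :: cmat by (rule eq_matI) auto
  show ?thesis
  proof (cases "i = 0")
    case True
    show ?thesis unfolding True r.fiedler_zero using fiedler_last
      by (simp only: rv_dsum) (simp add: rev_coeff_def rv_arith rv_rv neg rv_one)
  next
    case False
    define j where "j = nat i"
    have j: "i = int j" "1 \<le> j" "j < m" using False assms by (auto simp: j_def)
    have k: "i - int m = - int (m - j)" "1 \<le> m - j" "m - j < m" "m - (m - j) = j" using j by auto
    have d: "dim_row (a (m - j)) = n" "dim_col (a (m - j)) = n" using ad[of "m - j"] by auto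
    have "rv (four_block_mat (- rev_coeff j) (1\<^sub>m n) (1\<^sub>m n) (0\<^sub>m n n)) = four_block_mat (0\<^sub>m n n) (1\<^sub>m n) (1\<^sub>m n) (a (m - j))"
      by (subst rv_four_block) (simp_all add: rev_coeff_def rv_arith rv_rv neg rv_one rv_zero d)
    hence "rv (fiedler n m rev_coeff i) =
       dsum (dsum (1\<^sub>m ((j - 1) * n)) (four_block_mat (0\<^sub>m n n) (1\<^sub>m n) (1\<^sub>m n) (a (m - j)))) (1\<^sub>m ((m - j - 1) * n))"
      unfolding j(1) r.fiedler_pos[OF j(2,3)] fiedler_step_def by (simp only: rv_dsum rv_one)
    also have "\<dots> = dsum (1\<^sub>m ((m - (m - j) - 1) * n)) (dsum (four_block_mat (0\<^sub>m n n) (1\<^sub>m n) (1\<^sub>m n) (a (m - j))) (1\<^sub>m ((m - j - 1) * n)))"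
      unfolding dsum_assoc k(4) ..
    also have "\<dots> = F (i - int m)" unfolding k(1) fiedler_neg[OF k(2,3)] ..
    finally show ?thesis by simp
  qed
qed

text \<open>So every product with indices in \<open>{-m..-1}\<close> is the reversal of a product with indices in
  \<open>{0..m-1}\<close>, for the coefficients \<open>rev_coeff\<close>.\<close>

lemma prod_reverse:
  assumes "set t \<subseteq> {0..int m - 1}"
  shows "FP (shift t (- int m)) = rv (fiedler_prod n m rev_coeff t)"
  using assms
proof (induction t)
  case Nil
  show ?case by (simp add: shift_def fiedler_prod_def rv_one)
next
  case (Cons i t)
  interpret r: fiedler_coeffs n m rev_coeff by (rule rev_coeffs)
  have v: "r.valid t" by (rule subset_trans[of _ "{0..int m - 1}"]) (use Cons.prems in auto)
  have "rv (fiedler_prod n m rev_coeff (i # t)) = rv (fiedler n m rev_coeff i) * rv (fiedler_prod n m rev_coeff t)"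
    unfolding r.prod_Cons by (rule rv_mult) (use r.fiedler_dim[of i] r.prod_dim[OF v] Cons.prems in auto)
  thus ?case using Cons fiedler_reverse[of i] by (simp add: shift_def prod_Cons)
qed

end

section \<open>The pencil\<close>

interpretation const_hom: comm_ring_hom "\<lambda>c::complex. [:c:]"
  by unfold_locales auto

interpretation frac_hom: comm_ring_hom "to_fract :: complex poly \<Rightarrow> complex poly fract"
  by unfold_locales (auto simp: to_fract_def Zero_fract_def One_fract_def)

interpretation px: entry_ring "UNIV :: complex poly set"
  by unfold_locales auto

lemma const_mat_dim[simp]: "dim_row (const_mat X) = dim_row X" "dim_col (const_mat X) = dim_col X"
  by (simp_all add: const_mat_def)

lemma const_mat_mult: "dim_col A = dim_row B \<Longrightarrow> const_mat (A * B) = const_mat A * const_mat B"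
  unfolding const_mat_def by (rule const_hom.mat_hom_mult_dim)

lemma rat_mat_dim[simp]: "dim_row (rat_mat X) = dim_row X" "dim_col (rat_mat X) = dim_col X"
  by (simp_all add: rat_mat_def)

lemma rat_mat_mult: "dim_col A = dim_row B \<Longrightarrow> rat_mat (A * B) = rat_mat A * rat_mat B"
  unfolding rat_mat_def by (rule frac_hom.mat_hom_mult_dim)

lemma const_mat_ucol: "const_mat (ucol N p n) = ucol N p n"
  unfolding const_mat_def ucol_def by (rule eq_matI) (simp_all split: if_split)

lemma rat_mat_ucol: "rat_mat (ucol N p n) = ucol N p n"
  unfolding rat_mat_def ucol_def by (rule eq_matI) (simp_all split: if_split)

lemma const_mat_transpose: "const_mat (transpose_mat X) = transpose_mat (const_mat X)"
  unfolding const_mat_def by (rule eq_matI) simp_all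

lemma rat_mat_transpose: "rat_mat (transpose_mat X) = transpose_mat (rat_mat X)"
  unfolding rat_mat_def by (rule eq_matI) simp_all

lemma px_unit_const: "cx.S_unit N X \<Longrightarrow> px.S_unit N (const_mat X)"
proof -
  assume X: "cx.S_unit N X"
  then obtain Y where Y: "Y \<in> carrier_mat N N" "X * Y = 1\<^sub>m N" "Y * X = 1\<^sub>m N"
    by (auto simp: cx.S_unit_def)
  have d: "dim_row X = N" "dim_col X = N" using X by (simp_all add: cx.S_unit_dim)
  have "const_mat X * const_mat Y = const_mat (X * Y)" "const_mat Y * const_mat X = const_mat (Y * X)"
    using d Y(1) by (simp_all only: const_mat_mult carrier_matD)
  hence "const_mat X * const_mat Y = const_mat (1\<^sub>m N)" "const_mat Y * const_mat X = const_mat (1\<^sub>m N)"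
    using Y by simp_all
  moreover have "const_mat (1\<^sub>m N) = 1\<^sub>m N" unfolding const_mat_def by (rule const_hom.mat_hom_basic(1))
  ultimately show ?thesis using Y d
    by (intro px.S_unitI[of _ _ "const_mat Y"]) (auto simp: px.ent_def intro: carrier_matI)
qed

lemma unimodular_of_unit: "px.S_unit N U \<Longrightarrow> unimodular N U"
proof -
  assume U: "px.S_unit N U"
  then obtain V where V: "U \<in> carrier_mat N N" "V \<in> carrier_mat N N" "U * V = 1\<^sub>m N"
    by (auto simp: px.S_unit_def)
  have "det U * det V = 1" using det_mult[OF V(1,2)] V(3) by simp
  hence u: "is_unit (det U)" by (metis dvd_triv_left)
  then obtain c where c: "det U = [:c:]" "c dvd 1" unfolding is_unit_poly_iff by blast
  hence "c \<noteq> 0" by auto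
  with c(1) show ?thesis using V by (auto simp: unimodular_def)
qed

context fiedler_coeffs
begin

lemma port_col_bcol:
  fixes a' :: "nat \<Rightarrow> 'b::comm_ring_1 mat"
  assumes "h < m" and a': "\<And>i. i \<le> h \<Longrightarrow> a' i \<in> carrier_mat n n"
  shows "vcat0 ((m - h - 1) * n) (port_col n a' (adm_side 0) h) = ucol (m * n) ((m - min 1 h - 1) * n) n"
    "hcat0 ((m - h - 1) * n) (port_row n a' (adm_side 0) h) = transpose_mat (ucol (m * n) ((m - 1) * n) n)"
proof -
  obtain k where k: "m = Suc h + k" using assms by (metis Suc_leI le_iff_add)
  have p: "port_col n a' (adm_side 0) h = ucol (Suc h * n) ((h - min 1 h) * n) n"
    "port_row n a' (adm_side 0) h = transpose_mat (ucol (Suc h * n) (h * n) n)"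
    using simple_ports[of h a' n] a' by auto
  have e: "k * n + Suc h * n = m * n" "k * n + (h - min 1 h) * n = (m - min 1 h - 1) * n"
     "k * n + h * n = (m - 1) * n" "m - h - 1 = k"
    unfolding k by (simp_all add: algebra_simps)
  show "vcat0 ((m - h - 1) * n) (port_col n a' (adm_side 0) h) = ucol (m * n) ((m - min 1 h - 1) * n) n"
    "hcat0 ((m - h - 1) * n) (port_row n a' (adm_side 0) h) = transpose_mat (ucol (m * n) ((m - 1) * n) n)"
    unfolding p vcat0_ucol hcat0_urow e by simp_all
qed

text \<open>The outer factors collected from the four tuples are units and move the ports of \<open>M\<^sub>w\<close> to the block
  \<open>\<alpha>\<close>.\<close>

lemma pencil_structure:
  assumes h: "h < m" "even h" and k: "k = m - h - 1"
    and w: "w = pairs h 0 @ [0]" "c\<^sub>w = sym_compl h 0"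
    and z: "admissible_tuple k p (shift z (int m))" "shift c\<^sub>z (int m) = sym_compl k p"
    and tw: "type1_right_index_tuple h (rev w) t\<^sub>w"
    and tz: "type1_right_index_tuple k (rev (shift z (int m))) (shift t\<^sub>z (int m))"
    and \<alpha>: "\<alpha> = c0 (w @ c\<^sub>w @ t\<^sub>w)"
    and sing0: "\<not> invertible_mat (a 0) \<Longrightarrow> 0 \<notin> set t\<^sub>w"
    and singm: "\<not> invertible_mat (a m) \<Longrightarrow> - int m \<notin> set t\<^sub>z"
    and ind: "\<not> invertible_mat (a m) \<Longrightarrow> p = 0"
  shows "\<alpha> < m \<and> (\<exists>X Y. cx.S_unit (m * n) X \<and> cx.S_unit (m * n) Y \<and>
    X * bcol (min 1 h) = bcol \<alpha> \<and> brow 0 * Y = brow \<alpha> \<and>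
    fiedler_pencil n m a w c\<^sub>w t\<^sub>w z c\<^sub>z t\<^sub>z =
      const_mat X *
      (lam \<cdot>\<^sub>m const_mat (dsum (rv (fiedler_word n rev_coeff (adm_side p) k)) (1\<^sub>m (h * n)))
        - const_mat (dsum (1\<^sub>m (k * n)) (fiedler_word n a (adm_side 0) h))) * const_mat Y)"
proof -
  interpret r: fiedler_coeffs n m rev_coeff by (rule rev_coeffs)
  have km: "k < m" "m - k - 1 = h" using h k by auto
  have zk: "p \<le> k" "even (k - p)" using z(1) by (auto simp: admissible_tuple_def)
  have unshift: "t = shift (shift t (int m)) (- int m)" for t by (simp add: shift_def o_def)
  have in_shift: "i + int m \<in> set (shift t (int m)) \<longleftrightarrow> i \<in> set t" for i t by (auto simp: shift_def)
  \<comment> \<open>The indices in \<open>t\<^sub>w\<close>, \<open>c\<^sub>w\<close> are below \<open>h\<close>, while those in \<open>t\<^sub>z\<close>, \<open>c\<^sub>z\<close> have modulus at least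
    \<open>h + 2\<close>. Hence the latter act on blocks that the walk, which stays at \<open>d \<le> h\<close>, never reaches.\<close>
  have rtw: "set t\<^sub>w \<subseteq> {0..int h - 1}" by (rule type1_range[OF tw])
  have rcw: "set c\<^sub>w \<subseteq> {1..int h - 1}" using simple_compl_walk(3)[OF h(2)] by (simp add: w)
  have rtz: "- int m \<le> i \<and> i \<le> - int h - 2" if "i \<in> set t\<^sub>z" for i
    using type1_range[OF tz] that km in_shift[of i t\<^sub>z] k by (fastforce simp: subset_eq)
  have rcz: "- int m \<le> i \<and> i \<le> - int h - 2" if "i \<in> set c\<^sub>z" for i
  proof -
    have "i + int m \<in> set (sym_compl k p)" using that in_shift z(2) by metis
    thus ?thesis using sym_compl_range(1)[OF zk] k h by fastforce
  qed
  have rz: "set (shift z (int m)) \<subseteq> {0..int m - 1}"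
    using z(1) km unfolding admissible_pairs pairs_def by auto
  have vtw: "valid t\<^sub>w" "valid (rev t\<^sub>w)" using rtw h by auto
  have vcw: "valid c\<^sub>w" using rcw h by auto
  have vtz: "valid t\<^sub>z" "valid (rev t\<^sub>z)" using rtz by force+
  have vcz: "valid c\<^sub>z" using rcz by force
  have vz: "valid z"
  proof
    fix i assume "i \<in> set z"
    hence "i + int m \<in> {0..int m - 1}" using rz in_shift by blast
    thus "i \<in> {- int m..int m - 1}" by auto
  qed
  have Mw: "FP w = dsum (1\<^sub>m (k * n)) (fiedler_word n a (adm_side 0) h)"
  proof -
    have "admissible_tuple h 0 w" using h by (simp add: admissible_pairs w)
    thus ?thesis using prod_admissible[OF h(1)] k by simp
  qed
  have Mz: "FP z = dsum (rv (fiedler_word n rev_coeff (adm_side p) k)) (1\<^sub>m (h * n))"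
  proof -
    have "FP z = rv (fiedler_prod n m rev_coeff (shift z (int m)))"
      using prod_reverse[OF rz] unshift[of z] by simp
    thus ?thesis using r.prod_admissible[OF km(1) z(1)] km(2) by (simp only: rv_dsum rv_one)
  qed
  \<comment> \<open>Only \<open>M\<^sub>0\<close> and \<open>M\<^bsub>-m\<^esub>\<close> can be singular. \<open>c\<^sub>w\<close> has positive indices only, and
    \<open>c\<^sub>z\<close> contains \<open>-m\<close> only if the index \<open>p\<close> is positive.\<close>
  have z0: "- int m \<in> set c\<^sub>z \<Longrightarrow> invertible_mat (a m)"
    using sym_compl_range(2)[OF zk] ind in_shift[of "- int m" c\<^sub>z] z(2) by auto
  have inv0: "0 \<in> set t\<^sub>w \<Longrightarrow> invertible_mat (a 0)" and invm: "- int m \<in> set t\<^sub>z \<Longrightarrow> invertible_mat (a m)"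
    using sing0 singm by blast+
  have utw: "cx.S_unit (m * n) (FP t\<^sub>w)" "cx.S_unit (m * n) (FP (rev t\<^sub>w))"
    using rtw h inv0 vtw by (auto intro!: prod_unit)
  have ucw: "cx.S_unit (m * n) (FP c\<^sub>w)" using rcw vcw m by (auto intro!: prod_unit)
  have utz: "cx.S_unit (m * n) (FP t\<^sub>z)" "cx.S_unit (m * n) (FP (rev t\<^sub>z))"
    using rtz vtz invm by (auto intro!: prod_unit) fastforce+
  have ucz: "cx.S_unit (m * n) (FP c\<^sub>z)"
    using rcz vcz z0 by (auto intro!: prod_unit) fastforce+
  note units = utw ucw utz ucz
  have d: "dim_row (FP t) = m * n" "dim_col (FP t) = m * n" if "valid t" for t
    using prod_dim[OF that] by auto
  note ds = d[OF vtw(1)] d[OF vtw(2)] d[OF vcw] d[OF vtz(1)] d[OF vtz(2)] d[OF vcz] d[OF vz]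
  have vw: "valid w" using h pairs_valid[of h 0] m by (auto simp: w)
  note ds = ds d[OF vw]
  define X where "X = FP (rev t\<^sub>z) * FP (rev t\<^sub>w)"
  define Y where "Y = FP c\<^sub>w * (FP t\<^sub>w * (FP c\<^sub>z * FP t\<^sub>z))"
  have uX: "cx.S_unit (m * n) X" "cx.S_unit (m * n) Y"
    unfolding X_def Y_def using units by (auto intro!: cx.S_unit_mult)
  have pencil: "fiedler_pencil n m a w c\<^sub>w t\<^sub>w z c\<^sub>z t\<^sub>z =
      const_mat X * (lam \<cdot>\<^sub>m const_mat (FP z) - const_mat (FP w)) * const_mat Y"
    unfolding fiedler_pencil_def Let_def X_def Y_def
    by (simp add: const_mat_mult mult_assoc_dim ds)
  \<comment> \<open>The walk through \<open>w, c\<^sub>w\<close> ends at \<open>d\<^sub>0 = min 1 h\<close>, which is where the column port of \<open>M\<^sub>w\<close> sits and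
    also a string end; \<open>t\<^sub>w\<close> continues it to \<open>\<alpha>\<close>. For the row port the part through \<open>c\<^sub>w\<close>
    starts at \<open>0\<close>.\<close>
  define d0 where "d0 = min 1 h"
  have d0: "d0 < m" "d0 \<le> h" using h by (auto simp: d0_def)
  obtain ra where ra: "col_ends h ra" "int d0 \<in> set ra" "comm_swap\<^sup>*\<^sup>* (rev w) (concat (strs ra))"
    using simple_csf[OF h(2)] unfolding d0_def w by auto
  have av: "avoids (int d0) t\<^sub>w" by (rule type1_avoids[OF ra(1,3,2) tw])
  have tr: "track (-1) (w @ c\<^sub>w) = int d0"
    using simple_track[OF h(2)] by (simp add: w d0_def)
  have al: "int \<alpha> = track (int d0) t\<^sub>w"
  proof -
    have "track (-1) (w @ c\<^sub>w @ t\<^sub>w) = track (int d0) t\<^sub>w"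
      using tr track_append[of "-1" "w @ c\<^sub>w" t\<^sub>w] by simp
    moreover have "0 \<le> track (int d0) t\<^sub>w" using track_mono[of "int d0" t\<^sub>w] by simp
    ultimately show ?thesis unfolding \<alpha> using c0_track by simp
  qed
  have rt: "set t\<^sub>w \<subseteq> {0..int m - 1}" using rtw h by auto
  have walk: "FP (rev t\<^sub>w) * bcol d0 = bcol \<alpha>" "brow d0 * FP t\<^sub>w = brow \<alpha>" "\<alpha> < m"
    using prod_walk[OF av d0(1) rt] unfolding al[symmetric] by auto
  have rc: "set c\<^sub>w \<subseteq> {0..int m - 1}" using rcw h by auto
  have cw: "brow 0 * FP c\<^sub>w = brow d0"
    using prod_walk[of 0 c\<^sub>w] simple_compl_walk[OF h(2)] rc m by (auto simp: w d0_def)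
  have bound: "track c t \<le> max c (int h)" if "set t \<subseteq> {0..int h - 1}" for c t
    using that
  proof (induction t arbitrary: c)
    case (Cons s t)
    show ?case using Cons.IH[of c] Cons.IH[of "c + 1"] Cons.prems by (cases "s = c + 1") auto
  qed simp
  have ah: "\<alpha> \<le> h" using bound[OF rtw, of "int d0"] al d0 by simp
  have fixz: "FP t * bcol \<alpha> = bcol \<alpha> \<and> brow \<alpha> * FP t = brow \<alpha>"
    if "valid t" "\<forall>i\<in>set t. - int m \<le> i \<and> i \<le> - int h - 2" for t
    by (rule prod_fixes[OF walk(3) that(1)]) (use that(2) ah in fastforce)
  have ftz: "FP (rev t\<^sub>z) * bcol \<alpha> = bcol \<alpha>" "brow \<alpha> * FP t\<^sub>z = brow \<alpha>" "brow \<alpha> * FP c\<^sub>z = brow \<alpha>"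
    using fixz[OF vtz(2)] fixz[OF vtz(1)] fixz[OF vcz] rtz rcz by auto
  have "X * bcol d0 = FP (rev t\<^sub>z) * (FP (rev t\<^sub>w) * bcol d0)"
    unfolding X_def by (simp add: mult_assoc_dim ds)
  hence 1: "X * bcol d0 = bcol \<alpha>" using walk ftz by simp
  have "brow 0 * Y = (((brow 0 * FP c\<^sub>w) * FP t\<^sub>w) * FP c\<^sub>z) * FP t\<^sub>z"
    unfolding Y_def by (simp add: mult_assoc_dim ds)
  hence 2: "brow 0 * Y = brow \<alpha>" using walk ftz cw by simp
  show ?thesis using walk(3) uX 1 2 pencil unfolding d0_def[symmetric] Mw Mz by blast
qed

lemma poly_coeffs: "fiedler_word n (\<lambda>i. const_mat (a i)) c k = const_mat (fiedler_word n a c k)"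
  if "k < m"
  using const_hom.fiedler_word_hom[of k a n c] a that unfolding const_mat_def by auto

lemma power_sum_matrix_poly: "power_sum n m lam (\<lambda>i. const_mat (a i)) = matrix_poly n m a"
proof (rule eq_matI, goal_cases)
  case (1 i j)
  hence ij: "i < n" "j < n" by (auto simp: matrix_poly_def)
  have "lam ^ q * const_mat (a q) $$ (i, j) = monom (a q $$ (i, j)) q" if "q \<le> m" for q
    using that ij ad[of q] by (simp add: const_mat_def monom_altdef)
  thus ?case using ij by (simp add: power_sum_def matrix_poly_def)
qed (auto simp: power_sum_def matrix_poly_def)

lemma last_port: "vcat0 ((m - 1) * n) (1\<^sub>m n) = ucol (m * n) ((m - 1) * n) n"
  "hcat0 ((m - 1) * n) (1\<^sub>m n) = (transpose_mat (ucol (m * n) ((m - 1) * n) n) :: 'b::comm_ring_1 mat)"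
  using vcat0_ucol[of "(m - 1) * n" n 0 n] hcat0_urow[of "(m - 1) * n" n 0 n] block_size1
  by (simp_all add: ucol_0 transpose_one_zero)

lemma pencil_poly_eqv:
  assumes h: "h < m" and k: "k = m - h - 1"
  shows "px.port_eqv (m * n)
    (lam \<cdot>\<^sub>m const_mat (dsum (rv (fiedler_word n rev_coeff c2 k)) (1\<^sub>m (h * n)))
        - const_mat (dsum (1\<^sub>m (k * n)) (fiedler_word n a (adm_side 0) h)))
    (ucol (m * n) ((m - min 1 h - 1) * n) n) (transpose_mat (ucol (m * n) ((m - 1) * n) n))
    (dsum (1\<^sub>m ((m - 1) * n)) (matrix_poly n m a))
    (ucol (m * n) ((m - 1) * n) n) (transpose_mat (ucol (m * n) ((m - 1) * n) n))"
proof -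
  interpret r: fiedler_coeffs n m rev_coeff by (rule rev_coeffs)
  have km: "k < m" using h k by auto
  have b: "(\<lambda>i. const_mat (rev_coeff i)) = (\<lambda>j. - rv (const_mat (a (m - j))))"
    unfolding rev_coeff_def const_mat_def by (simp add: const_hom.mat_hom_basic const_hom.rv_hom)
  have ac: "const_mat (a i) \<in> carrier_mat n n" if "i \<le> m" for i using ad[OF that] by (auto intro: carrier_matI)
  have P: "px.port_eqv (m * n)
    (lam \<cdot>\<^sub>m dsum (rv (fiedler_word n (\<lambda>i. const_mat (rev_coeff i)) c2 k)) (1\<^sub>m (h * n))
        - dsum (1\<^sub>m (k * n)) (fiedler_word n (\<lambda>i. const_mat (a i)) (adm_side 0) h))
    (vcat0 (k * n) (port_col n (\<lambda>i. const_mat (a i)) (adm_side 0) h))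
    (hcat0 (k * n) (port_row n (\<lambda>i. const_mat (a i)) (adm_side 0) h))
    (dsum (1\<^sub>m ((m - 1) * n)) (power_sum n m lam (\<lambda>i. const_mat (a i))))
    (vcat0 ((m - 1) * n) (1\<^sub>m n)) (hcat0 ((m - 1) * n) (1\<^sub>m n))"
    by (rule px.generalized_fiedler_eqv[OF h _ ac _ k b]) (simp_all add: px.ent_def)
  have e1: "const_mat (dsum (rv (fiedler_word n rev_coeff c2 k)) (1\<^sub>m (h * n))) =
      dsum (rv (fiedler_word n (\<lambda>i. const_mat (rev_coeff i)) c2 k)) (1\<^sub>m (h * n))"
    unfolding r.poly_coeffs[OF km]
    by (simp add: const_mat_def const_hom.mat_hom_four_block const_hom.mat_hom_basic const_hom.rv_hom)
  have e2: "const_mat (dsum (1\<^sub>m (k * n)) (fiedler_word n a (adm_side 0) h)) =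
      dsum (1\<^sub>m (k * n)) (fiedler_word n (\<lambda>i. const_mat (a i)) (adm_side 0) h)"
    unfolding poly_coeffs[OF h]
    by (simp add: const_mat_def const_hom.mat_hom_four_block const_hom.mat_hom_basic)
  have e3: "vcat0 (k * n) (port_col n (\<lambda>i. const_mat (a i)) (adm_side 0) h) = ucol (m * n) ((m - min 1 h - 1) * n) n"
    "hcat0 (k * n) (port_row n (\<lambda>i. const_mat (a i)) (adm_side 0) h) = transpose_mat (ucol (m * n) ((m - 1) * n) n)"
    unfolding k using h ac by (intro port_col_bcol; simp)+
  show ?thesis using P unfolding e1 e2 e3 last_port power_sum_matrix_poly .
qed

end

section \<open>Proper rational functions\<close>

lemma complex_poly_eventually_nonzero:
  fixes p :: "complex poly"
  assumes "p \<noteq> 0" shows "eventually (\<lambda>x. poly p x \<noteq> 0) at_infinity"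
proof (rule eventually_at_infinityI[of "Max (norm ` {x. poly p x = 0}) + 1"])
  fix x :: complex assume x: "Max (norm ` {x. poly p x = 0}) + 1 \<le> norm x"
  have "norm x \<le> Max (norm ` {x. poly p x = 0})" if "poly p x = 0"
    using poly_roots_finite[OF assms] that by (intro Max_ge) auto
  thus "poly p x \<noteq> 0" using x by linarith
qed

lemma tendsto_at_infinity_const: "tendsto_at_infinity (to_fract [:c:]) c"
  unfolding tendsto_at_infinity_def to_fract_def
  by (intro exI[of _ "[:c:]"] exI[of _ 1]) auto

lemma tendsto_at_infinity_add:
  assumes "tendsto_at_infinity f c" "tendsto_at_infinity g d"
  shows "tendsto_at_infinity (f + g) (c + d)"
proof -
  obtain p q p' q' where 1: "q \<noteq> 0" "f = Fract p q" "((\<lambda>x. poly p x / poly q x) \<longlongrightarrow> c) at_infinity"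
    and 2: "q' \<noteq> 0" "g = Fract p' q'" "((\<lambda>x. poly p' x / poly q' x) \<longlongrightarrow> d) at_infinity"
    using assms unfolding tendsto_at_infinity_def by blast
  have "eventually (\<lambda>x. poly p x / poly q x + poly p' x / poly q' x =
      poly (p * q' + p' * q) x / poly (q * q') x) at_infinity"
    using complex_poly_eventually_nonzero[OF 1(1)] complex_poly_eventually_nonzero[OF 2(1)]
    by eventually_elim (simp add: field_simps)
  hence "((\<lambda>x. poly (p * q' + p' * q) x / poly (q * q') x) \<longlongrightarrow> c + d) at_infinity"
    by (rule Lim_transform_eventually[OF tendsto_add[OF 1(3) 2(3)]])
  moreover have "f + g = Fract (p * q' + p' * q) (q * q')" using 1 2 by simp
  moreover have "q * q' \<noteq> 0" using 1 2 by simp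
  ultimately show ?thesis unfolding tendsto_at_infinity_def by blast
qed

lemma tendsto_at_infinity_mult:
  assumes "tendsto_at_infinity f c" "tendsto_at_infinity g d"
  shows "tendsto_at_infinity (f * g) (c * d)"
proof -
  obtain p q p' q' where 1: "q \<noteq> 0" "f = Fract p q" "((\<lambda>x. poly p x / poly q x) \<longlongrightarrow> c) at_infinity"
    and 2: "q' \<noteq> 0" "g = Fract p' q'" "((\<lambda>x. poly p' x / poly q' x) \<longlongrightarrow> d) at_infinity"
    using assms unfolding tendsto_at_infinity_def by blast
  have "((\<lambda>x. poly (p * p') x / poly (q * q') x) \<longlongrightarrow> c * d) at_infinity"
    using tendsto_mult[OF 1(3) 2(3)] by simp
  moreover have "f * g = Fract (p * p') (q * q')" using 1 2 by simp
  moreover have "q * q' \<noteq> 0" using 1 2 by simp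
  ultimately show ?thesis unfolding tendsto_at_infinity_def by blast
qed

lemma tendsto_at_infinity_unique:
  assumes "tendsto_at_infinity f c" "tendsto_at_infinity f d"
  shows "c = d"
proof -
  obtain p q p' q' where 1: "q \<noteq> 0" "f = Fract p q" "((\<lambda>x. poly p x / poly q x) \<longlongrightarrow> c) at_infinity"
    and 2: "q' \<noteq> 0" "f = Fract p' q'" "((\<lambda>x. poly p' x / poly q' x) \<longlongrightarrow> d) at_infinity"
    using assms unfolding tendsto_at_infinity_def by blast
  have "p * q' = p' * q" using 1 2 by (simp add: eq_fract)
  hence e: "poly p x * poly q' x = poly p' x * poly q x" for x by (metis poly_mult)
  have "eventually (\<lambda>x. poly p' x / poly q' x = poly p x / poly q x) at_infinity"
    using complex_poly_eventually_nonzero[OF 1(1)] complex_poly_eventually_nonzero[OF 2(1)]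
    by eventually_elim (use e in \<open>simp add: field_simps\<close>)
  hence "((\<lambda>x. poly p x / poly q x) \<longlongrightarrow> d) at_infinity"
    by (rule Lim_transform_eventually[OF 2(3)])
  moreover have "(at_infinity :: complex filter) \<noteq> bot"
  proof
    assume "(at_infinity :: complex filter) = bot"
    hence "eventually (\<lambda>x::complex. False) at_infinity" by simp
    then obtain b where "\<forall>x::complex. b \<le> norm x \<longrightarrow> False" unfolding eventually_at_infinity by blast
    thus False using spec[of _ "complex_of_real \<bar>b\<bar>"] by (metis abs_ge_self abs_idempotent norm_of_real)
  qed
  ultimately show ?thesis using 1(3) tendsto_unique by blast
qed

lemma tendsto_at_infinity_strictly_proper:
  assumes "degree p < degree q" shows "tendsto_at_infinity (Fract p q) 0"
  unfolding tendsto_at_infinity_def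
  by (intro exI[of _ p] exI[of _ q]) (use assms poly_divide_tendsto_0_at_infinity[OF assms] in auto)

lemma tendsto_at_infinity_inverse_lam: "tendsto_at_infinity (inverse (to_fract lam)) 0"
  using tendsto_at_infinity_strictly_proper[of 1 lam] by (simp add: to_fract_def)

lemma tendsto_at_infinity_0: "tendsto_at_infinity 0 0" and tendsto_at_infinity_1: "tendsto_at_infinity 1 1"
  using tendsto_at_infinity_const[of 0] tendsto_at_infinity_const[of 1]
    by (simp_all add: frac_hom.hom_zero frac_hom.hom_one)

lemma tendsto_at_infinity_minus:
  assumes "tendsto_at_infinity f c" shows "tendsto_at_infinity (- f) (- c)"
proof -
  obtain p q where 1: "q \<noteq> 0" "f = Fract p q" "((\<lambda>x. poly p x / poly q x) \<longlongrightarrow> c) at_infinity"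
    using assms unfolding tendsto_at_infinity_def by blast
  have "((\<lambda>x. poly (- p) x / poly q x) \<longlongrightarrow> - c) at_infinity" using tendsto_minus[OF 1(3)] by simp
  moreover have "- f = Fract (- p) q" using 1 by simp
  ultimately show ?thesis unfolding tendsto_at_infinity_def using 1(1) by blast
qed

lemma tendsto_at_infinity_sum:
  "(\<And>i. i \<in> I \<Longrightarrow> tendsto_at_infinity (f i) (c i)) \<Longrightarrow> tendsto_at_infinity (sum f I) (sum c I)"
  by (induction I rule: infinite_finite_induct)
     (auto intro: tendsto_at_infinity_0 tendsto_at_infinity_add)

interpretation pr: entry_ring "{f. \<exists>c. tendsto_at_infinity f c}"
  by unfold_locales
     (auto intro: tendsto_at_infinity_0 tendsto_at_infinity_1 tendsto_at_infinity_add
        tendsto_at_infinity_mult tendsto_at_infinity_minus)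

text \<open>On proper functions the limit at infinity is a ring homomorphism to the complex numbers; so the
  limit of the inverse is an inverse of the limit.\<close>

lemma biproper_of_unit: "pr.S_unit N U \<Longrightarrow> biproper N U"
proof -
  assume "pr.S_unit N U"
  then obtain V where U: "U \<in> carrier_mat N N" "pr.ent U" and V: "V \<in> carrier_mat N N" "pr.ent V"
    and UV: "U * V = 1\<^sub>m N" "V * U = 1\<^sub>m N" by (auto simp: pr.S_unit_def)
  define lim where "lim X = mat N N (\<lambda>ij. SOME c. tendsto_at_infinity (X $$ ij) c)" for X :: rmat
  have lim: "tendsto_at_infinity (X $$ (i, j)) (lim X $$ (i, j))"
    if "X \<in> carrier_mat N N" "pr.ent X" "i < N" "j < N" for X i j
  proof -
    have "\<exists>c. tendsto_at_infinity (X $$ (i, j)) c" using that by (auto simp: pr.ent_def)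
    hence "tendsto_at_infinity (X $$ (i, j)) (SOME c. tendsto_at_infinity (X $$ (i, j)) c)" by (rule someI_ex)
    thus ?thesis using that by (simp add: lim_def)
  qed
  have limc: "lim X \<in> carrier_mat N N" for X by (simp add: lim_def)
  have prod: "lim X * lim Y = 1\<^sub>m N"
    if "X \<in> carrier_mat N N" "pr.ent X" "Y \<in> carrier_mat N N" "pr.ent Y" "X * Y = 1\<^sub>m N" for X Y
  proof (rule eq_matI)
    fix i j assume "i < dim_row (1\<^sub>m N)" "j < dim_col (1\<^sub>m N)"
    hence ij: "i < N" "j < N" by auto
    have "tendsto_at_infinity (\<Sum>k = 0..<N. X $$ (i, k) * Y $$ (k, j)) (\<Sum>k = 0..<N. lim X $$ (i, k) * lim Y $$ (k, j))"
      by (intro tendsto_at_infinity_sum tendsto_at_infinity_mult lim that) (use ij in auto)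
    moreover have "(\<Sum>k = 0..<N. X $$ (i, k) * Y $$ (k, j)) = (X * Y) $$ (i, j)"
      using that(1,3) ij by (simp add: scalar_prod_def)
    moreover have "(\<Sum>k = 0..<N. lim X $$ (i, k) * lim Y $$ (k, j)) = (lim X * lim Y) $$ (i, j)"
      using carrier_matD[OF limc] ij by (simp add: scalar_prod_def)
    ultimately have "tendsto_at_infinity (1\<^sub>m N $$ (i, j)) ((lim X * lim Y) $$ (i, j))"
      using that(5) by simp
    moreover have "tendsto_at_infinity (1\<^sub>m N $$ (i, j)) (1\<^sub>m N $$ (i, j))"
      using ij by (simp add: tendsto_at_infinity_0 tendsto_at_infinity_1)
    ultimately show "(lim X * lim Y) $$ (i, j) = 1\<^sub>m N $$ (i, j)" by (rule tendsto_at_infinity_unique)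
  qed (simp_all add: lim_def)
  have "invertible_mat (lim U)"
    unfolding invertible_mat_def inverts_mat_def
    using prod[OF U V UV(1)] prod[OF V U UV(2)] carrier_matD[OF limc] by (intro conjI exI[of _ "lim V"]) simp_all
  thus ?thesis unfolding biproper_def using U limc[of U] lim[OF U] by blast
qed

abbreviation rconst :: "cmat \<Rightarrow> rmat" where
  "rconst X \<equiv> rat_mat (const_mat X)"

interpretation rc_hom: comm_ring_hom "\<lambda>c::complex. to_fract [:c:]"
  by unfold_locales (auto simp: frac_hom.hom_add[symmetric] frac_hom.hom_mult[symmetric])

lemma rconst_conv: "rconst X = map_mat (\<lambda>c. to_fract [:c:]) X"
  unfolding rat_mat_def const_mat_def by (rule eq_matI) auto

lemma rconst_ent: "pr.ent (rconst X)"
  unfolding rconst_conv pr.ent_def using tendsto_at_infinity_const by auto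

lemma pr_unit_const: "cx.S_unit N X \<Longrightarrow> pr.S_unit N (rconst X)"
proof -
  assume X: "cx.S_unit N X"
  then obtain Y where Y: "Y \<in> carrier_mat N N" "X * Y = 1\<^sub>m N" "Y * X = 1\<^sub>m N"
    by (auto simp: cx.S_unit_def)
  have d: "dim_row X = N" "dim_col X = N" using X by (simp_all add: cx.S_unit_dim)
  have "rconst X * rconst Y = rconst (X * Y)" "rconst Y * rconst X = rconst (Y * X)"
    using d carrier_matD[OF Y(1)] by (simp_all only: const_mat_mult rat_mat_mult const_mat_dim)
  hence "rconst X * rconst Y = rconst (1\<^sub>m N)" "rconst Y * rconst X = rconst (1\<^sub>m N)"
    using Y by simp_all
  moreover have "rconst (1\<^sub>m N) = 1\<^sub>m N" unfolding rconst_conv by (rule rc_hom.mat_hom_basic(1))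
  ultimately show ?thesis using carrier_matD[OF Y(1)] d
    by (intro pr.S_unitI[of _ _ "rconst Y"] rconst_ent carrier_matI) simp_all
qed

section \<open>The resolvent\<close>

lemma state_pencil_char_poly: "A \<in> carrier_mat r r \<Longrightarrow> state_pencil r A = char_poly_matrix A"
  unfolding state_pencil_def char_poly_matrix_def const_mat_def by (intro eq_matI) auto

text \<open>The characteristic polynomial is monic of degree \<open>r\<close>, so the pencil is invertible over the rational
  functions. By the adjugate formula the entries of the inverse have numerators of degree below \<open>r\<close>.\<close>

lemma resolvent:
  assumes A: "A \<in> carrier_mat r r"
  defines "R \<equiv> rat_inverse (rat_mat (state_pencil r A))"
  shows "R \<in> carrier_mat r r" "R * rat_mat (state_pencil r A) = 1\<^sub>m r" "rat_mat (state_pencil r A) * R = 1\<^sub>m r"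
    and "pr.ent R"
proof -
  define D where "D = state_pencil r A"
  have D: "D \<in> carrier_mat r r" using A unfolding D_def state_pencil_def const_mat_def by auto
  have dD: "degree (det D) = r" "monic (det D)"
    using degree_monic_char_poly[OF A] unfolding D_def state_pencil_char_poly[OF A] char_poly_def by auto
  hence det0: "det D \<noteq> 0" by auto
  have rD: "rat_mat D \<in> carrier_mat r r" using D by (simp add: rat_mat_def)
  have detr: "det (rat_mat D) = to_fract (det D)" unfolding rat_mat_def by (rule frac_hom.hom_det)
  have "det (rat_mat D) \<noteq> 0" using det0 unfolding detr by (simp add: to_fract_eq_0_iff)
  hence "rat_mat D \<in> Units (ring_mat TYPE(complex poly fract) r ())"
    by (rule det_non_zero_imp_unit[OF rD])
  then obtain B where B: "mat_inverse (rat_mat D) = Some B"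
    using mat_inverse(1)[OF rD, of "()"] by (cases "mat_inverse (rat_mat D)") auto
  have R: "R = B" unfolding R_def D_def[symmetric] rat_inverse_def B by simp
  show Rc: "R \<in> carrier_mat r r" and R1: "R * rat_mat (state_pencil r A) = 1\<^sub>m r"
    and "rat_mat (state_pencil r A) * R = 1\<^sub>m r"
    using mat_inverse(2)[OF rD B] unfolding R D_def[symmetric] by auto
  define N where "N = adj_mat D"
  have N: "N \<in> carrier_mat r r" "D * N = det D \<cdot>\<^sub>m 1\<^sub>m r" using adj_mat[OF D] by (auto simp: N_def)
  have "R * (rat_mat D * rat_mat N) = R * rat_mat (D * N)" by (subst rat_mat_mult) (use carrier_matD[OF D] carrier_matD[OF N(1)] in simp_all)
  also have "\<dots> = R * (to_fract (det D) \<cdot>\<^sub>m 1\<^sub>m r)"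
    unfolding N(2) rat_mat_def by (simp add: frac_hom.mat_hom_basic)
  also have "\<dots> = to_fract (det D) \<cdot>\<^sub>m R" using Rc by (simp add: smult_mult_dim mat_trivial)
  finally have "to_fract (det D) \<cdot>\<^sub>m R = (R * rat_mat D) * rat_mat N"
    using carrier_matD[OF Rc] carrier_matD[OF rD] carrier_matD[OF N(1)] by (simp add: mult_assoc_dim)
  hence RN: "to_fract (det D) \<cdot>\<^sub>m R = rat_mat N" using R1 N(1) by (simp add: D_def[symmetric] mat_trivial)
  show "pr.ent R"
    unfolding pr.ent_def
  proof (intro allI impI)
    fix i j assume "i < dim_row R" "j < dim_col R"
    hence ij: "i < r" "j < r" using Rc by auto
    have "to_fract (det D) * R $$ (i, j) = to_fract (N $$ (i, j))"
      using arg_cong[OF RN, of "\<lambda>X. X $$ (i, j)"] ij Rc N(1) by (simp add: rat_mat_def)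
    hence "R $$ (i, j) = to_fract (N $$ (i, j)) / to_fract (det D)"
      using det0 by (simp add: to_fract_eq_0_iff field_simps)
    hence Rij: "R $$ (i, j) = Fract (N $$ (i, j)) (det D)" by (simp add: to_fract_def)
    have "degree (det (mat_delete D j i)) \<le> 1 * (r - 1)"
    proof (rule degree_det_le)
      show "mat_delete D j i \<in> carrier_mat (r - 1) (r - 1)" using mat_delete_carrier[OF D] .
      fix u v assume uv: "u < r - 1" "v < r - 1"
      define u' where "u' = (if u < j then u else Suc u)"
      define v' where "v' = (if v < i then v else Suc v)"
      have "mat_delete D j i $$ (u, v) = D $$ (u', v')" "u' < r" "v' < r"
        using uv carrier_matD[OF D] by (simp_all add: mat_delete_def u'_def v'_def less_diff_conv)
      thus "degree (mat_delete D j i $$ (u, v)) \<le> 1"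
        using A by (simp add: D_def state_pencil_def const_mat_def)
    qed
    moreover have "degree (N $$ (i, j)) \<le> degree (det (mat_delete D j i))"
    proof -
      have "N $$ (i, j) = (-1) ^ (j + i) * det (mat_delete D j i)"
        using D ij by (simp add: N_def adj_mat_def cofactor_def)
      thus ?thesis by (cases "even (j + i)") simp_all
    qed
    ultimately have "degree (N $$ (i, j)) < degree (det D)" using dD(1) ij by simp
    thus "R $$ (i, j) \<in> {f. \<exists>c. tendsto_at_infinity f c}"
      unfolding Rij using tendsto_at_infinity_strictly_proper by blast
  qed
qed

section \<open>Equivalence at infinity\<close>

lemma fiedler_word_coeff_cong:
  "(\<And>i. i \<le> k \<Longrightarrow> a i = a' i) \<Longrightarrow> fiedler_word n a c k = fiedler_word n a' c k"
  by (induction k) (simp_all add: Let_def)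

context fiedler_coeffs
begin

text \<open>With \<open>\<mu> = 1/\<lambda>\<close>, the perturbed pencil divided by \<open>\<lambda>\<close> is \<open>M\<^sub>z - \<mu> M\<^sub>w\<close>, with \<open>A\<^sub>0\<close> replaced by the
  proper matrix \<open>A\<^sub>0 + G\<^sub>s\<close>. Reversal of rows and columns turns it, up to the sign, into a generalized Fiedler
  pencil at \<open>\<mu>\<close> in which \<open>M\<^sub>z\<close> and \<open>M\<^sub>w\<close> have exchanged their roles and whose coefficients are those of
  \<open>\<mu>\<^sup>m (P + G\<^sub>s)\<close> as a polynomial in \<open>\<mu>\<close>, reversed and negated.\<close>

lemma pencil_proper_eqv:
  fixes Gs :: rmat and c2 :: "nat \<Rightarrow> bool"
  assumes h: "h < m" and k: "k = m - h - 1" and Gs: "Gs \<in> carrier_mat n n" "pr.ent Gs"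
  defines "Mz \<equiv> dsum (rv (fiedler_word n rev_coeff c2 k)) (1\<^sub>m (h * n))"
    and "Mw \<equiv> dsum (1\<^sub>m (k * n)) (fiedler_word n a (adm_side 0) h)"
    and "\<mu> \<equiv> inverse (to_fract lam)"
  shows "\<exists>U V. pr.S_unit (m * n) U \<and> pr.S_unit (m * n) V \<and>
    U * (\<mu> \<cdot>\<^sub>m (rat_mat (lam \<cdot>\<^sub>m const_mat Mz - const_mat Mw)
        + ucol (m * n) ((m - min 1 h - 1) * n) n * (Gs * transpose_mat (ucol (m * n) ((m - 1) * n) n)))) * V
    = dsum (1\<^sub>m ((m - 1) * n)) (\<mu> ^ m \<cdot>\<^sub>m (rat_mat (matrix_poly n m a) + Gs))"
proof -
  interpret r: fiedler_coeffs n m rev_coeff by (rule rev_coeffs)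
  have km: "k < m" "h = m - k - 1" using h k by auto
  define aF where "aF = (\<lambda>i. rconst (a i))"
  define aT where "aT = aF(0 := aF 0 + Gs)"
  have aF: "aF i \<in> carrier_mat n n" if "i \<le> m" for i using ad[OF that] by (auto simp: aF_def intro: carrier_matI)
  have aT: "aT i \<in> carrier_mat n n" "pr.ent (aT i)" if "i \<le> m" for i
    using aF[OF that] Gs aF[of 0] rconst_ent[of "a i"] rconst_ent[of "a 0"]
    by (auto simp: aT_def aF_def intro!: pr.ent_add)
  define W where "W = fiedler_word n aT (adm_side 0) h"
  have Wd: "dim_row W = Suc h * n" "dim_col W = Suc h * n"
    using fiedler_word_dim[of h aT n "adm_side 0"] aT h by (auto simp: W_def)
  have mu: "\<mu> * to_fract lam = 1" by (simp add: \<mu>_def to_fract_eq_0_iff)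
  \<comment> \<open>By \<open>fiedler_word_update\<close> the perturbation at the ports amounts to the coefficient
    \<open>A\<^sub>0 + G\<^sub>s\<close> in \<open>M\<^sub>w\<close>; \<open>W\<close> is the word with this coefficient.\<close>
  have rw: "rconst (fiedler_word n a c h) = fiedler_word n aF c h" for c
    unfolding rconst_conv aF_def using rc_hom.fiedler_word_hom[of h a n c] a h by auto
  have fd: "dim_row (fiedler_word n aF c h) = Suc h * n" "dim_col (fiedler_word n aF c h) = Suc h * n" for c
    using fiedler_word_dim[of h aF n c] aF h by auto
  have Mwr: "rconst Mw = dsum (1\<^sub>m (k * n)) (fiedler_word n aF (adm_side 0) h)"
    unfolding Mw_def rw[symmetric] rconst_conv
    by (simp add: rc_hom.mat_hom_four_block rc_hom.mat_hom_basic)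
  define u where "u = (ucol (m * n) ((m - min 1 h - 1) * n) n :: rmat)"
  define v where "v = (transpose_mat (ucol (m * n) ((m - 1) * n) n) :: rmat)"
  have ports: "vcat0 (k * n) (port_col n aF (adm_side 0) h) = u" "hcat0 (k * n) (port_row n aF (adm_side 0) h) = v"
    unfolding k u_def v_def using port_col_bcol[OF h, of aF] aF h by auto
  have pd: "dim_row (port_col n aF (adm_side 0) h) = Suc h * n" "dim_col (port_col n aF (adm_side 0) h) = n"
    "dim_row (port_row n aF (adm_side 0) h) = n" "dim_col (port_row n aF (adm_side 0) h) = Suc h * n"
    using port_dims[of h aF n "adm_side 0"] aF h by auto
  have "W = fiedler_word n aF (adm_side 0) h - port_col n aF (adm_side 0) h * (Gs * port_row n aF (adm_side 0) h)"
    unfolding W_def aT_def by (rule fiedler_word_update) (use aF h Gs in auto)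
  hence DW: "dsum (1\<^sub>m (k * n)) W = rconst Mw - u * (Gs * v)"
    unfolding Mwr ports[symmetric]
    by (simp only:) (rule dsum_one_minus; simp add: fd pd carrier_matD[OF Gs(1)])
  have Nz: "m * n = k * n + Suc h * n"
  proof -
    have "m = k + Suc h" using k h by simp
    hence "m * n = (k + Suc h) * n" by (rule arg_cong)
    thus ?thesis by (simp only: add_mult_distrib)
  qed
  have wd: "dim_row (fiedler_word n rev_coeff c2 k) = Suc k * n" "dim_col (fiedler_word n rev_coeff c2 k) = Suc k * n"
    using r.word_dim[OF km(1)] by auto
  have Nz': "m * n = Suc k * n + h * n" using Nz by simp
  have dims: "dim_row Mz = m * n" "dim_col Mz = m * n" "dim_row Mw = m * n" "dim_col Mw = m * n"
    "dim_row u = m * n" "dim_col u = n" "dim_row v = n" "dim_col v = m * n"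
    using Nz Nz' wd word_dim[OF h] by (simp_all add: Mz_def Mw_def u_def v_def)
  define F where "F = rat_mat (lam \<cdot>\<^sub>m const_mat Mz - const_mat Mw) + u * (Gs * v)"
  have pc: "to_fract (pCons 0 (const_mat Mz $$ ij)) = to_fract lam * to_fract (const_mat Mz $$ ij)" for ij
    using frac_hom.hom_mult[of lam "const_mat Mz $$ ij"] by simp
  have F: "F = to_fract lam \<cdot>\<^sub>m rconst Mz - dsum (1\<^sub>m (k * n)) W"
    unfolding F_def DW using dims
    by (intro eq_matI) (simp_all add: rat_mat_def frac_hom.hom_minus pc)
  have muF: "\<mu> \<cdot>\<^sub>m F = rconst Mz - \<mu> \<cdot>\<^sub>m dsum (1\<^sub>m (k * n)) W"
  proof -
    have sc: "\<mu> * (to_fract lam * y - z) = y - \<mu> * z" for y z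
      by (simp only: right_diff_distrib mult.assoc[symmetric] mu mult_1_left)
    have "\<mu> \<cdot>\<^sub>m (to_fract lam \<cdot>\<^sub>m X - Y) = X - \<mu> \<cdot>\<^sub>m Y"
      if "dim_row X = N" "dim_col X = N" "dim_row Y = N" "dim_col Y = N" for X Y :: rmat and N
      by (rule eq_matI) (simp_all only: index_smult_mat index_minus_mat that sc)
    moreover have "dim_row (dsum (1\<^sub>m (k * n)) W) = m * n" "dim_col (dsum (1\<^sub>m (k * n)) W) = m * n"
      using Wd Nz by simp_all
    moreover have "dim_row (rconst Mz) = m * n" "dim_col (rconst Mz) = m * n" using dims by simp_all
    ultimately show ?thesis unfolding F by blast
  qed
  \<comment> \<open>Reversing the coefficients twice gives the original ones; so the word with the original
    coefficients, which was the second one, becomes the reversed word.\<close>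
  define ah where "ah = (\<lambda>i. - rv (aT (m - i)))"
  have ah: "ah i \<in> carrier_mat n n" "pr.ent (ah i)" for i
    using aT[of "m - i"] by (auto simp: ah_def intro!: pr.ent_uminus pr.ent_rv carrier_matI)
  define b where "b = (\<lambda>j. - rv (ah (m - j)))"
  have neg: "- (- X) = X" for X :: rmat by (rule eq_matI) auto
  have bT: "b i = aT i" if "i \<le> m" for i
    using that by (simp add: b_def ah_def rv_arith rv_rv neg)
  have wb: "fiedler_word n b (adm_side 0) h = W"
    unfolding W_def by (rule fiedler_word_coeff_cong) (use bT h in auto)
  have wh: "fiedler_word n ah c2 k = rconst (fiedler_word n rev_coeff c2 k)"
  proof -
    have "fiedler_word n ah c2 k = fiedler_word n (\<lambda>i. rconst (rev_coeff i)) c2 k"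
    proof (rule fiedler_word_coeff_cong)
      fix i assume "i \<le> k"
      hence "m - i \<noteq> 0" using k h by auto
      thus "ah i = rconst (rev_coeff i)"
        unfolding ah_def rev_coeff_def aT_def aF_def rconst_conv
        by (simp add: rc_hom.mat_hom_basic rc_hom.rv_hom)
    qed
    also have "\<dots> = rconst (fiedler_word n rev_coeff c2 k)"
      unfolding rconst_conv using rc_hom.fiedler_word_hom[of k rev_coeff n c2] r.a km by auto
    finally show ?thesis .
  qed
  define Fh where "Fh = \<mu> \<cdot>\<^sub>m dsum (rv W) (1\<^sub>m (k * n)) - dsum (1\<^sub>m (h * n)) (rconst (fiedler_word n rev_coeff c2 k))"
  define PS where "PS = power_sum n m \<mu> ah"
  have "pr.port_eqv (m * n) Fh (vcat0 (h * n) (port_col n ah c2 k)) (hcat0 (h * n) (port_row n ah c2 k))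
      (dsum (1\<^sub>m ((m - 1) * n)) PS) (vcat0 ((m - 1) * n) (1\<^sub>m n)) (hcat0 ((m - 1) * n) (1\<^sub>m n))"
    using pr.generalized_fiedler_eqv[of k m \<mu> ah n h b "adm_side 0" c2] km ah
      tendsto_at_infinity_inverse_lam
    unfolding wb wh Fh_def PS_def by (auto simp: b_def \<mu>_def)
  then obtain U V where U: "pr.S_unit (m * n) U" and V: "pr.S_unit (m * n) V"
    and UV: "U * Fh * V = dsum (1\<^sub>m ((m - 1) * n)) PS"
    by (auto simp: pr.port_eqv_def)
  have Mzr: "rconst Mz = dsum (rv (rconst (fiedler_word n rev_coeff c2 k))) (1\<^sub>m (h * n))"
    unfolding Mz_def rconst_conv
    by (simp add: rc_hom.mat_hom_four_block rc_hom.mat_hom_basic rc_hom.rv_hom)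
  have Fhd: "dim_row Fh = m * n" "dim_col Fh = m * n" using wd Wd Nz' by (simp_all add: Fh_def)
  have rvF: "rv Fh = - (\<mu> \<cdot>\<^sub>m F)"
  proof -
    have "rv Fh = \<mu> \<cdot>\<^sub>m dsum (1\<^sub>m (k * n)) W - rconst Mz"
      unfolding Fh_def Mzr using wd Wd Nz Nz'
      by (subst rv_arith(2)) (simp_all only: rv_arith rv_dsum rv_one rv_rv, simp_all)
    also have "\<dots> = - (\<mu> \<cdot>\<^sub>m F)"
    proof -
      have "X - Y = - (Y - X)" if "dim_row X = N" "dim_col X = N" "dim_row Y = N" "dim_col Y = N"
        for X Y :: rmat and N
        by (rule eq_matI) (simp_all add: that)
      moreover have "dim_row (\<mu> \<cdot>\<^sub>m dsum (1\<^sub>m (k * n)) W) = m * n" "dim_col (\<mu> \<cdot>\<^sub>m dsum (1\<^sub>m (k * n)) W) = m * n"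
        using Wd Nz by simp_all
      moreover have "dim_row (rconst Mz) = m * n" "dim_col (rconst Mz) = m * n" using dims by simp_all
      ultimately show ?thesis unfolding muF by blast
    qed
    finally show ?thesis .
  qed
  have unit_rv: "pr.S_unit (m * n) (rv X)" if Xu: "pr.S_unit (m * n) X" for X
  proof -
    obtain Y where Y: "Y \<in> carrier_mat (m * n) (m * n)" "pr.ent Y" "X * Y = 1\<^sub>m (m * n)" "Y * X = 1\<^sub>m (m * n)"
      and X: "X \<in> carrier_mat (m * n) (m * n)" "pr.ent X"
      using Xu by (auto simp: pr.S_unit_def)
    have "rv X * rv Y = rv (X * Y)" "rv Y * rv X = rv (Y * X)"
      using X(1) Y(1) by (simp_all only: rv_mult carrier_matD)
    hence "rv X * rv Y = 1\<^sub>m (m * n)" "rv Y * rv X = 1\<^sub>m (m * n)" using Y by (simp_all add: rv_one)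
    thus ?thesis using X Y by (intro pr.S_unitI[of _ _ "rv Y"] pr.ent_rv carrier_matI) auto
  qed
  define N where "N = (m - 1) * n"
  have PSd: "dim_row PS = n" "dim_col PS = n" by (simp_all add: PS_def power_sum_def)
  define E where "E = - rv PS"
  have Ed: "dim_row E = n" "dim_col E = n" by (simp_all add: E_def PSd)
  have Fd: "dim_row F = m * n" "dim_col F = m * n"
    unfolding F_def using dims by simp_all
  have mid: "rv U * (\<mu> \<cdot>\<^sub>m F) * rv V = dsum E (- 1\<^sub>m N)"
  proof -
    have "rv (U * Fh * V) = rv U * rv Fh * rv V"
      using Fhd pr.S_unit_dim[OF U] pr.S_unit_dim[OF V] by (simp add: rv_mult)
    hence "rv U * (- (\<mu> \<cdot>\<^sub>m F)) * rv V = dsum (rv PS) (1\<^sub>m N)"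
      unfolding UV rvF by (simp only: rv_dsum rv_one N_def)
    hence "- (rv U * (\<mu> \<cdot>\<^sub>m F) * rv V) = dsum (rv PS) (1\<^sub>m N)"
      using Fd pr.S_unit_dim[OF U] pr.S_unit_dim[OF V] by (simp add: uminus_mult_dim)
    hence "rv U * (\<mu> \<cdot>\<^sub>m F) * rv V = - dsum (rv PS) (1\<^sub>m N)" using neg by metis
    also have "\<dots> = dsum E (- 1\<^sub>m N)"
      unfolding E_def by (simp add: four_block_arith mat_trivial)
    finally show ?thesis .
  qed
  \<comment> \<open>The reversal has moved the identity block to the end and changed its sign; \<open>P\<^sub>l\<close> and \<open>P\<^sub>r\<close>
    undo this.\<close>
  define Pl where "Pl = four_block_mat (0\<^sub>m N n) (- 1\<^sub>m N) (1\<^sub>m n) (0\<^sub>m n N :: rmat)"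
  define Pr where "Pr = four_block_mat (0\<^sub>m n N) (1\<^sub>m n) (1\<^sub>m N) (0\<^sub>m N n :: rmat)"
  have Nm: "n + N = m * n" "N + n = m * n" using block_size1 by (simp_all add: N_def)
  have neg1: "- (- 1\<^sub>m N) = (1\<^sub>m N :: rmat)" by (rule neg)
  have Pl: "pr.S_unit (m * n) Pl"
  proof (rule pr.S_unitI[of _ _ "four_block_mat (0\<^sub>m n N) (1\<^sub>m n) (- 1\<^sub>m N) (0\<^sub>m N n)"])
    show "Pl * four_block_mat (0\<^sub>m n N) (1\<^sub>m n) (- 1\<^sub>m N) (0\<^sub>m N n) = 1\<^sub>m (m * n)"
      "four_block_mat (0\<^sub>m n N) (1\<^sub>m n) (- 1\<^sub>m N) (0\<^sub>m N n) * Pl = 1\<^sub>m (m * n)"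
      unfolding Pl_def by (simp_all add: mult_four_block_dim mat_trivial uminus_mult_dim neg1 Nm)
  qed (auto simp: Pl_def Nm intro!: carrier_matI pr.ent_intros)
  have Pr: "pr.S_unit (m * n) Pr"
  proof (rule pr.S_unitI[of _ _ "four_block_mat (0\<^sub>m N n) (1\<^sub>m N) (1\<^sub>m n) (0\<^sub>m n N)"])
    show "Pr * four_block_mat (0\<^sub>m N n) (1\<^sub>m N) (1\<^sub>m n) (0\<^sub>m n N) = 1\<^sub>m (m * n)"
      "four_block_mat (0\<^sub>m N n) (1\<^sub>m N) (1\<^sub>m n) (0\<^sub>m n N) * Pr = 1\<^sub>m (m * n)"
      unfolding Pr_def by (simp_all add: mult_four_block_dim mat_trivial Nm)
  qed (auto simp: Pr_def Nm intro!: carrier_matI pr.ent_intros)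
  have swap: "Pl * dsum E (- 1\<^sub>m N) * Pr = dsum (1\<^sub>m N) E"
    unfolding Pl_def Pr_def by (simp add: mult_four_block_dim mat_trivial uminus_mult_dim neg1 Ed)
  have E: "E = \<mu> ^ m \<cdot>\<^sub>m (rat_mat (matrix_poly n m a) + Gs)"
  proof (rule eq_matI)
    fix i j assume "i < dim_row (\<mu> ^ m \<cdot>\<^sub>m (rat_mat (matrix_poly n m a) + Gs))"
      "j < dim_col (\<mu> ^ m \<cdot>\<^sub>m (rat_mat (matrix_poly n m a) + Gs))"
    hence ij: "i < n" "j < n" using Gs by auto
    have aTd: "dim_row (aT q) = n" "dim_col (aT q) = n" if "q \<le> m" for q using aT(1)[OF that] by auto
    have "E $$ (i, j) = - (\<Sum>q\<le>m. \<mu> ^ q * ah q $$ (n - 1 - i, n - 1 - j))"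
      using ij PSd by (simp add: E_def) (simp add: PS_def power_sum_def)
    also have "\<dots> = (\<Sum>q\<le>m. \<mu> ^ q * aT (m - q) $$ (i, j))"
      unfolding sum_negf[symmetric] by (intro sum.cong refl) (use ij aTd in \<open>simp add: ah_def\<close>)
    also have "\<dots> = (\<Sum>q\<le>m. \<mu> ^ (m - q) * aT q $$ (i, j))"
      by (rule sum.reindex_bij_witness[of _ "\<lambda>q. m - q" "\<lambda>q. m - q"]) auto
    also have "\<dots> = (\<Sum>q\<le>m. \<mu> ^ m * (to_fract lam ^ q * aF q $$ (i, j)) + (if q = 0 then \<mu> ^ m * Gs $$ (i, j) else 0))"
    proof (intro sum.cong refl)
      fix q assume q: "q \<in> {..m}"
      have e: "\<mu> ^ m * to_fract lam ^ q = \<mu> ^ (m - q)"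
      proof -
        have "\<mu> ^ m = \<mu> ^ (m - q) * \<mu> ^ q" using q by (simp add: power_add[symmetric])
        moreover have "\<mu> ^ q * to_fract lam ^ q = 1" by (simp only: power_mult_distrib[symmetric] mu power_one)
        ultimately show ?thesis by (simp only: mult.assoc mult_1_right)
      qed
      have d0: "dim_row (aF 0) = n" "dim_col (aF 0) = n" using aF[of 0] by auto
      show "\<mu> ^ (m - q) * aT q $$ (i, j) =
        \<mu> ^ m * (to_fract lam ^ q * aF q $$ (i, j)) + (if q = 0 then \<mu> ^ m * Gs $$ (i, j) else 0)"
        unfolding mult.assoc[symmetric] e
        using ij carrier_matD[OF Gs(1)] d0 by (cases "q = 0") (simp_all add: aT_def distrib_left)
    qed
    also have "\<dots> = \<mu> ^ m * (\<Sum>q\<le>m. to_fract lam ^ q * aF q $$ (i, j)) + \<mu> ^ m * Gs $$ (i, j)"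
      by (simp add: sum.distrib sum_distrib_left)
    also have "(\<Sum>q\<le>m. to_fract lam ^ q * aF q $$ (i, j)) = rat_mat (matrix_poly n m a) $$ (i, j)"
    proof -
      have "to_fract lam ^ q * aF q $$ (i, j) = to_fract (monom (a q $$ (i, j)) q)" if "q \<le> m" for q
      proof -
        have "monom (a q $$ (i, j)) q = lam ^ q * [:a q $$ (i, j):]" by (simp add: monom_altdef)
        hence "to_fract (monom (a q $$ (i, j)) q) = to_fract lam ^ q * to_fract [:a q $$ (i, j):]"
          by (simp only: frac_hom.hom_mult frac_hom.hom_power)
        thus ?thesis using that ij ad[of q] by (simp add: aF_def rconst_conv)
      qed
      thus ?thesis using ij by (simp add: rat_mat_def matrix_poly_def frac_hom.hom_sum)
    qed
    finally show "E $$ (i, j) = (\<mu> ^ m \<cdot>\<^sub>m (rat_mat (matrix_poly n m a) + Gs)) $$ (i, j)"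
      using ij Gs(1) by (simp add: matrix_poly_def distrib_left)
  qed (use Gs in \<open>simp_all add: Ed\<close>)
  show ?thesis
    unfolding u_def[symmetric] v_def[symmetric] F_def[symmetric]
  proof (intro exI conjI)
    show "pr.S_unit (m * n) (Pl * rv U)" "pr.S_unit (m * n) (rv V * Pr)"
      using Pl Pr unit_rv U V by (auto intro: pr.S_unit_mult)
    have "Pl * rv U * (\<mu> \<cdot>\<^sub>m F) * (rv V * Pr) = Pl * (rv U * (\<mu> \<cdot>\<^sub>m F) * rv V) * Pr"
      using Fd pr.S_unit_dim[OF U] pr.S_unit_dim[OF V] pr.S_unit_dim[OF Pl] pr.S_unit_dim[OF Pr]
      by (simp add: mult_assoc_dim)
    also have "\<dots> = dsum (1\<^sub>m N) E" unfolding mid by (rule swap)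
    finally show "Pl * rv U * (\<mu> \<cdot>\<^sub>m F) * (rv V * Pr) =
      dsum (1\<^sub>m ((m - 1) * n)) (\<mu> ^ m \<cdot>\<^sub>m (rat_mat (matrix_poly n m a) + Gs))"
      unfolding E N_def .
  qed
qed

end

section \<open>Minimal realizations\<close>

text \<open>A zero row of the row echelon form \<open>C = P M\<close> would give a row of the invertible matrix \<open>P\<close> that
  annihilates \<open>M\<close>. So every row of \<open>C\<close> has a pivot, and the matrix \<open>E\<close> that selects the
  pivot columns is a right inverse of \<open>C\<close>.\<close>

lemma full_row_rank:
  fixes M :: cmat
  assumes M: "M \<in> carrier_mat r N"
    and ker: "\<And>u. u \<in> carrier_mat 1 r \<Longrightarrow> u * M = 0\<^sub>m 1 N \<Longrightarrow> u = 0\<^sub>m 1 r"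
  shows "vec_space.rank r M = r"
proof -
  interpret V: vec_space "TYPE(complex)" r .
  define C where "C = gauss_jordan_single M"
  obtain P Q where C: "C \<in> carrier_mat r N" "row_echelon_form C" "C = P * M"
    and P: "P \<in> carrier_mat r r" and Q: "Q \<in> carrier_mat r r" and PQ: "P * Q = 1\<^sub>m r" "Q * P = 1\<^sub>m r"
    using gauss_jordan_single(2,3,4)[OF M C_def[symmetric]] by blast
  obtain f where f: "pivot_fun C f N" using C(1,2) by (auto simp: row_echelon_form_def)
  note piv = pivot_funD[OF carrier_matD(1)[OF C(1)] f]
  have flt: "f i < N" if i: "i < r" for i
  proof (rule ccontr)
    assume "\<not> f i < N"
    hence fi: "f i = N" using piv(1)[OF i] by simp
    define u where "u = mat 1 r (\<lambda>(_, j). P $$ (i, j))"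
    have "u * M = 0\<^sub>m 1 N"
    proof (rule eq_matI)
      fix k j assume "k < dim_row (0\<^sub>m 1 N)" "j < dim_col (0\<^sub>m 1 N)"
      hence kj: "k = 0" "j < N" by auto
      have "(u * M) $$ (k, j) = C $$ (i, j)"
        unfolding C(3) using M P i kj by (simp add: u_def scalar_prod_def)
      also have "\<dots> = 0" using piv(2)[OF i, of j] fi kj by simp
      finally show "(u * M) $$ (k, j) = 0\<^sub>m 1 N $$ (k, j)" using kj by simp
    qed (use M in \<open>auto simp: u_def\<close>)
    hence u0: "u = 0\<^sub>m 1 r" using ker[of u] by (simp add: u_def)
    have "P $$ (i, j) = 0" if "j < r" for j
      using arg_cong[OF u0, of "\<lambda>X. X $$ (0, j)"] that by (simp add: u_def)
    hence "(P * Q) $$ (i, i) = 0" using P Q i by (simp add: scalar_prod_def)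
    thus False using PQ(1) i by simp
  qed
  have span: "V.span (set (cols M)) = carrier_vec r"
  proof -
    have "\<exists>x\<in>carrier_vec N. M *\<^sub>v x = y" if y: "y \<in> carrier_vec r" for y
    proof -
      define z where "z = P *\<^sub>v y"
      have z: "z \<in> carrier_vec r" using P y by (simp add: z_def)
      define E where "E = mat N r (\<lambda>(j, i). if j = f i then 1 else (0::complex))"
      have E: "E \<in> carrier_mat N r" by (simp add: E_def)
      have CE: "C * E = 1\<^sub>m r"
      proof (rule eq_matI)
        fix i j assume "i < dim_row (1\<^sub>m r)" "j < dim_col (1\<^sub>m r)"
        hence ij: "i < r" "j < r" by auto
        have "(C * E) $$ (i, j) = (\<Sum>k = 0..<N. C $$ (i, k) * (if k = f j then 1 else 0))"
          using C(1) E ij by (simp add: scalar_prod_def E_def)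
        also have "\<dots> = C $$ (i, f j)" using flt[OF ij(2)]
          by (simp add: if_distrib[of "\<lambda>x. _ * x"] sum.delta cong: if_cong)
        also have "\<dots> = 1\<^sub>m r $$ (i, j)"
          using piv(4)[OF ij(2) flt[OF ij(2)]] piv(5)[OF ij(2) flt[OF ij(2)] ij(1)] ij by auto
        finally show "(C * E) $$ (i, j) = 1\<^sub>m r $$ (i, j)" .
      qed (use C(1) E in auto)
      have "M = Q * C" unfolding C(3) using M P Q PQ(2) by (simp add: assoc_mult_mat[of Q r r P r M N, symmetric])
      hence "M * E = Q * (C * E)" using Q C(1) E by (simp add: assoc_mult_mat[of Q r r C N E r])
      hence ME: "M * E = Q" unfolding CE using Q by simp
      have "M *\<^sub>v (E *\<^sub>v z) = (M * E) *\<^sub>v z" using assoc_mult_mat_vec[OF M E z] by simp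
      also have "\<dots> = (Q * P) *\<^sub>v y" unfolding ME z_def using assoc_mult_mat_vec[OF Q P y] by simp
      also have "\<dots> = y" unfolding PQ(2) using y by simp
      finally have "M *\<^sub>v (E *\<^sub>v z) = y" .
      thus ?thesis using E z by (intro bexI[of _ "E *\<^sub>v z"]) auto
    qed
    hence "V.col_space M = carrier_vec r" using V.col_space_eq[OF M] M by auto
    thus ?thesis by (simp add: V.col_space_def)
  qed
  have "V.span_vs (set (cols M)) = V.V" unfolding span by (simp add: module_vec_def)
  thus ?thesis unfolding V.rank_def using V.dim_is_n by simp
qed

lemma full_col_rank:
  fixes M :: cmat
  assumes M: "M \<in> carrier_mat N r"
    and ker: "\<And>v. v \<in> carrier_mat r 1 \<Longrightarrow> M * v = 0\<^sub>m N 1 \<Longrightarrow> v = 0\<^sub>m r 1"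
  shows "vec_space.rank N M = r"
proof -
  interpret V: vec_space "TYPE(complex)" N .
  have ker': "v = 0\<^sub>v r" if v: "v \<in> carrier_vec r" "M *\<^sub>v v = 0\<^sub>v N" for v
  proof -
    define w where "w = mat r 1 (\<lambda>(i, _). v $ i)"
    have w: "w \<in> carrier_mat r 1" by (simp add: w_def)
    have "M * w = 0\<^sub>m N 1"
    proof (rule eq_matI)
      fix i j assume "i < dim_row (0\<^sub>m N 1)" "j < dim_col (0\<^sub>m N 1)"
      hence ij: "i < N" "j = 0" by auto
      have "(M * w) $$ (i, j) = (M *\<^sub>v v) $ i"
        using M v(1) ij by (simp add: w_def scalar_prod_def mult_mat_vec_def)
      thus "(M * w) $$ (i, j) = 0\<^sub>m N 1 $$ (i, j)" using v(2) ij by simp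
    qed (use M in \<open>auto simp: w_def\<close>)
    hence w0: "w = 0\<^sub>m r 1" by (rule ker[OF w])
    show ?thesis
    proof (rule eq_vecI)
      fix i assume "i < dim_vec (0\<^sub>v r :: complex vec)"
      thus "v $ i = 0\<^sub>v r $ i" using arg_cong[OF w0, of "\<lambda>X. X $$ (i, 0)"] by (simp add: w_def)
    qed (use v in simp)
  qed
  have dist: "distinct (cols M)"
    unfolding distinct_conv_nth
  proof (intro allI impI notI)
    fix i j assume ij: "i < length (cols M)" "j < length (cols M)" "i \<noteq> j" and eq: "cols M ! i = cols M ! j"
    hence ij': "i < r" "j < r" using M by auto
    have e: "col M i = col M j" using eq ij by simp
    define v where "v = (unit_vec r i - unit_vec r j :: complex vec)"
    have "M *\<^sub>v v = M *\<^sub>v unit_vec r i - M *\<^sub>v unit_vec r j"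
      unfolding v_def by (rule mult_minus_distrib_mat_vec[OF M]) auto
    also have "M *\<^sub>v unit_vec r i = col M i" using M ij' by (auto intro!: eq_vecI)
    also have "M *\<^sub>v unit_vec r j = col M j" using M ij' by (auto intro!: eq_vecI)
    also have "col M i - col M j = 0\<^sub>v N" unfolding e using M ij' by (intro eq_vecI) auto
    finally have "v = 0\<^sub>v r" by (intro ker') (auto simp: v_def)
    hence "v $ i = 0" using ij' by simp
    thus False using ij' ij(3) by (simp add: v_def)
  qed
  have "V.lin_indpt (set (cols M))"
  proof
    assume "V.lin_dep (set (cols M))"
    then obtain v where "v \<in> carrier_vec r" "v \<noteq> 0\<^sub>v r" "M *\<^sub>v v = 0\<^sub>v N"
      using V.lin_depE[OF M _ dist] by blast
    thus False using ker' by blast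
  qed
  thus ?thesis by (rule V.lin_indpt_full_rank[OF M dist])
qed

text \<open>If \<open>v\<^sub>i \<noteq> 0\<close>, the equation \<open>v y = 0\<close> can be solved for \<open>y\<^sub>i\<close>: the other coordinates are free. \<open>R\<close> reads
  them off and \<open>N\<close> recovers \<open>y\<close> from them.\<close>

lemma kernel_parametrization:
  fixes v :: cmat
  assumes v: "v \<in> carrier_mat 1 r" "v \<noteq> 0\<^sub>m 1 r"
  obtains N R where "r > 0" "N \<in> carrier_mat r (r - 1)" "R \<in> carrier_mat (r - 1) r" "v * N = 0\<^sub>m 1 (r - 1)"
    "\<And>Y k. Y \<in> carrier_mat r k \<Longrightarrow> v * Y = 0\<^sub>m 1 k \<Longrightarrow> N * (R * Y) = Y"
proof -
  obtain i where i: "i < r" "v $$ (0, i) \<noteq> 0"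
  proof (rule ccontr)
    assume "\<not> thesis"
    hence "v = 0\<^sub>m 1 r" using v(1) that by (intro eq_matI) auto
    thus False using v(2) by simp
  qed
  define vi where "vi = v $$ (0, i)"
  have vi: "vi \<noteq> 0" using i by (simp add: vi_def)
  define sk where "sk j = (if j < i then j else Suc j)" for j
  have bij: "bij_betw sk {0..<r - 1} ({0..<r} - {i})"
    by (rule bij_betw_byWitness[where f' = "\<lambda>c. if c < i then c else c - 1"]) (use i in \<open>auto simp: sk_def\<close>)
  have skr: "sk j < r \<and> sk j \<noteq> i" if "j < r - 1" for j using bij_betwE[OF bij] that by auto
  have inj: "sk j = sk j' \<longleftrightarrow> j = j'" for j j' by (auto simp: sk_def)
  define R where "R = mat (r - 1) r (\<lambda>(j, c). if c = sk j then 1 else (0::complex))"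
  define N where "N = mat r (r - 1) (\<lambda>(c, j). if c = i then - v $$ (0, sk j) / vi else if c = sk j then 1 else 0)"
  have d: "dim_row v = 1" "dim_col v = r" using v by auto
  show thesis
  proof (rule that)
    show "r > 0" using i by simp
    show "N \<in> carrier_mat r (r - 1)" "R \<in> carrier_mat (r - 1) r" by (simp_all add: N_def R_def)
    show "v * N = 0\<^sub>m 1 (r - 1)"
    proof (rule eq_matI)
      fix k j assume "k < dim_row (0\<^sub>m 1 (r - 1))" "j < dim_col (0\<^sub>m 1 (r - 1))"
      hence kj: "k = 0" "j < r - 1" by auto
      have "(v * N) $$ (k, j) = (\<Sum>c = 0..<r. v $$ (0, c) * N $$ (c, j))"
        using d kj by (simp add: scalar_prod_def N_def)
      also have "\<dots> = v $$ (0, i) * N $$ (i, j) + (\<Sum>c\<in>{0..<r} - {i}. v $$ (0, c) * N $$ (c, j))"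
        using i by (subst sum.remove[of _ i]) auto
      also have "(\<Sum>c\<in>{0..<r} - {i}. v $$ (0, c) * N $$ (c, j)) =
          (\<Sum>c\<in>{0..<r} - {i}. if c = sk j then v $$ (0, c) else 0)"
        by (intro sum.cong refl) (use kj in \<open>auto simp: N_def\<close>)
      also have "\<dots> = v $$ (0, sk j)" using skr[OF kj(2)] by (subst sum.delta) auto
      also have "v $$ (0, i) * N $$ (i, j) = - v $$ (0, sk j)"
        using i kj vi by (simp add: N_def vi_def)
      finally show "(v * N) $$ (k, j) = 0\<^sub>m 1 (r - 1) $$ (k, j)" using kj by simp
    qed (auto simp: d N_def)
    show "N * (R * Y) = Y" if Y: "Y \<in> carrier_mat r k" and vY: "v * Y = 0\<^sub>m 1 k" for Y k
    proof (rule eq_matI)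
      fix c j assume "c < dim_row Y" "j < dim_col Y"
      hence cj: "c < r" "j < k" using Y by auto
      have RY: "(R * Y) $$ (b, j) = Y $$ (sk b, j)" if "b < r - 1" for b
      proof -
        have "(R * Y) $$ (b, j) = (\<Sum>a = 0..<r. (if a = sk b then 1 else 0) * Y $$ (a, j))"
          using Y that cj by (simp add: scalar_prod_def R_def)
        also have "\<dots> = Y $$ (sk b, j)" using skr[OF that]
          by (simp add: if_distrib[of "\<lambda>x. x * _"] sum.delta cong: if_cong)
        finally show ?thesis .
      qed
      have NRY: "(N * (R * Y)) $$ (c, j) = (\<Sum>b = 0..<r - 1. N $$ (c, b) * Y $$ (sk b, j))"
      proof -
        have "(N * (R * Y)) $$ (c, j) = (\<Sum>b = 0..<r - 1. N $$ (c, b) * (R * Y) $$ (b, j))"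
          using Y cj by (simp add: scalar_prod_def N_def R_def)
        thus ?thesis using RY by simp
      qed
      show "(N * (R * Y)) $$ (c, j) = Y $$ (c, j)"
      proof (cases "c = i")
        case True
        have "(v * Y) $$ (0, j) = (\<Sum>c = 0..<r. v $$ (0, c) * Y $$ (c, j))"
          using d Y cj by (simp add: scalar_prod_def)
        hence "0 = v $$ (0, i) * Y $$ (i, j) + (\<Sum>c\<in>{0..<r} - {i}. v $$ (0, c) * Y $$ (c, j))"
          unfolding vY using i cj by (subst (asm) sum.remove[of _ i]) auto
        also have "(\<Sum>c\<in>{0..<r} - {i}. v $$ (0, c) * Y $$ (c, j)) =
            (\<Sum>b = 0..<r - 1. v $$ (0, sk b) * Y $$ (sk b, j))"
          by (rule sum.reindex_bij_betw[OF bij, symmetric])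
        finally have "vi * Y $$ (i, j) = - (\<Sum>b = 0..<r - 1. v $$ (0, sk b) * Y $$ (sk b, j))"
          by (simp add: vi_def eq_neg_iff_add_eq_0)
        moreover have "vi * (\<Sum>b = 0..<r - 1. N $$ (c, b) * Y $$ (sk b, j)) =
            - (\<Sum>b = 0..<r - 1. v $$ (0, sk b) * Y $$ (sk b, j))"
          unfolding sum_distrib_left sum_negf[symmetric]
          by (intro sum.cong refl) (use True i vi in \<open>simp add: N_def\<close>)
        ultimately have "vi * (\<Sum>b = 0..<r - 1. N $$ (c, b) * Y $$ (sk b, j)) = vi * Y $$ (i, j)" by simp
        thus ?thesis unfolding NRY mult_cancel_left using True vi by blast
      next
        case False
        have "c \<in> sk ` {0..<r - 1}" using bij False cj unfolding bij_betw_def by auto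
        then obtain b0 where b0: "b0 < r - 1" "c = sk b0" by auto
        have "(\<Sum>b = 0..<r - 1. N $$ (c, b) * Y $$ (sk b, j)) =
            (\<Sum>b = 0..<r - 1. if b = b0 then Y $$ (c, j) else 0)"
          by (intro sum.cong refl) (use False cj b0 inj in \<open>auto simp: N_def\<close>)
        thus ?thesis unfolding NRY using b0 by simp
      qed
    qed (use Y in \<open>auto simp: N_def\<close>)
  qed
qed

text \<open>One half of the Popov-Belevitch-Hautus criterion. The kernel of such a \<open>v \<noteq> 0\<close> is invariant
  under \<open>A\<close> and contains the range of \<open>B\<close>. Restricting the state space to it does not change the
  transfer function and lowers the dimension by 1.\<close>

lemma minimal_controllable:
  assumes real: "realization n r P A B C G"
    and min: "\<And>r' P' A' B' C'. realization n r' P' A' B' C' G \<Longrightarrow> r \<le> r'"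
    and v: "v \<in> carrier_mat 1 r" "v * B = 0\<^sub>m 1 n" "v * A = x \<cdot>\<^sub>m v"
  shows "v = 0\<^sub>m 1 r"
proof (rule ccontr)
  assume "v \<noteq> 0\<^sub>m 1 r"
  then obtain N R where r: "r > 0" and N: "N \<in> carrier_mat r (r - 1)" and R: "R \<in> carrier_mat (r - 1) r"
    and vN: "v * N = 0\<^sub>m 1 (r - 1)"
    and NR: "\<And>Y k. Y \<in> carrier_mat r k \<Longrightarrow> v * Y = 0\<^sub>m 1 k \<Longrightarrow> N * (R * Y) = Y"
    using kernel_parametrization[OF v(1)] by metis
  have c: "P \<in> carrier_mat n n" "A \<in> carrier_mat r r" "B \<in> carrier_mat r n" "C \<in> carrier_mat n r"
    and G: "G = rat_mat P + rconst C * rat_inverse (rat_mat (state_pencil r A)) * rconst B"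
    using real by (auto simp: realization_def)
  note d = carrier_matD[OF c(1)] carrier_matD[OF c(2)] carrier_matD[OF c(3)] carrier_matD[OF c(4)]
    carrier_matD[OF N] carrier_matD[OF R] carrier_matD[OF v(1)]
  define A1 where "A1 = R * (A * N)"
  define B1 where "B1 = R * B"
  have A1: "A1 \<in> carrier_mat (r - 1) (r - 1)" and B1: "B1 \<in> carrier_mat (r - 1) n"
    unfolding A1_def B1_def by (rule carrier_matI; simp add: d)+
  note d = d carrier_matD[OF A1] carrier_matD[OF B1]
  have "v * (A * N) = (v * A) * N" by (simp add: mult_assoc_dim d)
  also have "\<dots> = 0\<^sub>m 1 (r - 1)" unfolding v(3) by (simp add: smult_mult_dim d vN mat_trivial)
  finally have AN: "N * A1 = A * N" unfolding A1_def by (intro NR carrier_matI) (simp_all add: d)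
  have NB: "N * B1 = B" unfolding B1_def by (rule NR[OF c(3) v(2)])
  define D where "D = rat_mat (state_pencil r A)"
  define D1 where "D1 = rat_mat (state_pencil (r - 1) A1)"
  define Rs where "Rs = rat_inverse D"
  define Rs1 where "Rs1 = rat_inverse D1"
  note res = resolvent[OF c(2), folded D_def, folded Rs_def]
  note res1 = resolvent[OF A1, folded D1_def, folded Rs1_def]
  have Dd: "dim_row D = r" "dim_col D = r" "dim_row D1 = r - 1" "dim_col D1 = r - 1"
    by (simp_all add: D_def D1_def state_pencil_def d)
  note d = d Dd carrier_matD[OF res(1)] carrier_matD[OF res1(1)]
  have pc: "state_pencil q X = lam \<cdot>\<^sub>m 1\<^sub>m q - const_mat X" for q X by (simp add: state_pencil_def)
  \<comment> \<open>\<open>A N = N A\<^sub>1\<close> gives the same intertwining relation for the pencils and hence for the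
    resolvents.\<close>
  have "state_pencil r A * const_mat N = lam \<cdot>\<^sub>m const_mat N - const_mat (A * N)"
    unfolding pc by (subst mult_minus_dim(2)) (simp_all add: d smult_mult_dim mat_trivial const_mat_mult)
  also have "\<dots> = const_mat N * state_pencil (r - 1) A1"
    unfolding pc AN[symmetric] by (subst mult_minus_dim(1)) (simp_all add: d smult_mult_dim mat_trivial const_mat_mult)
  finally have "rat_mat (state_pencil r A * const_mat N) = rat_mat (const_mat N * state_pencil (r - 1) A1)" by simp
  hence DN: "D * rconst N = rconst N * D1"
    unfolding D_def D1_def by (subst (asm) (1 2) rat_mat_mult) (simp_all add: d state_pencil_def)
  have "rconst N * Rs1 = (Rs * D) * (rconst N * Rs1)" by (simp add: res(2) mat_trivial d)
  also have "\<dots> = Rs * ((D * rconst N) * Rs1)" by (simp add: mult_assoc_dim d)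
  also have "\<dots> = (Rs * rconst N) * (D1 * Rs1)" unfolding DN by (simp add: mult_assoc_dim d)
  also have "\<dots> = Rs * rconst N" by (simp add: res1(3) mat_trivial d)
  finally have NRs: "rconst N * Rs1 = Rs * rconst N" .
  have "rconst (C * N) * Rs1 * rconst B1 = rconst C * (rconst N * Rs1) * rconst B1"
    by (simp add: const_mat_mult rat_mat_mult mult_assoc_dim d)
  also have "\<dots> = rconst C * Rs * rconst (N * B1)"
    unfolding NRs by (simp add: const_mat_mult rat_mat_mult mult_assoc_dim d)
  finally have "G = rat_mat P + rconst (C * N) * Rs1 * rconst B1"
    unfolding G NB Rs_def D_def by simp
  hence "realization n (r - 1) P A1 B1 (C * N) G"
    unfolding realization_def Rs1_def D1_def using c A1 B1 by (auto intro!: carrier_matI simp: d)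
  from min[OF this] r show False by simp
qed

section \<open>The symplectic structure\<close>

lemma J_mat_dim[simp]: "dim_row (J_mat l) = 2 * l" "dim_col (J_mat l) = 2 * l"
  by (simp_all add: J_mat_def)

lemma J_mat_transpose: "transpose_mat (J_mat l) = - (J_mat l :: 'a::comm_ring_1 mat)"
proof -
  have 1: "transpose_mat (- 1\<^sub>m l) = (- 1\<^sub>m l :: 'a mat)" by (rule eq_matI) auto
  have 2: "- (- 1\<^sub>m l) = (1\<^sub>m l :: 'a mat)" by (rule eq_matI) auto
  show ?thesis
    unfolding J_mat_def by (simp add: transpose_four_block_dim transpose_one_zero four_block_arith 1 2 mat_trivial)
qed

lemma J_mat_square: "J_mat l * J_mat l = - (1\<^sub>m (2 * l) :: 'a::comm_ring_1 mat)"
proof -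
  have "J_mat l * J_mat l = - dsum (1\<^sub>m l) (1\<^sub>m l :: 'a mat)"
    unfolding J_mat_def by (simp add: mult_four_block_dim mat_trivial four_block_arith uminus_mult_dim
        del: four_block_one_mat)
  thus ?thesis by (simp only: dsum_one mult_2)
qed

section \<open>The system matrix\<close>

lemma diag_block_two: "diag_block_mat [A, B] = dsum A B"
  by (simp only: diag_block_mat.simps(2)[of A] diag_block_mat_singleton Let_def)

lemma const_mat_uminus: "const_mat (- X) = - const_mat X"
  unfolding const_mat_def by (rule const_hom.mat_hom_basic(3))

lemma rat_mat_uminus: "rat_mat (- X) = - rat_mat X"
  unfolding rat_mat_def by (rule frac_hom.mat_hom_basic(3))

lemma ucol_mult:
  fixes X :: "'a::comm_ring_1 mat"
  assumes X: "dim_row X = n" and ij: "i < N" "j < dim_col X"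
  shows "(ucol N p n * X) $$ (i, j) = (if p \<le> i \<and> i < p + n then X $$ (i - p, j) else 0)"
proof -
  have "(ucol N p n * X) $$ (i, j) = (\<Sum>k = 0..<n. (if i = p + k then 1 else 0) * X $$ (k, j))"
    using X ij by (simp add: scalar_prod_def ucol_def)
  also have "\<dots> = (\<Sum>k = 0..<n. if p \<le> i \<and> k = i - p then X $$ (k, j) else 0)"
    by (intro sum.cong refl) auto
  also have "\<dots> = (if p \<le> i \<and> i < p + n then X $$ (i - p, j) else 0)"
    by (cases "p \<le> i") (auto simp: sum.delta)
  finally show ?thesis .
qed

lemma kron_col:
  fixes X :: "'a::comm_ring_1 mat"
  assumes \<alpha>: "\<alpha> < m" and X: "X \<in> carrier_mat n q"
  shows "kron (e_col m (m - \<alpha>)) X = ucol (m * n) ((m - \<alpha> - 1) * n) n * X"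
proof (rule eq_matI)
  have d: "dim_row X = n" "dim_col X = q" using X by auto
  show "dim_row (kron (e_col m (m - \<alpha>)) X) = dim_row (ucol (m * n) ((m - \<alpha> - 1) * n) n * X)"
    "dim_col (kron (e_col m (m - \<alpha>)) X) = dim_col (ucol (m * n) ((m - \<alpha> - 1) * n) n * X)"
    by (simp_all add: kron_def e_col_def d)
  fix i j assume "i < dim_row (ucol (m * n) ((m - \<alpha> - 1) * n) n * X)"
    "j < dim_col (ucol (m * n) ((m - \<alpha> - 1) * n) n * X)"
  hence ij: "i < m * n" "j < q" by (simp_all add: d)
  hence n: "n > 0" by (cases n) auto
  have im: "i div n < m" using ij(1) by (simp add: less_mult_imp_div_less)
  define b where "b = m - \<alpha> - 1"
  have iff: "b * n \<le> i \<and> i < b * n + n \<longleftrightarrow> i div n = b"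
    using n by (metis add.commute div_nat_eqI dividend_less_times_div mult.commute mult_Suc times_div_less_eq_dividend)
  have "kron (e_col m (m - \<alpha>)) X $$ (i, j) = (if Suc (i div n) = m - \<alpha> then 1 else 0) * X $$ (i mod n, j)"
    using ij im by (simp add: kron_def e_col_def d)
  also have "\<dots> = (if i div n = b then X $$ (i - b * n, j) else 0)"
    using \<alpha> by (auto simp: b_def minus_div_mult_eq_mod[of i n, symmetric])
  also have "\<dots> = (ucol (m * n) (b * n) n * X) $$ (i, j)"
    using iff by (subst ucol_mult) (use ij d in auto)
  finally show "kron (e_col m (m - \<alpha>)) X $$ (i, j) = (ucol (m * n) ((m - \<alpha> - 1) * n) n * X) $$ (i, j)"
    by (simp add: b_def)
qed

lemma kron_transpose:
  "kron (transpose_mat A) (transpose_mat B) = transpose_mat (kron A B)"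
proof (rule eq_matI)
  fix i j assume "i < dim_row (transpose_mat (kron A B))" "j < dim_col (transpose_mat (kron A B))"
  hence ij: "i < dim_col A * dim_col B" "j < dim_row A * dim_row B" by (auto simp: kron_def)
  hence p: "dim_col B > 0" "dim_row B > 0" by (cases "dim_col B"; cases "dim_row B"; auto)+
  have "i div dim_col B < dim_col A" "j div dim_row B < dim_row A" "i mod dim_col B < dim_col B"
    "j mod dim_row B < dim_row B"
    using ij p by (auto simp: less_mult_imp_div_less)
  thus "kron (transpose_mat A) (transpose_mat B) $$ (i, j) = transpose_mat (kron A B) $$ (i, j)"
    using ij by (simp add: kron_def)
qed (auto simp: kron_def)

lemma kron_row:
  fixes X :: "'a::comm_ring_1 mat"
  assumes \<alpha>: "\<alpha> < m" and X: "X \<in> carrier_mat q n"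
  shows "kron (transpose_mat (e_col m (m - \<alpha>))) X = X * transpose_mat (ucol (m * n) ((m - \<alpha> - 1) * n) n)"
proof -
  have "kron (transpose_mat (e_col m (m - \<alpha>))) X = transpose_mat (kron (e_col m (m - \<alpha>)) (transpose_mat X))"
    using kron_transpose[of "e_col m (m - \<alpha>)" "transpose_mat X"] by simp
  also have "\<dots> = transpose_mat (ucol (m * n) ((m - \<alpha> - 1) * n) n * transpose_mat X)"
    by (subst kron_col[OF \<alpha>, of _ n q]) (use X in auto)
  also have "\<dots> = X * transpose_mat (ucol (m * n) ((m - \<alpha> - 1) * n) n)"
    by (subst transpose_mult_dim) (use X in auto)
  finally show ?thesis .
qed

lemma quasi_identity_index:
  "diag_block_mat (map (\<lambda>j. \<epsilon> j \<cdot>\<^sub>m 1\<^sub>m n) [1..<Suc m]) =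
    mat (m * n) (m * n) (\<lambda>(i, j). if i = j then \<epsilon> (Suc (i div n)) else (0::complex))"
proof (induction m)
  case 0
  show ?case by (rule eq_matI) auto
next
  case (Suc m)
  let ?D = "mat (m * n) (m * n) (\<lambda>(i, j). if i = j then \<epsilon> (Suc (i div n)) else (0::complex))"
  have "diag_block_mat (map (\<lambda>j. \<epsilon> j \<cdot>\<^sub>m 1\<^sub>m n) [1..<Suc (Suc m)]) = dsum ?D (\<epsilon> (Suc m) \<cdot>\<^sub>m 1\<^sub>m n)"
  proof -
    have "[1..<Suc (Suc m)] = [1..<Suc m] @ [Suc m]" by simp
    thus ?thesis by (simp only: map_append list.map diag_block_mat_last Suc.IH Let_def)
  qed
  also have "\<dots> = mat (Suc m * n) (Suc m * n) (\<lambda>(i, j). if i = j then \<epsilon> (Suc (i div n)) else 0)"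
  proof (rule eq_matI, goal_cases)
    case (1 i j)
    hence ij: "i < m * n + n" "j < m * n + n" by auto
    have div: "i div n = m" if "\<not> i < m * n"
      by (rule div_nat_eqI) (use that ij in \<open>auto simp: mult.commute\<close>)
    show ?case using ij div by (cases "i < m * n"; cases "j < m * n") auto
  qed auto
  finally show ?case .
qed

lemma rat_inverse_eqI:
  assumes F: "F \<in> carrier_mat r r" and X: "X \<in> carrier_mat r r" and FX: "F * X = 1\<^sub>m r" "X * F = 1\<^sub>m r"
  shows "rat_inverse F = X"
proof -
  have "det F * det X = 1" using det_mult[OF F X] FX by simp
  hence "det F \<noteq> 0" by auto
  hence "F \<in> Units (ring_mat TYPE(complex poly fract) r ())" by (rule det_non_zero_imp_unit[OF F])
  then obtain B where B: "mat_inverse F = Some B"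
    using mat_inverse(1)[OF F, of "()"] by (cases "mat_inverse F") auto
  note b = mat_inverse(2)[OF F B]
  have Bc: "B \<in> carrier_mat r r" using b by simp
  have "B = B * (F * X)" unfolding FX using right_mult_one_mat[OF Bc] by simp
  also have "\<dots> = (B * F) * X" using assoc_mult_mat[OF Bc F X] by simp
  also have "\<dots> = X" using b X by simp
  finally show ?thesis unfolding rat_inverse_def B by simp
qed

lemma four_block_assoc:
  fixes P X Z D :: "'a::comm_ring_1 mat"
  assumes d: "dim_row X = dim_row P" "dim_col Z = dim_col P" "dim_row Z = dim_row D" "dim_col X = dim_col D"
  shows "four_block_mat (dsum (1\<^sub>m q) P) (vcat0 q X) (hcat0 q Z) D =
    dsum (1\<^sub>m q) (four_block_mat P X Z D)"
proof (rule eq_matI, goal_cases)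
  case (1 i j)
  hence ij: "i < q + dim_row P + dim_row D" "j < q + dim_col P + dim_col D" by simp_all
  show ?case using ij
    by (cases "i < q"; cases "j < q"; cases "i < q + dim_row P"; cases "j < q + dim_col P")
       (simp_all add: d vcat0_def hcat0_def less_diff_conv2 not_less add.commute)
qed (simp_all add: d)

lemma vcat0_mult: "dim_col l = dim_row X \<Longrightarrow> vcat0 p l * X = vcat0 p (l * (X :: 'a::comm_ring_1 mat))"
proof -
  assume l: "dim_col l = dim_row X"
  have X: "X = four_block_mat (0\<^sub>m 0 0) (0\<^sub>m 0 (dim_col X)) (0\<^sub>m (dim_row X) 0) X"
    by (rule eq_matI) auto
  show ?thesis by (subst X) (use l in \<open>simp add: vcat0_def mult_four_block_dim mat_trivial\<close>)
qed

lemma mult_hcat0: "dim_col X = dim_row r \<Longrightarrow> X * hcat0 p r = hcat0 p ((X :: 'a::comm_ring_1 mat) * r)"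
proof -
  assume l: "dim_col X = dim_row r"
  have X: "X = four_block_mat (0\<^sub>m 0 0) (0\<^sub>m 0 (dim_col X)) (0\<^sub>m (dim_row X) 0) X"
    by (rule eq_matI) auto
  show ?thesis by (subst X) (use l in \<open>simp add: hcat0_def mult_four_block_dim mat_trivial\<close>)
qed

lemma (in entry_ring) port_eqv_outer:
  assumes X: "S_unit N X" and Y: "S_unit N Y" and l: "X * l0 = l" and r: "r0 * Y = r"
    and F: "port_eqv N F l0 r0 F' l' r'"
  shows "port_eqv N (X * F * Y) l r F' l' r'"
proof -
  obtain U V where UV: "S_unit N U" "S_unit N V" "U * F * V = F'" "U * l0 = l'" "r0 * V = r'"
    and d: "dim_row F = N" "dim_col F = N" "dim_row l0 = N" "dim_col r0 = N"
    using F by (auto simp: port_eqv_def)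
  obtain Xi where Xi: "Xi \<in> carrier_mat N N" "ent Xi" "X * Xi = 1\<^sub>m N" "Xi * X = 1\<^sub>m N"
    and Xc: "X \<in> carrier_mat N N" "ent X" using X by (auto simp: S_unit_def)
  obtain Yi where Yi: "Yi \<in> carrier_mat N N" "ent Yi" "Y * Yi = 1\<^sub>m N" "Yi * Y = 1\<^sub>m N"
    and Yc: "Y \<in> carrier_mat N N" "ent Y" using Y by (auto simp: S_unit_def)
  note d = d carrier_matD[OF Xi(1)] carrier_matD[OF Yi(1)] carrier_matD[OF Xc(1)] carrier_matD[OF Yc(1)]
    S_unit_dim[OF UV(1)] S_unit_dim[OF UV(2)]
  have lc: "Xi * (X * Z) = Z" if "dim_row Z = N" for Z
    using Xi(4) that d by (simp add: mult_assoc_dim[symmetric] mat_trivial)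
  have rc: "(Z * Y) * Yi = Z" if "dim_col Z = N" for Z
    using Yi(3) that d by (simp add: mult_assoc_dim mat_trivial)
  have "S_unit N Xi" "S_unit N Yi"
    by (rule S_unitI[OF Xi(1) Xc(1) Xi(2) Xc(2) Xi(4,3)], rule S_unitI[OF Yi(1) Yc(1) Yi(2) Yc(2) Yi(4,3)])
  show ?thesis
  proof (rule port_eqvI[of _ _ _ _ "U * Xi" "Yi * V"])
    show "S_unit N (U * Xi)" "S_unit N (Yi * V)"
      using UV \<open>S_unit N Xi\<close> \<open>S_unit N Yi\<close> by (auto intro: S_unit_mult)
    have "U * Xi * (X * F * Y) * (Yi * V) = U * (((Xi * (X * F)) * Y) * Yi) * V"
      by (simp add: mult_assoc_dim d)
    thus "U * Xi * (X * F * Y) * (Yi * V) = F'" using UV(3) by (simp add: lc rc d)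
    have "U * Xi * (X * l0) = U * (Xi * (X * l0))" by (simp add: mult_assoc_dim d)
    also have "Xi * (X * l0) = l0" by (rule lc) (simp add: d)
    finally show "U * Xi * l = l'" unfolding l UV(4) .
    have "(r0 * Y) * (Yi * V) = ((r0 * Y) * Yi) * V" by (simp add: mult_assoc_dim d)
    also have "(r0 * Y) * Yi = r0" by (rule rc) (simp add: d)
    finally show "r * (Yi * V) = r'" unfolding r UV(5) .
  qed (use d l r in auto)
qed

context fiedler_coeffs
begin

text \<open>The off-diagonal blocks of the system matrix are the ports multiplied by \<open>- C\<close> and \<open>B\<close>. Extended by
  the identity on the states, an equivalence that takes the ports to the last block unit vector takes
  these blocks to \<open>- C\<close> and \<open>B\<close> in the last block row and column.\<close>

lemma system_equivalence:
  assumes eqv: "px.port_eqv (m * n) Lp (const_mat (bcol \<alpha>)) (const_mat (brow \<alpha>))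
      (dsum (1\<^sub>m ((m - 1) * n)) (matrix_poly n m a))
      (ucol (m * n) ((m - 1) * n) n) (transpose_mat (ucol (m * n) ((m - 1) * n) n))"
    and C: "C \<in> carrier_mat n r" and B: "B \<in> carrier_mat r n" and D: "D \<in> carrier_mat r r"
  shows "\<exists>U V. \<exists>U\<^sub>0 \<in> carrier_mat r r. \<exists>V\<^sub>0 \<in> carrier_mat r r.
    unimodular (m * n) U \<and> unimodular (m * n) V \<and> invertible_mat U\<^sub>0 \<and> invertible_mat V\<^sub>0 \<and>
    diag_block_mat [U, const_mat U\<^sub>0] * four_block_mat Lp (- const_mat (bcol \<alpha> * C)) (const_mat (B * brow \<alpha>)) D
      * diag_block_mat [V, const_mat V\<^sub>0] =
    diag_block_mat [1\<^sub>m ((m - 1) * n), four_block_mat (matrix_poly n m a) (- const_mat C) (const_mat B) D]"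
proof -
  obtain U V where U: "px.S_unit (m * n) U" and V: "px.S_unit (m * n) V"
    and UV: "U * Lp * V = dsum (1\<^sub>m ((m - 1) * n)) (matrix_poly n m a)"
      "U * const_mat (bcol \<alpha>) = ucol (m * n) ((m - 1) * n) n"
      "const_mat (brow \<alpha>) * V = transpose_mat (ucol (m * n) ((m - 1) * n) n)"
    and Ld: "dim_row Lp = m * n" "dim_col Lp = m * n"
    using eqv by (auto simp: px.port_eqv_def)
  note d = px.S_unit_dim[OF U] px.S_unit_dim[OF V] Ld carrier_matD[OF C] carrier_matD[OF B] carrier_matD[OF D]
  have Pd: "dim_row (matrix_poly n m a) = n" "dim_col (matrix_poly n m a) = n" by (simp_all add: matrix_poly_def)
  have c1: "const_mat (1\<^sub>m r) = 1\<^sub>m r" unfolding const_mat_def by (rule const_hom.mat_hom_basic(1))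
  have "U * - const_mat (bcol \<alpha> * C) = - ((U * const_mat (bcol \<alpha>)) * const_mat C)"
    by (simp add: uminus_mult_dim mult_assoc_dim const_mat_mult d)
  also have "\<dots> = vcat0 ((m - 1) * n) (1\<^sub>m n) * (- const_mat C)"
    unfolding UV(2) last_port(1)[symmetric] by (simp add: uminus_mult_dim d)
  also have "\<dots> = vcat0 ((m - 1) * n) (- const_mat C)"
    by (subst vcat0_mult) (simp_all add: d mat_trivial)
  finally have e1: "U * - const_mat (bcol \<alpha> * C) = \<dots>" .
  have "const_mat (B * brow \<alpha>) * V = const_mat B * (const_mat (brow \<alpha>) * V)"
    by (simp add: mult_assoc_dim const_mat_mult d)
  also have "\<dots> = hcat0 ((m - 1) * n) (const_mat B)"
    unfolding UV(3) last_port(2)[symmetric] by (simp add: mult_hcat0 d mat_trivial)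
  finally have e2: "const_mat (B * brow \<alpha>) * V = \<dots>" .
  have "dsum U (1\<^sub>m r) * four_block_mat Lp (- const_mat (bcol \<alpha> * C)) (const_mat (B * brow \<alpha>)) D * dsum V (1\<^sub>m r)
      = four_block_mat (U * Lp * V) (U * - const_mat (bcol \<alpha> * C)) (const_mat (B * brow \<alpha>) * V) D"
    by (simp add: mult_four_block_dim mat_trivial d)
  also have "\<dots> = dsum (1\<^sub>m ((m - 1) * n)) (four_block_mat (matrix_poly n m a) (- const_mat C) (const_mat B) D)"
    unfolding UV(1) e1 e2 by (rule four_block_assoc) (simp_all add: d Pd)
  finally have main: "diag_block_mat [U, const_mat (1\<^sub>m r)] *
      four_block_mat Lp (- const_mat (bcol \<alpha> * C)) (const_mat (B * brow \<alpha>)) D * diag_block_mat [V, const_mat (1\<^sub>m r)] =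
    diag_block_mat [1\<^sub>m ((m - 1) * n), four_block_mat (matrix_poly n m a) (- const_mat C) (const_mat B) D]"
    unfolding diag_block_two c1 .
  have i1: "invertible_mat (1\<^sub>m r :: cmat)"
    unfolding invertible_mat_def inverts_mat_def by (intro conjI exI[of _ "1\<^sub>m r"]) auto
  show ?thesis
    using main i1 unimodular_of_unit[OF U] unimodular_of_unit[OF V]
    by (intro exI[of _ U] exI[of _ V] bexI[of _ "1\<^sub>m r"] conjI) auto
qed

end

theorem theorem4p36:
  fixes n m l h p\<^sub>w p\<^sub>z \<alpha> :: nat
    and a :: "nat \<Rightarrow> complex mat"
    and A B Q :: "complex mat"
    and G :: "complex poly fract mat"
    and S L T :: "complex poly mat"
    and w c\<^sub>w t\<^sub>w z c\<^sub>z t\<^sub>z :: "int list"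
    and \<epsilon> :: "nat \<Rightarrow> complex"
    and s :: complex
  assumes m: "m \<ge> 1"
    and coeffs: "\<And>i. i \<le> m \<Longrightarrow> a i \<in> carrier_mat n n"
    and lead: "a m \<noteq> 0\<^sub>m n n"
    and G_skew: "skew_symmetric G"
    and realiz: "minimal_skew_hamiltonian_realization n l (matrix_poly n m a) A B
                   (transpose_mat B * transpose_mat (J_mat l)) G"
    and S: "S = four_block_mat
                  (matrix_poly n m a) (- const_mat (transpose_mat B * transpose_mat (J_mat l)))
                  (const_mat B)       (state_pencil (2 * l) A)"
    and h: "h \<le> m - 1" "even h"
    and w: "simple_admissible_tuple h p\<^sub>w w" "c\<^sub>w = sym_compl h p\<^sub>w"
    and z: "admissible_tuple (m - h - 1) p\<^sub>z (shift z (int m))"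
           "shift c\<^sub>z (int m) = sym_compl (m - h - 1) p\<^sub>z"
    and t\<^sub>w: "type1_right_index_tuple h (rev w) t\<^sub>w"
    and t\<^sub>z: "type1_right_index_tuple (m - h - 1) (rev (shift z (int m))) (shift t\<^sub>z (int m))"
    and L: "L = fiedler_pencil n m a w c\<^sub>w t\<^sub>w z c\<^sub>z t\<^sub>z"
    and \<alpha>: "\<alpha> = c0 (w @ c\<^sub>w @ t\<^sub>w)"
    and Q: "quasi_identity n m \<epsilon> Q" "skew_symmetric (const_mat Q * L)"
    and s: "s = \<epsilon> (m - \<alpha>)"
    and sing0: "\<not> invertible_mat (a 0) \<Longrightarrow> 0 \<notin> set t\<^sub>w"
    and singm: "\<not> invertible_mat (a m) \<Longrightarrow> - int m \<notin> set t\<^sub>z"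
    and ind: "\<not> invertible_mat (a m) \<Longrightarrow> p\<^sub>z = 0"
    and T: "T = four_block_mat
        (const_mat (s \<cdot>\<^sub>m Q) * L)
        (- const_mat (kron (e_col m (m - \<alpha>)) (transpose_mat B * transpose_mat (J_mat l))))
        (const_mat (kron (transpose_mat (e_col m (m - \<alpha>))) B))
        (state_pencil (2 * l) A)"
  shows "skew_hamiltonian_system (m * n) l T \<and>
    rosenbrock_strong_linearization n m (2 * l) S G T \<and>
    transfer_function (m * n) T =
      rat_mat (const_mat (s \<cdot>\<^sub>m Q) * L)
      + rat_mat (const_mat (kron (e_col m (m - \<alpha>)) (transpose_mat B * transpose_mat (J_mat l))))
        * rat_inverse (rat_mat (state_pencil (2 * l) A))
        * rat_mat (const_mat (kron (transpose_mat (e_col m (m - \<alpha>))) B)) \<and>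
    skew_symmetric (transfer_function (m * n) T)"
proof -
  define N where "N = m * n"
  define r where "r = 2 * l"
  define k where "k = m - h - 1"
  define C where "C = transpose_mat B * (transpose_mat (J_mat l) :: cmat)"
  interpret fc: fiedler_coeffs n m a by unfold_locales (use m coeffs in auto)
  have hm: "h < m" using h m by auto
  have shr: "realization n r (matrix_poly n m a) A B C G" and Psk: "skew_symmetric (matrix_poly n m a)"
    and Ask: "skew_symmetric (J_mat l * A)"
    and min: "\<And>r' P' A' B' C'. realization n r' P' A' B' C' G \<Longrightarrow> r \<le> r'"
    using realiz unfolding minimal_skew_hamiltonian_realization_def skew_hamiltonian_realization_def
      skew_hamiltonian_def C_def r_def by blast+
  have A: "A \<in> carrier_mat r r" and B: "B \<in> carrier_mat r n" and Cc: "C \<in> carrier_mat n r"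
    and G: "G = rat_mat (matrix_poly n m a) + rconst C * rat_inverse (rat_mat (state_pencil r A)) * rconst B"
    using shr by (auto simp: realization_def)
  \<comment> \<open>The index of the simple tuple has the parity of \<open>h\<close>.\<close>
  have "p\<^sub>w = 0" using w(1) h(2) unfolding simple_admissible_tuple_def admissible_tuple_def by auto
  hence w': "w = pairs h 0 @ [0]" "c\<^sub>w = sym_compl h 0"
    using w by (simp_all add: simple_admissible_tuple_def admissible_pairs)
  note struct = fc.pencil_structure[OF hm h(2) k_def w' z[folded k_def] t\<^sub>w t\<^sub>z[folded k_def] \<alpha> sing0 singm ind]
  have am: "\<alpha> < m" using struct by simp
  define E where "E = fc.bcol \<alpha>"
  define Mz where "Mz = dsum (rv (fiedler_word n fc.rev_coeff (adm_side p\<^sub>z) k)) (1\<^sub>m (h * n))"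
  define Mw where "Mw = dsum (1\<^sub>m (k * n)) (fiedler_word n a (adm_side 0) h)"
  obtain X Y where X: "cx.S_unit N X" and Y: "cx.S_unit N Y"
    and XE: "X * fc.bcol (min 1 h) = E" and EY: "fc.brow 0 * Y = transpose_mat E"
    and L': "L = const_mat X * (lam \<cdot>\<^sub>m const_mat Mz - const_mat Mw) * const_mat Y"
    using struct unfolding L E_def Mz_def Mw_def N_def by blast
  have Ed: "dim_row E = N" "dim_col E = n" by (simp_all add: E_def N_def)
  note Xd = cx.S_unit_dim[OF X] and Yd = cx.S_unit_dim[OF Y]
  have Nz: "m * n = k * n + Suc h * n"
  proof -
    have "m = k + Suc h" using hm by (simp add: k_def)
    hence "m * n = (k + Suc h) * n" by (rule arg_cong)
    thus ?thesis by (simp only: add_mult_distrib)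
  qed
  have Md: "dim_row Mz = N" "dim_col Mz = N" "dim_row Mw = N" "dim_col Mw = N"
  proof -
    interpret rev: fiedler_coeffs n m fc.rev_coeff by (rule fc.rev_coeffs)
    have km: "k < m" using hm by (simp add: k_def)
    show "dim_row Mz = N" "dim_col Mz = N" "dim_row Mw = N" "dim_col Mw = N"
      using rev.word_dim[OF km] fc.word_dim[OF hm] Nz by (simp_all add: Mz_def Mw_def N_def)
  qed
  \<comment> \<open>The block of \<open>sQ\<close> in position \<open>m - \<alpha>\<close> is \<open>s\<^sup>2 I = I\<close>. So \<open>sQ\<close> fixes \<open>e\<^bsub>m-\<alpha>\<^esub>\<close> and can be merged with
    \<open>X\<close> without moving the port.\<close>
  define Qs where "Qs = s \<cdot>\<^sub>m Q"
  have Qi: "Q = mat N N (\<lambda>(i, j). if i = j then \<epsilon> (Suc (i div n)) else 0)"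
    using Q(1) unfolding quasi_identity_def quasi_identity_index N_def by simp
  have eps: "\<epsilon> j * \<epsilon> j = 1" if "1 \<le> j" "j \<le> m" for j
  proof -
    have "\<epsilon> j \<in> {1, -1}" using Q(1) that unfolding quasi_identity_def by simp
    thus ?thesis by auto
  qed
  have ss: "s * s = 1" unfolding s by (rule eps) (use am in auto)
  have Qd: "dim_row Qs = N" "dim_col Qs = N" by (simp_all add: Qs_def Qi)
  have QQ: "Qs * Qs = 1\<^sub>m N"
  proof (rule eq_matI)
    fix i j assume "i < dim_row (1\<^sub>m N)" "j < dim_col (1\<^sub>m N)"
    hence ij: "i < N" "j < N" by auto
    have "i div n < m" using ij(1) by (simp add: N_def less_mult_imp_div_less)
    hence e: "\<epsilon> (Suc (i div n)) * \<epsilon> (Suc (i div n)) = 1" by (intro eps) auto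
    have q: "(s * \<epsilon> (Suc (i div n))) * (s * \<epsilon> (Suc (i div n))) = 1"
      using ss e by (metis mult.left_commute mult.assoc mult_1_right)
    have "(Qs * Qs) $$ (i, j) = (\<Sum>b = 0..<N. Qs $$ (i, b) * Qs $$ (b, j))"
      using ij Qd by (simp add: scalar_prod_def)
    also have "\<dots> = (\<Sum>b = 0..<N. if b = i then s * \<epsilon> (Suc (i div n)) * Qs $$ (i, j) else 0)"
      by (intro sum.cong refl) (use ij in \<open>auto simp: Qs_def Qi\<close>)
    also have "\<dots> = s * \<epsilon> (Suc (i div n)) * Qs $$ (i, j)" using ij by simp
    also have "\<dots> = 1\<^sub>m N $$ (i, j)" using ij q by (cases "i = j") (auto simp: Qs_def Qi)
    finally show "(Qs * Qs) $$ (i, j) = 1\<^sub>m N $$ (i, j)" .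
  qed (simp_all add: Qd)
  have Qu: "cx.S_unit N Qs"
    by (rule cx.S_unitI[of _ _ Qs]) (rule carrier_matI | simp add: QQ Qd cx.ent_def)+
  have QE: "Qs * E = E"
  proof -
    define p where "p = (m - \<alpha> - 1) * n"
    have top: "p + n \<le> N" using fc.offset_top[OF am] by (simp add: p_def N_def)
    have Eu: "E = ucol N p n" by (simp add: E_def fc.bcol_def p_def N_def)
    have "Qs * ucol N p n = mat N n (\<lambda>(i, j). Qs $$ (i, p + j))"
      using mult_ucol[of Qs N p n] top Qd by simp
    also have "\<dots> = ucol N p n"
    proof (rule eq_matI)
      fix i j assume "i < dim_row (ucol N p n :: cmat)" "j < dim_col (ucol N p n :: cmat)"
      hence ij: "i < N" "j < n" by auto
      have "(p + j) div n = m - \<alpha> - 1"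
        by (rule div_nat_eqI) (use ij in \<open>auto simp: p_def mult.commute\<close>)
      hence "Suc ((p + j) div n) = m - \<alpha>" using am by simp
      thus "mat N n (\<lambda>(i, j). Qs $$ (i, p + j)) $$ (i, j) = ucol N p n $$ (i, j)"
        using ij top ss by (simp add: Qs_def Qi ucol_def s)
    qed auto
    finally show ?thesis unfolding Eu .
  qed
  define Xs where "Xs = Qs * X"
  have Xs: "cx.S_unit N Xs" unfolding Xs_def by (rule cx.S_unit_mult[OF Qu X])
  note Xsd = cx.S_unit_dim[OF Xs]
  have XsE: "Xs * fc.bcol (min 1 h) = E"
    unfolding Xs_def using XE QE Xd Qd by (simp add: mult_assoc_dim N_def)
  define Lp where "Lp = const_mat Qs * L"
  have Lp: "Lp = const_mat Xs * (lam \<cdot>\<^sub>m const_mat Mz - const_mat Mw) * const_mat Y"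
    unfolding Lp_def L' Xs_def by (simp add: const_mat_mult mult_assoc_dim Xd Yd Qd Md)
  have Lpd: "dim_row Lp = N" "dim_col Lp = N" unfolding Lp by (simp_all add: Xsd Yd)
  have Lsk: "transpose_mat Lp = - Lp"
  proof -
    have Ld: "dim_row L = N" "dim_col L = N" unfolding L' by (simp_all add: Xd Yd)
    have "Lp = [:s:] \<cdot>\<^sub>m (const_mat Q * L)"
    proof -
      have "const_mat Qs = [:s:] \<cdot>\<^sub>m const_mat Q"
        unfolding Qs_def const_mat_def by (rule const_hom.mat_hom_basic(4))
      thus ?thesis unfolding Lp_def using Ld by (simp add: smult_mult_dim Qi)
    qed
    moreover have "transpose_mat (const_mat Q * L) = - (const_mat Q * L)"
      using Q(2) by (simp add: skew_symmetric_def)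
    moreover have "transpose_mat (c \<cdot>\<^sub>m Z) = c \<cdot>\<^sub>m transpose_mat Z" "c \<cdot>\<^sub>m (- Z) = - (c \<cdot>\<^sub>m Z)"
      for c and Z :: pmat by (rule eq_matI; simp)+
    ultimately show ?thesis by metis
  qed
  define D where "D = state_pencil r A"
  have Dd: "dim_row D = r" "dim_col D = r" using A by (simp_all add: D_def state_pencil_def)
  note dims = carrier_matD[OF A] carrier_matD[OF B] carrier_matD[OF Cc] Ed Lpd Dd
  have kc: "kron (e_col m (m - \<alpha>)) C = E * C" "kron (transpose_mat (e_col m (m - \<alpha>))) B = B * transpose_mat E"
    using kron_col[OF am Cc] kron_row[OF am B] by (simp_all add: E_def fc.bcol_def)
  have T': "T = four_block_mat Lp (- const_mat (E * C)) (const_mat (B * transpose_mat E)) D"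
    unfolding T C_def[symmetric] kc Lp_def Qs_def D_def r_def ..
  have S': "S = four_block_mat (matrix_poly n m a) (- const_mat C) (const_mat B) D"
    unfolding S C_def D_def r_def ..
  define J where "J = (J_mat l :: cmat)"
  have Jd: "dim_row J = r" "dim_col J = r" by (simp_all add: J_def r_def)
  have J: "transpose_mat J = - J" "J * J = - 1\<^sub>m r"
    by (simp_all add: J_def J_mat_transpose J_mat_square r_def)
  have CJ: "C = transpose_mat B * transpose_mat J" by (simp add: C_def J_def)
  have neg: "- (- Z) = Z" for Z :: cmat by (rule eq_matI) auto
  have JA: "transpose_mat A * J = J * A"
  proof -
    have "- (J * A) = transpose_mat (J * A)" using Ask by (simp add: skew_symmetric_def J_def)
    also have "\<dots> = transpose_mat A * (- J)" using J(1) Jd dims by (simp add: transpose_mult_dim)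
    finally show ?thesis using Jd dims neg by (metis uminus_mult_dim(2) index_transpose_mat(3))
  qed
  have JB: "transpose_mat (J * B) = C" using Jd dims by (simp add: transpose_mult_dim CJ)
  \<comment> \<open>In \<open>diag(I, J) T\<close> the lower left block \<open>J B e\<^sup>T\<close> is the transpose of \<open>e B\<^sup>T J\<^sup>T\<close>, which is the upper right
    block up to the sign, and the diagonal blocks are skew-symmetric.\<close>
  have part1: "skew_hamiltonian_system (m * n) l T"
    unfolding skew_hamiltonian_system_def
  proof
    show "T \<in> carrier_mat (m * n + 2 * l) (m * n + 2 * l)"
      unfolding T' by (rule carrier_matI; simp add: dims N_def r_def)
    have JJ: "JJ_mat (m * n) l = dsum (1\<^sub>m N) (const_mat J)"
    proof -
      have "const_mat (J_mat l) = J_mat l"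
        unfolding J_mat_def const_mat_def
        by (simp add: const_hom.mat_hom_four_block const_hom.mat_hom_basic)
      thus ?thesis unfolding JJ_mat_def diag_block_two N_def J_def by simp
    qed
    define V where "V = const_mat (J * B * transpose_mat E)"
    have Vd: "dim_row V = r" "dim_col V = N" by (simp_all add: V_def Jd dims)
    have Vt: "transpose_mat V = const_mat (E * C)"
      unfolding V_def const_mat_transpose[symmetric]
      by (rule arg_cong[of _ _ const_mat]) (subst transpose_mult_dim, simp_all add: Jd dims JB)
    have "JJ_mat (m * n) l * T = four_block_mat Lp (- const_mat (E * C)) V (const_mat J * D)"
      unfolding JJ T' V_def by (simp add: mult_four_block_dim mat_trivial dims Jd const_mat_mult mult_assoc_dim)
    hence JT: "JJ_mat (m * n) l * T = four_block_mat Lp (- transpose_mat V) V (const_mat J * D)"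
      unfolding Vt .
    have JD: "transpose_mat (const_mat J * D) = - (const_mat J * D)"
    proof -
      have e: "const_mat J * D = lam \<cdot>\<^sub>m const_mat J - const_mat (J * A)"
        unfolding D_def state_pencil_def
        by (subst mult_minus_dim(1)) (simp_all add: dims Jd smult_mult_dim mat_trivial const_mat_mult)
      have "transpose_mat (const_mat J) = - const_mat J"
        unfolding const_mat_transpose[symmetric] J(1) const_mat_uminus ..
      moreover have "transpose_mat (const_mat (J * A)) = - const_mat (J * A)"
        unfolding const_mat_transpose[symmetric] const_mat_uminus[symmetric]
        using Ask by (simp add: skew_symmetric_def J_def)
      moreover have "transpose_mat (c \<cdot>\<^sub>m Z - W) = - (c \<cdot>\<^sub>m Z - W)"
        if "transpose_mat Z = - Z" "transpose_mat W = - W" "dim_row Z = r" "dim_col Z = r" "dim_row W = r" "dim_col W = r"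
        for c and Z W :: pmat
      proof -
        have "transpose_mat (c \<cdot>\<^sub>m Z - W) = c \<cdot>\<^sub>m transpose_mat Z - transpose_mat W"
          using that(3-6) by (intro eq_matI) auto
        also have "\<dots> = - (c \<cdot>\<^sub>m Z - W)" unfolding that(1,2) using that(3-6) by (intro eq_matI) auto
        finally show ?thesis .
      qed
      ultimately show ?thesis unfolding e using Jd dims by simp
    qed
    have t: "transpose_mat (- transpose_mat V) = - V" by (rule eq_matI) auto
    show "skew_symmetric (JJ_mat (m * n) l * T)"
      unfolding skew_symmetric_def JT
      by (simp add: transpose_four_block_dim four_block_arith dims Jd Vd Lsk JD t)
  qed
  have EE: "transpose_mat E * E = 1\<^sub>m n"
  proof -
    have top: "(m - \<alpha> - 1) * n + n \<le> m * n" by (rule fc.offset_top[OF am])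
    show ?thesis unfolding E_def fc.bcol_def
      by (subst mult_ucol) (use top in \<open>simp_all add: ucol_def, intro eq_matI, auto\<close>)
  qed
  define H where "H = - A"
  define K where "K = - (1\<^sub>m r :: cmat)"
  have HK: "H - x \<cdot>\<^sub>m K = x \<cdot>\<^sub>m 1\<^sub>m r - A" for x unfolding H_def K_def using dims by (intro eq_matI) auto
  have ctrl: "u = 0\<^sub>m 1 r" if "u \<in> carrier_mat 1 r" "u * B = 0\<^sub>m 1 n" "u * A = x \<cdot>\<^sub>m u" for u x
    by (rule minimal_controllable[OF shr min that])
  have sub0: "Z1 = Z2" if "Z1 - Z2 = 0\<^sub>m p q" "Z1 \<in> carrier_mat p q" "Z2 \<in> carrier_mat p q" for Z1 Z2 :: cmat and p q
  proof (rule eq_matI)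
    fix i j assume "i < dim_row Z2" "j < dim_col Z2"
    thus "Z1 $$ (i, j) = Z2 $$ (i, j)" using arg_cong[OF that(1), of "\<lambda>X. X $$ (i, j)"] that(2,3) by simp
  qed (use that in auto)
  \<comment> \<open>As \<open>e\<^sup>T e = I\<close>, a row that annihilates \<open>[B e\<^sup>T, x I - A]\<close> is a left eigenvector of \<open>A\<close> that
    annihilates \<open>B\<close>.\<close>
  have rank1: "vec_space.rank r (four_block_mat (B * transpose_mat E) (H - x \<cdot>\<^sub>m K) (0\<^sub>m 0 (m * n)) (0\<^sub>m 0 r)) = r" for x
  proof (rule full_row_rank)
    show "four_block_mat (B * transpose_mat E) (H - x \<cdot>\<^sub>m K) (0\<^sub>m 0 (m * n)) (0\<^sub>m 0 r) \<in> carrier_mat r (N + r)"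
      by (rule carrier_matI; simp add: dims N_def)
    fix u :: cmat assume u: "u \<in> carrier_mat 1 r"
      and u0: "u * four_block_mat (B * transpose_mat E) (H - x \<cdot>\<^sub>m K) (0\<^sub>m 0 (m * n)) (0\<^sub>m 0 r) = 0\<^sub>m 1 (N + r)"
    note ud = carrier_matD[OF u]
    have "four_block_mat u (0\<^sub>m 1 0) (0\<^sub>m 0 r) (0\<^sub>m 0 0) *
        four_block_mat (B * transpose_mat E) (H - x \<cdot>\<^sub>m K) (0\<^sub>m 0 N) (0\<^sub>m 0 r) =
        four_block_mat (u * (B * transpose_mat E)) (u * (H - x \<cdot>\<^sub>m K)) (0\<^sub>m 0 N) (0\<^sub>m 0 r)"
      unfolding HK by (simp add: mult_four_block_dim mat_trivial ud dims)
    hence z: "four_block_mat (u * (B * transpose_mat E)) (u * (x \<cdot>\<^sub>m 1\<^sub>m r - A)) (0\<^sub>m 0 N) (0\<^sub>m 0 r) = 0\<^sub>m 1 (N + r)"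
      using u0 unfolding HK N_def[symmetric] by (simp add: four_block_empty' ud)
    have z1: "u * (B * transpose_mat E) = 0\<^sub>m 1 N"
    proof (rule eq_matI)
      fix i j assume "i < dim_row (0\<^sub>m 1 N)" "j < dim_col (0\<^sub>m 1 N)"
      thus "(u * (B * transpose_mat E)) $$ (i, j) = 0\<^sub>m 1 N $$ (i, j)"
        using arg_cong[OF z, of "\<lambda>X. X $$ (i, j)"] by (simp add: ud dims)
    qed (simp_all add: ud dims)
    have z2: "u * (x \<cdot>\<^sub>m 1\<^sub>m r - A) = 0\<^sub>m 1 r"
    proof (rule eq_matI)
      fix i j assume "i < dim_row (0\<^sub>m 1 r)" "j < dim_col (0\<^sub>m 1 r)"
      thus "(u * (x \<cdot>\<^sub>m 1\<^sub>m r - A)) $$ (i, j) = 0\<^sub>m 1 r $$ (i, j)"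
        using arg_cong[OF z, of "\<lambda>X. X $$ (i, N + j)"] by (simp add: ud dims)
    qed (simp_all add: ud dims)
    have "u * B = (u * (B * transpose_mat E)) * E"
      by (simp add: mult_assoc_dim ud dims EE mat_trivial)
    hence "u * B = 0\<^sub>m 1 n" unfolding z1 by (simp add: mat_trivial dims)
    moreover have "u * A = x \<cdot>\<^sub>m u"
    proof -
      have "u * (x \<cdot>\<^sub>m 1\<^sub>m r - A) = x \<cdot>\<^sub>m u - u * A"
        by (subst mult_minus_dim(1)) (simp_all add: dims ud smult_mult_dim mat_trivial)
      hence "x \<cdot>\<^sub>m u - u * A = 0\<^sub>m 1 r" using z2 by simp
      hence "x \<cdot>\<^sub>m u = u * A" by (rule sub0) (auto intro!: carrier_matI simp: ud dims)
      thus ?thesis by simp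
    qed
    ultimately show "u = 0\<^sub>m 1 r" by (rule ctrl[OF u])
  qed
  \<comment> \<open>Since \<open>A\<^sup>T J = J A\<close> and \<open>C = B\<^sup>T J\<^sup>T\<close>, an eigenvector \<open>v\<close> of \<open>A\<close> with \<open>C v = 0\<close> yields the left
    eigenvector \<open>(J v)\<^sup>T\<close>, which annihilates \<open>B\<close>.\<close>
  have rank2: "vec_space.rank (m * n + r) ((- (E * C)) @\<^sub>r (H - x \<cdot>\<^sub>m K)) = r" for x
  proof (rule full_col_rank)
    define M where "M = (- (E * C)) @\<^sub>r (H - x \<cdot>\<^sub>m K)"
    have M: "M = four_block_mat (- (E * C)) (0\<^sub>m N 0) (x \<cdot>\<^sub>m 1\<^sub>m r - A) (0\<^sub>m r 0)"
      unfolding M_def append_rows_def HK by (simp add: dims)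
    show "(- (E * C)) @\<^sub>r (H - x \<cdot>\<^sub>m K) \<in> carrier_mat (m * n + r) r"
      unfolding M_def[symmetric] M by (rule carrier_matI; simp add: dims N_def)
    fix v :: cmat assume v: "v \<in> carrier_mat r 1" and "((- (E * C)) @\<^sub>r (H - x \<cdot>\<^sub>m K)) * v = 0\<^sub>m (m * n + r) 1"
    hence v0: "M * v = 0\<^sub>m (N + r) 1" by (simp add: M_def N_def)
    note vd = carrier_matD[OF v]
    have "M * four_block_mat v (0\<^sub>m r 0) (0\<^sub>m 0 1) (0\<^sub>m 0 0) =
        four_block_mat (- (E * C) * v) (0\<^sub>m N 0) ((x \<cdot>\<^sub>m 1\<^sub>m r - A) * v) (0\<^sub>m r 0)"
      unfolding M by (simp add: mult_four_block_dim mat_trivial vd dims)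
    hence z: "four_block_mat (- (E * C) * v) (0\<^sub>m N 0) ((x \<cdot>\<^sub>m 1\<^sub>m r - A) * v) (0\<^sub>m r 0) = 0\<^sub>m (N + r) 1"
      using v0 by (simp add: four_block_empty' vd)
    have z1: "- (E * C) * v = 0\<^sub>m N 1"
    proof (rule eq_matI)
      fix i j assume ij: "i < dim_row (0\<^sub>m N 1)" "j < dim_col (0\<^sub>m N 1)"
      have "(- (E * C) * v) $$ (i, j) =
          four_block_mat (- (E * C) * v) (0\<^sub>m N 0) ((x \<cdot>\<^sub>m 1\<^sub>m r - A) * v) (0\<^sub>m r 0) $$ (i, j)"
        using ij by (simp add: vd dims)
      thus "(- (E * C) * v) $$ (i, j) = 0\<^sub>m N 1 $$ (i, j)" unfolding z using ij by simp
    qed (simp_all add: vd dims)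
    have z2: "(x \<cdot>\<^sub>m 1\<^sub>m r - A) * v = 0\<^sub>m r 1"
    proof (rule eq_matI)
      fix i j assume ij: "i < dim_row (0\<^sub>m r 1)" "j < dim_col (0\<^sub>m r 1)"
      have "((x \<cdot>\<^sub>m 1\<^sub>m r - A) * v) $$ (i, j) =
          four_block_mat (- (E * C) * v) (0\<^sub>m N 0) ((x \<cdot>\<^sub>m 1\<^sub>m r - A) * v) (0\<^sub>m r 0) $$ (N + i, j)"
        using ij by (simp add: vd dims)
      thus "((x \<cdot>\<^sub>m 1\<^sub>m r - A) * v) $$ (i, j) = 0\<^sub>m r 1 $$ (i, j)" unfolding z using ij by simp
    qed (simp_all add: vd dims)
    have "transpose_mat E * (- (E * C) * v) = - ((transpose_mat E * E) * (C * v))"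
      by (simp add: uminus_mult_dim mult_assoc_dim vd dims)
    hence "- (C * v) = transpose_mat E * 0\<^sub>m N 1" unfolding z1 EE by (simp add: mat_trivial vd dims)
    hence Cv: "C * v = 0\<^sub>m n 1" using neg[of "C * v"] by (simp add: mat_trivial dims)
    have Av: "A * v = x \<cdot>\<^sub>m v"
    proof -
      have "(x \<cdot>\<^sub>m 1\<^sub>m r - A) * v = x \<cdot>\<^sub>m v - A * v"
        by (subst mult_minus_dim(2)) (simp_all add: dims vd smult_mult_dim mat_trivial)
      hence "x \<cdot>\<^sub>m v - A * v = 0\<^sub>m r 1" using z2 by simp
      hence "x \<cdot>\<^sub>m v = A * v" by (rule sub0) (auto intro!: carrier_matI simp: vd dims)
      thus ?thesis by simp
    qed
    define u where "u = transpose_mat (J * v)"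
    have u: "u \<in> carrier_mat 1 r" unfolding u_def by (rule carrier_matI; simp add: Jd vd)
    have "u * B = transpose_mat (transpose_mat B * (J * v))"
      unfolding u_def by (simp add: transpose_mult_dim Jd vd dims)
    also have "transpose_mat B * (J * v) = - (C * v)"
      unfolding CJ J(1) by (simp add: mult_assoc_dim uminus_mult_dim Jd vd dims)
    also have "transpose_mat (- (C * v)) = 0\<^sub>m 1 n" unfolding Cv by (rule eq_matI) auto
    finally have uB: "u * B = 0\<^sub>m 1 n" .
    have "u * A = transpose_mat (transpose_mat A * (J * v))"
      unfolding u_def by (simp add: transpose_mult_dim Jd vd dims)
    also have "transpose_mat A * (J * v) = (transpose_mat A * J) * v" by (simp add: mult_assoc_dim Jd vd dims)
    also have "\<dots> = J * (x \<cdot>\<^sub>m v)" unfolding JA Av[symmetric] by (simp add: mult_assoc_dim Jd vd dims)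
    also have "\<dots> = x \<cdot>\<^sub>m (J * v)" by (simp add: smult_mult_dim Jd vd)
    also have "transpose_mat (x \<cdot>\<^sub>m (J * v)) = x \<cdot>\<^sub>m u" unfolding u_def by (rule eq_matI) auto
    finally have "u = 0\<^sub>m 1 r" by (rule ctrl[OF u uB])
    hence "transpose_mat u = 0\<^sub>m r 1" by (simp add: transpose_one_zero)
    hence Jv: "J * v = 0\<^sub>m r 1" by (simp add: u_def)
    have "- v = (J * J) * v" unfolding J(2) by (simp add: uminus_mult_dim mat_trivial vd)
    also have "\<dots> = J * (J * v)" by (simp add: mult_assoc_dim Jd vd)
    also have "\<dots> = 0\<^sub>m r 1" unfolding Jv by (simp add: mat_trivial Jd)
    finally show "v = 0\<^sub>m r 1" using neg[of v] by (simp add: mat_trivial)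
  qed
  have irreducible: "\<exists>X \<in> carrier_mat (m * n) (m * n). \<exists>Y \<in> carrier_mat (m * n) (m * n).
     \<exists>C \<in> carrier_mat (m * n) (2 * l). \<exists>B \<in> carrier_mat (2 * l) (m * n).
     \<exists>H \<in> carrier_mat (2 * l) (2 * l). \<exists>K \<in> carrier_mat (2 * l) (2 * l).
        T = four_block_mat (const_mat X - lam \<cdot>\<^sub>m const_mat Y) (const_mat C)
                           (const_mat B) (const_mat H - lam \<cdot>\<^sub>m const_mat K) \<and>
        invertible_mat K \<and>
        (\<forall>x. vec_space.rank (2 * l)
               (four_block_mat B (H - x \<cdot>\<^sub>m K) (0\<^sub>m 0 (m * n)) (0\<^sub>m 0 (2 * l))) = 2 * l \<and>
             vec_space.rank (m * n + 2 * l) (C @\<^sub>r (H - x \<cdot>\<^sub>m K)) = 2 * l)"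
  proof -
    have e1: "Lp = const_mat (- (Xs * Mw * Y)) - lam \<cdot>\<^sub>m const_mat (- (Xs * Mz * Y))"
    proof -
      have "const_mat Xs * (lam \<cdot>\<^sub>m const_mat Mz - const_mat Mw) * const_mat Y =
          lam \<cdot>\<^sub>m const_mat (Xs * Mz * Y) - const_mat (Xs * Mw * Y)"
        by (simp add: mult_minus_dim smult_mult_dim const_mat_mult Xsd Yd Md)
      also have "\<dots> = const_mat (- (Xs * Mw * Y)) - lam \<cdot>\<^sub>m const_mat (- (Xs * Mz * Y))"
      proof -
        have "c \<cdot>\<^sub>m Z - W = - W - c \<cdot>\<^sub>m (- Z)" if "dim_row Z = N" "dim_col Z = N" "dim_row W = N" "dim_col W = N"
          for c and Z W :: pmat using that by (intro eq_matI) auto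
        thus ?thesis unfolding const_mat_uminus using Xsd Yd by simp
      qed
      finally show ?thesis unfolding Lp .
    qed
    have e2: "- const_mat (E * C) = const_mat (- (E * C))"
      by (rule const_mat_uminus[symmetric])
    have e3: "D = const_mat H - lam \<cdot>\<^sub>m const_mat K"
      unfolding D_def state_pencil_def H_def K_def const_mat_def using dims by (intro eq_matI) auto
    have iK: "invertible_mat K"
      unfolding invertible_mat_def inverts_mat_def K_def
    proof (intro conjI exI[of _ "- 1\<^sub>m r"])
      have "- 1\<^sub>m r * - 1\<^sub>m r = (1\<^sub>m r :: cmat)" by (simp add: uminus_mult_dim neg)
      thus "- 1\<^sub>m r * - 1\<^sub>m r = (1\<^sub>m (dim_row (- 1\<^sub>m r)) :: cmat)" "- 1\<^sub>m r * - 1\<^sub>m r = (1\<^sub>m (dim_row (- 1\<^sub>m r)) :: cmat)"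
        by simp_all
    qed simp
    show ?thesis
    proof (rule bexI[of _ "- (Xs * Mw * Y)"], rule bexI[of _ "- (Xs * Mz * Y)"], rule bexI[of _ "- (E * C)"],
        rule bexI[of _ "B * transpose_mat E"], rule bexI[of _ H], rule bexI[of _ K], intro conjI allI)
      show "T = four_block_mat (const_mat (- (Xs * Mw * Y)) - lam \<cdot>\<^sub>m const_mat (- (Xs * Mz * Y))) (const_mat (- (E * C)))
          (const_mat (B * transpose_mat E)) (const_mat H - lam \<cdot>\<^sub>m const_mat K)"
        unfolding T' e1[symmetric] e2[symmetric] e3[symmetric] ..
    qed (use iK rank1 rank2 in \<open>simp_all add: r_def[symmetric]\<close>,
        (rule carrier_matI; simp add: H_def K_def dims Xsd Yd N_def[symmetric])+)
  qed
  have u0: "const_mat (fc.bcol (min 1 h)) = ucol N ((m - min 1 h - 1) * n) n"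
    "const_mat (fc.brow 0) = transpose_mat (ucol N ((m - 1) * n) n)"
    unfolding fc.bcol_def N_def const_mat_transpose by (simp_all add: const_mat_ucol)
  have finite: "px.port_eqv (m * n) Lp (const_mat (fc.bcol \<alpha>)) (const_mat (fc.brow \<alpha>))
      (dsum (1\<^sub>m ((m - 1) * n)) (matrix_poly n m a))
      (ucol (m * n) ((m - 1) * n) n) (transpose_mat (ucol (m * n) ((m - 1) * n) n))"
    unfolding Lp N_def[symmetric]
  proof (rule px.port_eqv_outer)
    show "px.S_unit N (const_mat Xs)" "px.S_unit N (const_mat Y)" using Xs Y by (auto intro: px_unit_const)
    show "const_mat Xs * ucol N ((m - min 1 h - 1) * n) n = const_mat (fc.bcol \<alpha>)"
      unfolding u0[symmetric] E_def[symmetric] XsE[symmetric] by (rule const_mat_mult[symmetric]) (simp add: Xsd N_def)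
    show "transpose_mat (ucol N ((m - 1) * n) n) * const_mat Y = const_mat (fc.brow \<alpha>)"
      unfolding u0[symmetric] E_def[symmetric] EY[symmetric] by (rule const_mat_mult[symmetric]) (simp add: Yd N_def)
    show "px.port_eqv N (lam \<cdot>\<^sub>m const_mat Mz - const_mat Mw) (ucol N ((m - min 1 h - 1) * n) n)
       (transpose_mat (ucol N ((m - 1) * n) n)) (dsum (1\<^sub>m ((m - 1) * n)) (matrix_poly n m a))
       (ucol N ((m - 1) * n) n) (transpose_mat (ucol N ((m - 1) * n) n))"
      unfolding N_def Mz_def Mw_def by (rule fc.pencil_poly_eqv[OF hm k_def])
  qed
  have Dc: "D \<in> carrier_mat r r" by (rule carrier_matI; simp add: dims)
  note smith = fc.system_equivalence[OF finite Cc B Dc, folded E_def, folded T' S', unfolded r_def]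
  \<comment> \<open>The transfer function contains the inverse of the negative of the lower right block
    \<open>\<lambda> I - A\<close>. This sign cancels against the one of the upper right block.\<close>
  define R where "R = rat_inverse (rat_mat D)"
  note res = resolvent[OF A, folded D_def, folded R_def]
  have Rd: "dim_row R = r" "dim_col R = r" using res(1) by auto
  have Rn: "rat_inverse (rat_mat (- D)) = - R"
  proof (rule rat_inverse_eqI)
    have nn: "- (- Z) = Z" for Z :: rmat by (rule eq_matI) auto
    show "rat_mat (- D) \<in> carrier_mat r r" "- R \<in> carrier_mat r r" by (rule carrier_matI; simp add: dims Rd)+
    show "rat_mat (- D) * - R = 1\<^sub>m r" "- R * rat_mat (- D) = 1\<^sub>m r"
      unfolding rat_mat_uminus by (simp_all add: uminus_mult_dim dims Rd nn res(2,3))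
  qed
  have split: "split_block T (m * n) (m * n) = (Lp, - const_mat (E * C), const_mat (B * transpose_mat E), D)"
    unfolding split_block_def Let_def T'
    by (simp, intro conjI; rule eq_matI; simp add: dims N_def[symmetric])
  have nneg: "- X * - Z = X * Z" if "dim_col X = dim_row Z" for X Z :: rmat
    using that by (intro eq_matI) auto
  have tf: "transfer_function (m * n) T =
      rat_mat Lp + rconst (E * C) * R * rconst (B * transpose_mat E)"
  proof -
    show ?thesis unfolding transfer_function_def split prod.case Rn unfolding rat_mat_uminus by (simp add: nneg dims Rd)
  qed
  define Gs where "Gs = rconst C * R * rconst B"
  have Gsd: "dim_row Gs = n" "dim_col Gs = n" by (simp_all add: Gs_def dims)
  have G': "G = rat_mat (matrix_poly n m a) + Gs" unfolding G Gs_def R_def D_def ..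
  have tf': "transfer_function (m * n) T = rat_mat Lp + rconst E * (Gs * transpose_mat (rconst E))"
    unfolding tf Gs_def
    by (simp add: const_mat_mult rat_mat_mult mult_assoc_dim dims Rd const_mat_transpose rat_mat_transpose)
  have Pd: "dim_row (matrix_poly n m a) = n" "dim_col (matrix_poly n m a) = n" by (simp_all add: matrix_poly_def)
  \<comment> \<open>\<open>G\<^sub>s = G - P\<close> is skew-symmetric because \<open>G\<close> and \<open>P\<close> are, and \<open>e G\<^sub>s e\<^sup>T\<close> is congruent to it.\<close>
  have tsk: "skew_symmetric (transfer_function (m * n) T)"
  proof -
    have P: "transpose_mat (rat_mat (matrix_poly n m a)) = - rat_mat (matrix_poly n m a)"
      unfolding rat_mat_transpose[symmetric] using Psk
      by (simp add: skew_symmetric_def rat_mat_uminus)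
    have "transpose_mat Gs = - Gs"
    proof (rule eq_matI)
      fix i j assume "i < dim_row (- Gs)" "j < dim_col (- Gs)"
      hence ij: "i < n" "j < n" by (simp_all add: Gsd)
      have "G $$ (j, i) = - G $$ (i, j)" "rat_mat (matrix_poly n m a) $$ (j, i) = - rat_mat (matrix_poly n m a) $$ (i, j)"
        using arg_cong[OF G_skew[unfolded skew_symmetric_def], of "\<lambda>X. X $$ (i, j)"]
          arg_cong[OF P, of "\<lambda>X. X $$ (i, j)"] ij Gsd Pd by (simp_all add: G')
      hence "Gs $$ (j, i) = - Gs $$ (i, j)" using ij Gsd Pd by (simp add: G')
      thus "transpose_mat Gs $$ (i, j) = (- Gs) $$ (i, j)" using ij Gsd by simp
    qed (simp_all add: Gsd)
    hence "transpose_mat (rconst E * (Gs * transpose_mat (rconst E))) = - (rconst E * (Gs * transpose_mat (rconst E)))"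
      by (simp add: transpose_mult_dim uminus_mult_dim mult_assoc_dim Gsd dims)
    moreover have "transpose_mat (rat_mat Lp) = - rat_mat Lp"
      unfolding rat_mat_transpose[symmetric] Lsk by (rule rat_mat_uminus)
    moreover have "transpose_mat (X + Z) = - (X + Z)"
      if "transpose_mat X = - X" "transpose_mat Z = - Z" "dim_row X = N" "dim_col X = N" "dim_row Z = N" "dim_col Z = N" for X Z :: rmat
    proof -
      have "transpose_mat (X + Z) = transpose_mat X + transpose_mat Z" using that(3-6) by (intro eq_matI) auto
      also have "\<dots> = - (X + Z)" unfolding that(1,2) using that(3-6) by (intro eq_matI) auto
      finally show ?thesis .
    qed
    ultimately show ?thesis unfolding skew_symmetric_def tf' by (simp add: dims)
  qed
  define \<mu> where "\<mu> = inverse (to_fract lam)"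
  have "Gs \<in> carrier_mat n n" by (rule carrier_matI; simp add: Gsd)
  moreover have "pr.ent Gs"
    unfolding Gs_def by (intro pr.ent_mult rconst_ent res(4)) (simp_all add: dims Rd)
  ultimately obtain U V where U: "pr.S_unit N U" and V: "pr.S_unit N V"
    and UV: "U * (\<mu> \<cdot>\<^sub>m (rat_mat (lam \<cdot>\<^sub>m const_mat Mz - const_mat Mw)
        + ucol N ((m - min 1 h - 1) * n) n * (Gs * transpose_mat (ucol N ((m - 1) * n) n)))) * V
      = dsum (1\<^sub>m ((m - 1) * n)) (\<mu> ^ m \<cdot>\<^sub>m G)"
    using fc.pencil_proper_eqv[OF hm k_def, of Gs "adm_side p\<^sub>z"]
    unfolding G' \<mu>_def N_def Mz_def Mw_def by blast
  define Z where "Z = rat_mat (lam \<cdot>\<^sub>m const_mat Mz - const_mat Mw)"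
  define u where "u = (ucol N ((m - min 1 h - 1) * n) n :: rmat)"
  define v where "v = (transpose_mat (ucol N ((m - 1) * n) n) :: rmat)"
  have Zd: "dim_row Z = N" "dim_col Z = N" "dim_row u = N" "dim_col u = n" "dim_row v = n" "dim_col v = N"
    by (simp_all add: Z_def Md u_def v_def)
  have Eu: "rconst E = rconst Xs * u"
  proof -
    have "rconst (fc.bcol (min 1 h)) = u" unfolding u0(1) u_def by (rule rat_mat_ucol)
    moreover have "rconst (Xs * fc.bcol (min 1 h)) = rconst Xs * rconst (fc.bcol (min 1 h))"
      by (simp add: const_mat_mult rat_mat_mult Xsd N_def)
    ultimately show ?thesis unfolding XsE by simp
  qed
  have Ev: "transpose_mat (rconst E) = v * rconst Y"
  proof -
    have "rconst (fc.brow 0) = v" unfolding u0(2) v_def rat_mat_transpose rat_mat_ucol ..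
    moreover have "rconst (fc.brow 0 * Y) = rconst (fc.brow 0) * rconst Y"
      by (simp add: const_mat_mult rat_mat_mult Yd N_def)
    ultimately show ?thesis unfolding EY by (simp add: const_mat_transpose rat_mat_transpose)
  qed
  have tfZ: "transfer_function (m * n) T = rconst Xs * (Z + u * (Gs * v)) * rconst Y"
  proof -
    have "rat_mat Lp = rconst Xs * Z * rconst Y"
      unfolding Lp Z_def by (simp add: rat_mat_mult Xsd Yd Md)
    thus ?thesis unfolding tf' Ev unfolding Eu
      by (simp add: mult_left_distrib_dim mult_right_distrib_dim mult_assoc_dim Xsd Yd Zd Gsd)
  qed
  \<comment> \<open>The constant factors \<open>sQX\<close> and \<open>Y\<close> are biproper, so that they can be removed.\<close>
  obtain Xi where Xi: "pr.S_unit N Xi" "Xi * rconst Xs = 1\<^sub>m N"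
    using pr_unit_const[OF Xs] by (auto simp: pr.S_unit_def)
  obtain Yi where Yi: "pr.S_unit N Yi" "rconst Y * Yi = 1\<^sub>m N"
    using pr_unit_const[OF Y] by (auto simp: pr.S_unit_def)
  note invd = pr.S_unit_dim[OF Xi(1)] pr.S_unit_dim[OF Yi(1)] pr.S_unit_dim[OF U] pr.S_unit_dim[OF V]
  have infinity: "(U * Xi) * (\<mu> \<cdot>\<^sub>m transfer_function (m * n) T) * (Yi * V) =
      diag_block_mat [1\<^sub>m ((m - 1) * n), \<mu> ^ m \<cdot>\<^sub>m G]"
  proof -
    define W where "W = Z + u * (Gs * v)"
    have Wd: "dim_row W = N" "dim_col W = N" by (simp_all add: W_def Zd)
    have "(U * Xi) * (\<mu> \<cdot>\<^sub>m (rconst Xs * W * rconst Y)) * (Yi * V) =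
        \<mu> \<cdot>\<^sub>m (U * ((Xi * rconst Xs) * (W * ((rconst Y * Yi) * V))))"
      by (simp add: mult_assoc_dim smult_mult_dim Xsd Yd Wd invd)
    also have "\<dots> = U * (\<mu> \<cdot>\<^sub>m W) * V"
      unfolding Xi(2) Yi(2) by (simp add: mult_assoc_dim smult_mult_dim mat_trivial Wd invd)
    also have "\<dots> = dsum (1\<^sub>m ((m - 1) * n)) (\<mu> ^ m \<cdot>\<^sub>m G)"
      unfolding W_def Z_def u_def v_def by (rule UV)
    finally show ?thesis unfolding tfZ W_def diag_block_two .
  qed
  have part2: "rosenbrock_strong_linearization n m (2 * l) S G T"
    unfolding rosenbrock_strong_linearization_def
  proof (intro conjI)
    show "\<exists>O\<^sub>l O\<^sub>r. biproper (m * n) O\<^sub>l \<and> biproper (m * n) O\<^sub>r \<and>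
        O\<^sub>l * (inverse (to_fract lam) \<cdot>\<^sub>m transfer_function (m * n) T) * O\<^sub>r
          = diag_block_mat [1\<^sub>m ((m - 1) * n), (inverse (to_fract lam)) ^ m \<cdot>\<^sub>m G]"
      using infinity biproper_of_unit[OF pr.S_unit_mult[OF U Xi(1)]] biproper_of_unit[OF pr.S_unit_mult[OF Yi(1) V]]
      unfolding \<mu>_def N_def by blast
  qed (rule irreducible, rule smith)
  have part3: "transfer_function (m * n) T =
      rat_mat (const_mat (s \<cdot>\<^sub>m Q) * L)
      + rat_mat (const_mat (kron (e_col m (m - \<alpha>)) (transpose_mat B * transpose_mat (J_mat l))))
        * rat_inverse (rat_mat (state_pencil (2 * l) A))
        * rat_mat (const_mat (kron (transpose_mat (e_col m (m - \<alpha>))) B))"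
    unfolding tf C_def[symmetric] kc Lp_def Qs_def R_def D_def r_def ..
  show ?thesis using part1 part2 part3 tsk by blast
qed


end
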